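(* Fix $D\ge1$ and $k\ge2$, let $(r_n)$ be a sequence in $[0,1/2]$, and suppose that $$n^k r_n^{D(k-1)}\longrightarrow a\in(0,\infty)\qquad(n\to\infty).$$ For $H\in\mathcal H_D^{(k)}$, put $\lambda_H=\dfrac{a\,\gamma_D(H)}{k!}$. For a finite connected graph $H$, let $C_{n,H}$ denote the number of connected components of $G_D(n;r_n)$ isomorphic to $H$. Then the following hold. (i) The vector $\bigl(C_{n,H}:H\in\mathcal H_D^{(k)}\bigr)$ converges jointly in distribution to a vector $\bigl(Z_H:H\in\mathcal H_D^{(k)}\bigr)$ of independent random variables with $Z_H\sim\operatorname{Poisson}(\lambda_H)$. (ii) For every $H\in\mathcal H_{D,k-1}$, $C_{n,H}\to\infty$ in probability. (iii) With high probability every connected component of $G_D(n;r_n)$ has at most $k$ vertices and is isomorphic to a member of $\mathcal H_{D,k}$. Moreover, for a vector $\mathbf m=(m_H)_{H\in\mathcal H_D^{(k)}}$ of nonnegative integers and $N\ge0$, let $F_{\mathbf m,N}$ be the finite graph (disjoint union) consisting of $N$ copies of every graph in $\mathcal H_{D,k-1}$ and exactly $m_H$ copies of $H$ for each $H\in\mathcal H_D^{(k)}$. For every first-order graph sentence $\varphi$, the truth value of $F_{\mathbf m,N}\models\varphi$ is constant for all sufficiently large $N$; denote this eventual truth value by $b_\varphi(\mathbf m)\in\{0,1\}$. Then $$\lim_{n\to\infty}\mathbb P(G_D(n;r_n)\models\varphi)=\sum_{\mathbf m}b_\varphi(\mathbf m)\prod_{H\in\mathcal H_D^{(k)}}e^{-\lambda_H}\frac{\lambda_H^{m_H}}{m_H!},$$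 where the sum ranges over all vectors $\mathbf m=(m_H)_{H\in\mathcal H_D^{(k)}}$ of nonnegative integers. In particular, $G_D(n;r_n)$ satisfies a first-order convergence law but not a first-order zero-one law.
   Context: Let $\mathbb T^D=(\mathbb R/\mathbb Z)^D$, with torus $L^\infty$ metric $d_\infty(x,y)=\max_{1\le i\le D}\|x_i-y_i\|_{\mathbb T}$, where $\|t\|_{\mathbb T}=\min_{m\in\mathbb Z}|t-m|$. Let $X_1,\dots,X_n$ be independent uniform random points of $\mathbb T^D$. For $0\le r\le1/2$, $G_D(n;r)$ is the simple graph on $[n]=\{1,\dots,n\}$ in which distinct $i,j$ are adjacent iff $d_\infty(X_i,X_j)\le r$. A finite connected graph $H$ is strictly $D$-geometric if either $H=K_1$ or, after writing $V(H)=\{1,\dots,s\}$, there are points $z_1,\dots,z_s\in\mathbb R^D$ such that for every $i<j$: $ij\in E(H)\Rightarrow\|z_i-z_j\|_\infty<1$, and $ij\notin E(H)\Rightarrow\|z_i-z_j\|_\infty>1$. For $s\ge1$, $\mathcal H_D^{(s)}$ is a fixed set of representatives of the isomorphism classes of strictly $D$-geometric connected graphs on exactly $s$ vertices, and $\mathcal H_{D,k}=\bigcup_{1\le s\le k}\mathcal H_D^{(s)}$. For points $0,z_2,\dots,z_s\in\mathbb R^D$, $G_\infty(0,z_2,\dots,z_s)$ is the graph on these $s$ (labelled) points in which two points are adjacent exactly when their $L^\infty$-distance is at most $1$. For a finite connected graph $H$ on $s$ vertices, $$\gamma_D(H)=\int_{(\mathbb R^D)^{s-1}}\mathbf 1\{G_\infty(0,z_2,\dots,z_s)\cong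 H\}\,dz_2\cdots dz_s,$$ with $\gamma_D(K_1)=1$. Graphs are regarded as structures in the first-order language with equality and one binary relation symbol $E$. A sequence of random graphs satisfies a first-order convergence law if the probability of every first-order graph sentence has a limit as $n\to\infty$, and a first-order zero-one law if each of these limits exists and is $0$ or $1$. "With high probability" means with probability tending to $1$; $Y_n\to\infty$ in probability means $\mathbb P(Y_n\ge M)\to1$ for every $M$. $\operatorname{Poisson}(\lambda)$ is the Poisson distribution with mean $\lambda$. *)

theory Defs
  imports "HOL-Probability.Probability"
begin

section \<open>Finite simple graphs\<close>

text \<open>A graph carries its vertex set and its adjacency relation as a set of ordered pairs; the
  latter also interprets the binary relation symbol of the first-order language.\<close>

datatype 'a graph = Graph (verts: "'a set") (adj: "'a rel")

definition finite_simple_graph :: "'a graph \<Rightarrow> bool" where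
  "finite_simple_graph G \<longleftrightarrow>
     finite (verts G) \<and> adj G \<subseteq> verts G \<times> verts G \<and> sym (adj G) \<and> irrefl (adj G)"

definition connected_graph :: "'a graph \<Rightarrow> bool" where
  "connected_graph G \<longleftrightarrow>
     verts G \<noteq> {} \<and> (\<forall>u\<in>verts G. \<forall>v\<in>verts G. (u, v) \<in> (adj G)\<^sup>*)"

definition induced_subgraph :: "'a graph \<Rightarrow> 'a set \<Rightarrow> 'a graph" where
  "induced_subgraph G C = Graph C (adj G \<inter> C \<times> C)"

definition component_sets :: "'a graph \<Rightarrow> 'a set set" where
  "component_sets G = (\<lambda>u. {v \<in> verts G. (u, v) \<in> (adj G)\<^sup>*}) ` verts G"

definition graph_iso :: "'a graph \<Rightarrow> 'b graph \<Rightarrow> bool"  (infix \<open>\<simeq>\<close> 50) where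
  "G \<simeq> H \<longleftrightarrow> (\<exists>f. bij_betw f (verts G) (verts H) \<and>
     (\<forall>u\<in>verts G. \<forall>v\<in>verts G. (u, v) \<in> adj G \<longleftrightarrow> (f u, f v) \<in> adj H))"

definition component_count :: "'a graph \<Rightarrow> 'b graph \<Rightarrow> nat" where
  "component_count G H = card {C \<in> component_sets G. induced_subgraph G C \<simeq> H}"

text \<open>Disjoint union of \<open>c H\<close> copies of every \<open>H \<in> S\<close>; the vertex \<open>(H, i, v)\<close> is the vertex
  \<open>v\<close> of the \<open>i\<close>-th copy of \<open>H\<close>.\<close>

definition disjoint_copies ::
  "'a graph set \<Rightarrow> ('a graph \<Rightarrow> nat) \<Rightarrow> ('a graph \<times> nat \<times> 'a) graph" where
  "disjoint_copies S c = Graph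
     {(H, i, v). H \<in> S \<and> i < c H \<and> v \<in> verts H}
     {((H, i, u), (H', j, v)). H \<in> S \<and> H' = H \<and> i < c H \<and> j = i \<and> (u, v) \<in> adj H}"


section \<open>First-order logic of graphs\<close>

datatype fo = Equal nat nat | Edge nat nat | Neg fo | Conj fo fo | Exists nat fo

primrec free_vars :: "fo \<Rightarrow> nat set" where
  "free_vars (Equal x y) = {x, y}"
| "free_vars (Edge x y) = {x, y}"
| "free_vars (Neg p) = free_vars p"
| "free_vars (Conj p q) = free_vars p \<union> free_vars q"
| "free_vars (Exists x p) = free_vars p - {x}"

definition sentence :: "fo \<Rightarrow> bool" where
  "sentence p \<longleftrightarrow> free_vars p = {}"

primrec sat :: "'a graph \<Rightarrow> (nat \<Rightarrow> 'a) \<Rightarrow> fo \<Rightarrow> bool" where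
  "sat G e (Equal x y) \<longleftrightarrow> e x = e y"
| "sat G e (Edge x y) \<longleftrightarrow> (e x, e y) \<in> adj G"
| "sat G e (Neg p) \<longleftrightarrow> \<not> sat G e p"
| "sat G e (Conj p q) \<longleftrightarrow> sat G e p \<and> sat G e q"
| "sat G e (Exists x p) \<longleftrightarrow> (\<exists>v\<in>verts G. sat G (e(x := v)) p)"

text \<open>Only used for sentences, whose truth value does not depend on the assignment. Assignments
  are not required to take values in \<open>verts G\<close>, so that the empty graph is treated correctly.\<close>

definition models :: "'a graph \<Rightarrow> fo \<Rightarrow> bool"  (infix \<open>\<Turnstile>\<close> 50) where
  "G \<Turnstile> p \<longleftrightarrow> (\<forall>e. sat G e p)"

definition sentence_prob :: "'w measure \<Rightarrow> ('w \<Rightarrow> 'a graph) \<Rightarrow> fo \<Rightarrow> real" where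
  "sentence_prob M G p = measure M {\<omega> \<in> space M. G \<omega> \<Turnstile> p}"

definition fo_convergence_law :: "(nat \<Rightarrow> 'w measure) \<Rightarrow> (nat \<Rightarrow> 'w \<Rightarrow> 'a graph) \<Rightarrow> bool" where
  "fo_convergence_law M G \<longleftrightarrow>
     (\<forall>p. sentence p \<longrightarrow> convergent (\<lambda>n. sentence_prob (M n) (G n) p))"

definition fo_zero_one_law :: "(nat \<Rightarrow> 'w measure) \<Rightarrow> (nat \<Rightarrow> 'w \<Rightarrow> 'a graph) \<Rightarrow> bool" where
  "fo_zero_one_law M G \<longleftrightarrow>
     (\<forall>p. sentence p \<longrightarrow>
        (\<exists>l\<in>{0, 1}. (\<lambda>n. sentence_prob (M n) (G n) p) \<longlonglongrightarrow> l))"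


section \<open>Modes of convergence\<close>

definition with_high_probability ::
  "(nat \<Rightarrow> 'w measure) \<Rightarrow> (nat \<Rightarrow> 'w \<Rightarrow> bool) \<Rightarrow> bool" where
  "with_high_probability M P \<longleftrightarrow>
     (\<lambda>n. measure (M n) {\<omega> \<in> space (M n). P n \<omega>}) \<longlonglongrightarrow> 1"

definition to_infinity_in_probability ::
  "(nat \<Rightarrow> 'w measure) \<Rightarrow> (nat \<Rightarrow> 'w \<Rightarrow> real) \<Rightarrow> bool" where
  "to_infinity_in_probability M Y \<longleftrightarrow>
     (\<forall>b. with_high_probability M (\<lambda>n \<omega>. Y n \<omega> \<ge> b))"

text \<open>Convergence in distribution of random elements \<open>Y n\<close> (on the probability spaces \<open>M n\<close>) to
  the law \<open>L\<close>. The library only has this notion for real random variables; here it is applied to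
  \<open>'i \<Rightarrow> nat\<close> with the product of the discrete topologies.\<close>

definition converges_in_distribution ::
  "(nat \<Rightarrow> 'w measure) \<Rightarrow> (nat \<Rightarrow> 'w \<Rightarrow> 'b::topological_space) \<Rightarrow> 'b measure \<Rightarrow> bool" where
  "converges_in_distribution M Y L \<longleftrightarrow>
     (\<forall>f :: 'b \<Rightarrow> real. continuous_on UNIV f \<and> bounded (range f) \<longrightarrow>
        (\<lambda>n. \<integral>\<omega>. f (Y n \<omega>) \<partial>M n) \<longlonglongrightarrow> (\<integral>y. f y \<partial>L))"


section \<open>Random geometric graphs on the torus\<close>

text \<open>The dimension is \<open>D = CARD('d)\<close>. Points of the torus are given by representatives in
  \<open>real ^ 'd\<close>; uniform points have representatives uniform on the half-open unit cube.\<close>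

definition circle_norm :: "real \<Rightarrow> real" where
  "circle_norm t = (INF m::int. \<bar>t - of_int m\<bar>)"

definition torus_dist :: "real ^ 'd \<Rightarrow> real ^ 'd \<Rightarrow> real" where
  "torus_dist x y = Max (range (\<lambda>i. circle_norm (x $ i - y $ i)))"

definition uniform_torus :: "(real ^ 'd) measure" where
  "uniform_torus = uniform_measure lborel {x. \<forall>i. x $ i \<in> {0..<1}}"

definition torus_graph :: "nat \<Rightarrow> real \<Rightarrow> (nat \<Rightarrow> real ^ 'd) \<Rightarrow> nat graph" where
  "torus_graph n r x = Graph {1..n}
     {(i, j). i \<in> {1..n} \<and> j \<in> {1..n} \<and> i \<noteq> j \<and> torus_dist (x i) (x j) \<le> r}"

definition random_torus_graph ::
  "(nat \<Rightarrow> real) \<Rightarrow> (nat \<Rightarrow> nat \<Rightarrow> 'w \<Rightarrow> real ^ 'd) \<Rightarrow> nat \<Rightarrow> 'w \<Rightarrow> nat graph" where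
  "random_torus_graph r X n \<omega> = torus_graph n (r n) (\<lambda>i. X n i \<omega>)"


section \<open>Strictly geometric graphs\<close>

text \<open>On \<open>real ^ 'd\<close> the library's \<open>infnorm\<close> is the maximum norm.\<close>

definition strictly_geometric :: "'d::finite itself \<Rightarrow> 'a graph \<Rightarrow> bool" where
  "strictly_geometric D H \<longleftrightarrow>
     finite_simple_graph H \<and> connected_graph H \<and>
     (card (verts H) = 1 \<or>
      (\<exists>z :: 'a \<Rightarrow> real ^ 'd. \<forall>u\<in>verts H. \<forall>v\<in>verts H. u \<noteq> v \<longrightarrow>
         ((u, v) \<in> adj H \<longrightarrow> infnorm (z u - z v) < 1) \<and>
         ((u, v) \<notin> adj H \<longrightarrow> infnorm (z u - z v) > 1)))"

definition iso_representatives :: "'a graph set \<Rightarrow> 'a graph set \<Rightarrow> bool" where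
  "iso_representatives \<G> R \<longleftrightarrow> R \<subseteq> \<G> \<and> (\<forall>G\<in>\<G>. \<exists>!H. H \<in> R \<and> G \<simeq> H)"

text \<open>Every finite graph is isomorphic to one with vertices in \<open>nat\<close>, so representatives are
  taken there.\<close>

definition strictly_geometric_graphs :: "'d::finite itself \<Rightarrow> nat \<Rightarrow> nat graph set" where
  "strictly_geometric_graphs D s = {H. strictly_geometric D H \<and> card (verts H) = s}"

definition up_to :: "(nat \<Rightarrow> 'a graph set) \<Rightarrow> nat \<Rightarrow> 'a graph set" where
  "up_to \<H> k = (\<Union>s\<in>{1..k}. \<H> s)"

definition euclidean_graph :: "nat \<Rightarrow> (nat \<Rightarrow> real ^ 'd) \<Rightarrow> nat graph" where
  "euclidean_graph s z = Graph {1..s}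
     {(i, j). i \<in> {1..s} \<and> j \<in> {1..s} \<and> i \<noteq> j \<and> infnorm (z i - z j) \<le> 1}"

text \<open>The integration variables are \<open>z 2, \<dots>, z s\<close>, while \<open>z 1 = 0\<close>. For a one-vertex graph the
  product measure is the unit mass on a single point, and the value is \<open>1\<close>.\<close>

definition geometric_constant :: "'d::finite itself \<Rightarrow> 'a graph \<Rightarrow> real" where
  "geometric_constant D H =
     (let s = card (verts H) in
        \<integral>z. of_bool (euclidean_graph s (z(1 := 0)) \<simeq> H)
          \<partial>(Pi\<^sub>M {2..s} (\<lambda>_. lborel :: (real ^ 'd) measure)))"

definition poisson_rate :: "'d::finite itself \<Rightarrow> real \<Rightarrow> 'a graph \<Rightarrow> real" where
  "poisson_rate D a H = a * geometric_constant D H / fact (card (verts H))"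


section \<open>The limiting finite graphs\<close>

definition limit_graph ::
  "(nat \<Rightarrow> 'a graph set) \<Rightarrow> nat \<Rightarrow> ('a graph \<Rightarrow> nat) \<Rightarrow> nat \<Rightarrow> ('a graph \<times> nat \<times> 'a) graph" where
  "limit_graph \<H> k m N =
     disjoint_copies (up_to \<H> (k - 1) \<union> \<H> k) (\<lambda>H. if H \<in> \<H> k then m H else N)"

definition eventual_truth ::
  "(nat \<Rightarrow> 'a graph set) \<Rightarrow> nat \<Rightarrow> fo \<Rightarrow> ('a graph \<Rightarrow> nat) \<Rightarrow> real" where
  "eventual_truth \<H> k p m = of_bool (\<forall>\<^sub>F N in sequentially. limit_graph \<H> k m N \<Turnstile> p)"

text \<open>Vectors indexed by a finite set \<open>A\<close> are functions that vanish outside \<open>A\<close>.\<close>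

definition vectors :: "'i set \<Rightarrow> ('i \<Rightarrow> nat) set" where
  "vectors A = {m. \<forall>i. i \<notin> A \<longrightarrow> m i = 0}"

definition count_vector :: "'b graph set \<Rightarrow> 'a graph \<Rightarrow> 'b graph \<Rightarrow> nat" where
  "count_vector A G = (\<lambda>H. if H \<in> A then component_count G H else 0)"

end

theory Submission
  imports Defs
begin

text \<open>Write \<open>x = n r^D\<close>; the hypothesis says \<open>n x^(k-1) \<rightarrow> a\<close>, so \<open>x \<rightarrow> 0\<close>. A connected set of \<open>s\<close>
  points fits into a small box, where the torus is flat; rescaling by \<open>1/r\<close> shows that a given
  set of \<open>s\<close> points induces a copy of a connected \<open>H\<close> with probability \<open>r^(D(s-1)) \<gamma>(H)\<close>.

  Removing one component isomorphic to \<open>H\<close> leaves an independent graph which, up to an error of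
  order \<open>x\<close>, has the law of the original one. Hence the vector \<open>C\<close> of counts satisfies
  \<open>m H * P(C = m) = \<mu> H * (P(C = m - e\<^sub>H) + O(x))\<close>, where \<open>\<mu> H\<close> is the expected number of
  induced copies of \<open>H\<close>. On \<open>k\<close> vertices \<open>\<mu> H \<rightarrow> \<lambda> H\<close>, and the limiting recursion together with
  tightness characterises the product of Poisson laws. On fewer vertices \<open>\<mu> H \<rightarrow> \<infinity>\<close>, and dividing
  by \<open>\<mu> H\<close> shows that every fixed value of the count has vanishing probability.

  A first-order sentence of quantifier depth \<open>q\<close> does not distinguish two graphs in which every
  isomorphism type of component occurs equally often or at least \<open>q\<close> times in both. So its truth
  is asymptotically a function of the Poisson vector. Existence of a \<open>k\<close>-clique
  has a limiting probability strictly between 0 and 1.\<close>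


section \<open>Graph isomorphism and components\<close>


text \<open>The recursion links each mass only to those of smaller vectors, so it determines the law
  up to the factor carried by the zero vector. That this factor tends to 1 is a separate argument:
  Markov's inequality gives tightness, and masses that are nearly proportional to a probability law
  on a large finite set carrying almost all of both are nearly equal to it. Comparing the graph left
  after a removal with the original one costs only the event that some removed vertex has a
  neighbour, provided that isolated vertices are not themselves counted. Hence the recursion is
  confined to types with at least two vertices; one-vertex components are treated directly.
  Strictness in the definition of the admissible graphs is used twice: a configuration realising
  such a graph may be perturbed, so its limiting rate is positive; and two points lie at distance
  exactly \<open>r\<close> with probability 0, so no other small component occurs. Larger components
  are excluded by a first moment, as \<open>n x^k\<close> tends to 0. The clique is a good test
  because in a graph whose components have at most \<open>k\<close> vertices a
  \<open>k\<close>-clique fills a component.\<close>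

lemma graph_iso_refl [simp]: "G \<simeq> G"
  unfolding graph_iso_def by (rule exI[of _ id]) auto

lemma graph_iso_sym: "G \<simeq> H \<Longrightarrow> H \<simeq> G"
proof -
  assume "G \<simeq> H"
  then obtain f where f: "bij_betw f (verts G) (verts H)"
    "\<forall>u\<in>verts G. \<forall>v\<in>verts G. (u, v) \<in> adj G \<longleftrightarrow> (f u, f v) \<in> adj H"
    unfolding graph_iso_def by blast
  let ?g = "the_inv_into (verts G) f"
  have g: "bij_betw ?g (verts H) (verts G)"
    by (rule bij_betw_the_inv_into[OF f(1)])
  have "(u, v) \<in> adj H \<longleftrightarrow> (?g u, ?g v) \<in> adj G" if "u \<in> verts H" "v \<in> verts H" for u v
  proof -
    have "?g u \<in> verts G" "?g v \<in> verts G" using g that by (auto simp: bij_betw_def)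
    moreover have "f (?g u) = u" "f (?g v) = v"
      using f(1) that by (auto simp: bij_betw_def f_the_inv_into_f)
    ultimately show ?thesis using f(2) by metis
  qed
  with g show ?thesis unfolding graph_iso_def by blast
qed

lemma graph_iso_trans: "G \<simeq> H \<Longrightarrow> H \<simeq> K \<Longrightarrow> G \<simeq> K"
proof -
  assume "G \<simeq> H" "H \<simeq> K"
  then obtain f g where f: "bij_betw f (verts G) (verts H)"
    "\<forall>u\<in>verts G. \<forall>v\<in>verts G. (u, v) \<in> adj G \<longleftrightarrow> (f u, f v) \<in> adj H"
    and g: "bij_betw g (verts H) (verts K)"
    "\<forall>u\<in>verts H. \<forall>v\<in>verts H. (u, v) \<in> adj H \<longleftrightarrow> (g u, g v) \<in> adj K"
    unfolding graph_iso_def by blast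
  have "bij_betw (g \<circ> f) (verts G) (verts K)" using f(1) g(1) by (rule bij_betw_trans)
  moreover have "(u, v) \<in> adj G \<longleftrightarrow> ((g \<circ> f) u, (g \<circ> f) v) \<in> adj K"
    if "u \<in> verts G" "v \<in> verts G" for u v
  proof -
    have "f u \<in> verts H" "f v \<in> verts H" using f(1) that by (auto simp: bij_betw_def)
    then show ?thesis using f(2) g(2) that by simp
  qed
  ultimately show ?thesis unfolding graph_iso_def by blast
qed

lemma graph_iso_card: "G \<simeq> H \<Longrightarrow> card (verts G) = card (verts H)"
  unfolding graph_iso_def using bij_betw_same_card by blast

lemma graph_iso_finite: "G \<simeq> H \<Longrightarrow> finite (verts G) \<longleftrightarrow> finite (verts H)"
  unfolding graph_iso_def using bij_betw_finite by blast

text \<open>\<open>graph_iso\<close> says nothing about pairs outside the vertex sets, so a path is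
  transported edge by edge only if all edges of \<open>G\<close> join vertices; hence the last
  premise.\<close>

lemma graph_iso_connected:
  assumes "G \<simeq> H" "connected_graph G" "adj G \<subseteq> verts G \<times> verts G"
  shows "connected_graph H"
proof -
  obtain f where f: "bij_betw f (verts G) (verts H)"
    "\<forall>u\<in>verts G. \<forall>v\<in>verts G. (u, v) \<in> adj G \<longleftrightarrow> (f u, f v) \<in> adj H"
    using assms(1) unfolding graph_iso_def by blast
  have path: "(f u, f v) \<in> (adj H)\<^sup>*" if "(u, v) \<in> (adj G)\<^sup>*" for u v
    using that
  proof (induction rule: rtrancl_induct)
    case (step y z)
    with assms(3) f(2) have "(f y, f z) \<in> adj H" by blast
    with step show ?case by (meson rtrancl.rtrancl_into_rtrancl)
  qed simp
  show ?thesis unfolding connected_graph_def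
  proof (intro conjI ballI)
    show "verts H \<noteq> {}" using assms(2) f(1) unfolding connected_graph_def bij_betw_def by blast
    fix u v assume "u \<in> verts H" "v \<in> verts H"
    then obtain u' v' where "u = f u'" "v = f v'" "u' \<in> verts G" "v' \<in> verts G"
      using f(1) unfolding bij_betw_def by blast
    with path assms(2) show "(u, v) \<in> (adj H)\<^sup>*" unfolding connected_graph_def by blast
  qed
qed

lemma verts_induced [simp]: "verts (induced_subgraph G C) = C"
  and adj_induced [simp]: "adj (induced_subgraph G C) = adj G \<inter> C \<times> C"
  by (simp_all add: induced_subgraph_def)

lemma induced_subgraph_verts:
  "adj G \<subseteq> verts G \<times> verts G \<Longrightarrow> induced_subgraph G (verts G) = G"
  by (cases G) (auto simp: induced_subgraph_def)

lemma induced_subgraph_nested: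
  "B \<subseteq> A \<Longrightarrow> induced_subgraph (induced_subgraph G A) B = induced_subgraph G B"
  by (auto simp: induced_subgraph_def)

lemma finite_simple_induced:
  "finite_simple_graph G \<Longrightarrow> C \<subseteq> verts G \<Longrightarrow> finite_simple_graph (induced_subgraph G C)"
  unfolding finite_simple_graph_def
  by (auto simp: sym_def irrefl_def intro: finite_subset)

lemma finite_simple_iso:
  assumes "G \<simeq> H" "finite_simple_graph G" "adj H \<subseteq> verts H \<times> verts H"
  shows "finite_simple_graph H"
proof -
  obtain f where f: "bij_betw f (verts H) (verts G)"
    "\<forall>u\<in>verts H. \<forall>v\<in>verts H. (u, v) \<in> adj H \<longleftrightarrow> (f u, f v) \<in> adj G"
    using graph_iso_sym[OF assms(1)] unfolding graph_iso_def by blast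
  have fin: "finite (verts H)" using assms graph_iso_finite finite_simple_graph_def by blast
  have "sym (adj H)"
  proof (rule symI)
    fix u v assume uv: "(u, v) \<in> adj H"
    hence "u \<in> verts H" "v \<in> verts H" using assms(3) by auto
    then show "(v, u) \<in> adj H" using uv f(2) assms(2)
      unfolding finite_simple_graph_def by (meson symD)
  qed
  moreover have "irrefl (adj H)"
  proof (rule irreflI)
    fix u show "(u, u) \<notin> adj H" using assms(2,3) f(2)
      unfolding finite_simple_graph_def irrefl_def by blast
  qed
  ultimately show ?thesis using fin assms(3) unfolding finite_simple_graph_def by auto
qed

section \<open>Isolated sets and connected components\<close>

definition isolated_set :: "'a graph \<Rightarrow> 'a set \<Rightarrow> bool" where
  "isolated_set G C \<longleftrightarrow> C \<subseteq> verts G \<and> (\<forall>u\<in>C. \<forall>v\<in>verts G - C. (u, v) \<notin> adj G)"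

lemma isolated_set_closed:
  assumes "isolated_set G C" "adj G \<subseteq> verts G \<times> verts G" "(u, v) \<in> (adj G)\<^sup>*" "u \<in> C"
  shows "v \<in> C \<and> (u, v) \<in> (adj G \<inter> C \<times> C)\<^sup>*"
  using assms(3,4)
proof (induction rule: rtrancl_induct)
  case (step y z)
  then have "z \<in> C" using assms(1,2) unfolding isolated_set_def by blast
  with step have "(y, z) \<in> adj G \<inter> C \<times> C" by blast
  with step \<open>z \<in> C\<close> show ?case by (meson rtrancl.rtrancl_into_rtrancl)
qed simp

text \<open>This separates a condition on the graph induced on \<open>C\<close> from one on the
  edges that leave \<open>C\<close>. The probability of the first is computed exactly; the failure
  of the second is bounded given the first.\<close>

lemma component_sets_iff:
  assumes G: "adj G \<subseteq> verts G \<times> verts G" "sym (adj G)"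
  shows "C \<in> component_sets G \<longleftrightarrow> isolated_set G C \<and> connected_graph (induced_subgraph G C)"
proof
  assume "C \<in> component_sets G"
  then obtain u where u: "u \<in> verts G" and C: "C = {v \<in> verts G. (u, v) \<in> (adj G)\<^sup>*}"
    unfolding component_sets_def by blast
  have iso: "isolated_set G C"
    unfolding isolated_set_def C by (auto intro: rtrancl.rtrancl_into_rtrancl)
  have "(v, w) \<in> (adj G \<inter> C \<times> C)\<^sup>*" if "v \<in> C" "w \<in> C" for v w
  proof -
    have "(v, u) \<in> (adj G)\<^sup>*" using that(1) C sym_rtrancl[OF G(2)] by (auto dest: symD)
    also have "(u, w) \<in> (adj G)\<^sup>*" using that C by auto
    finally show ?thesis using isolated_set_closed[OF iso G(1)] that by blast
  qed
  moreover have "C \<noteq> {}" using u C by auto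
  ultimately show "isolated_set G C \<and> connected_graph (induced_subgraph G C)"
    using iso unfolding connected_graph_def by simp
next
  assume *: "isolated_set G C \<and> connected_graph (induced_subgraph G C)"
  then obtain u where u: "u \<in> C" unfolding connected_graph_def by auto
  have sub: "C \<subseteq> verts G" using * unfolding isolated_set_def by blast
  have "C = {v \<in> verts G. (u, v) \<in> (adj G)\<^sup>*}"
  proof (intro equalityI subsetI CollectI conjI)
    fix v assume "v \<in> C"
    then show "v \<in> verts G" using sub by blast
    have "(u, v) \<in> (adj G \<inter> C \<times> C)\<^sup>*" using * u \<open>v \<in> C\<close> unfolding connected_graph_def by simp
    then show "(u, v) \<in> (adj G)\<^sup>*" by (meson Int_lower1 in_mono rtrancl_mono)
  next
    fix v assume "v \<in> {v \<in> verts G. (u, v) \<in> (adj G)\<^sup>*}"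
    then show "v \<in> C" using isolated_set_closed[of G C u v] * G u by blast
  qed
  then show "C \<in> component_sets G" using u sub unfolding component_sets_def by blast
qed

text \<open>No path leaves an isolated set, so a component cannot cross its border. Applied to two
  components it gives that they are equal or disjoint.\<close>

lemma component_sets_disjoint:
  assumes G: "adj G \<subseteq> verts G \<times> verts G" "sym (adj G)"
    and "C \<in> component_sets G" "isolated_set G W" "C \<inter> W \<noteq> {}"
  shows "C \<subseteq> W"
proof
  fix v assume v: "v \<in> C"
  obtain u where u: "u \<in> C" "u \<in> W" using assms by blast
  have "(u, v) \<in> (adj G \<inter> C \<times> C)\<^sup>*"
    using assms(3) u v unfolding component_sets_iff[OF G] connected_graph_def by simp
  then have "(u, v) \<in> (adj G)\<^sup>*" by (meson Int_lower1 in_mono rtrancl_mono)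
  with isolated_set_closed[OF assms(4) G(1)] u show "v \<in> W" by blast
qed

lemma ex_component:
  assumes G: "adj G \<subseteq> verts G \<times> verts G" "sym (adj G)" and "v \<in> verts G"
  obtains C where "C \<in> component_sets G" "v \<in> C"
  using assms(3) unfolding component_sets_def by blast

lemma isolated_set_Un: "isolated_set G A \<Longrightarrow> isolated_set G B \<Longrightarrow> isolated_set G (A \<union> B)"
  unfolding isolated_set_def by blast

lemma component_sets_subset: "component_sets G \<subseteq> Pow (verts G)"
  unfolding component_sets_def by blast

lemma component_sets_nonempty: "C \<in> component_sets G \<Longrightarrow> C \<noteq> {}"
  unfolding component_sets_def by blast

lemma component_sets_iso:
  assumes "adj G \<subseteq> verts G \<times> verts G" "sym (adj G)"
    and "connected_graph H" "adj H \<subseteq> verts H \<times> verts H" "induced_subgraph G C \<simeq> H"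
  shows "C \<in> component_sets G \<longleftrightarrow> isolated_set G C"
proof -
  have "connected_graph (induced_subgraph G C)"
    using graph_iso_connected[OF graph_iso_sym[OF assms(5)] assms(3,4)] .
  then show ?thesis unfolding component_sets_iff[OF assms(1,2)] by blast
qed

section \<open>Deletion of vertices and its effect on component counts\<close>

definition delete_verts :: "'a graph \<Rightarrow> 'a set \<Rightarrow> 'a graph" where
  "delete_verts G S = induced_subgraph G (verts G - S)"

lemma finite_simple_delete: "finite_simple_graph G \<Longrightarrow> finite_simple_graph (delete_verts G S)"
  unfolding delete_verts_def by (rule finite_simple_induced) auto

lemma verts_delete [simp]: "verts (delete_verts G S) = verts G - S"
  by (simp add: delete_verts_def)

lemma isolated_set_delete:
  assumes "isolated_set G S"  "sym (adj G)"
  shows "isolated_set (delete_verts G S) C \<longleftrightarrow> isolated_set G C \<and> C \<inter> S = {}"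
  using assms unfolding isolated_set_def delete_verts_def sym_def by simp blast

lemma delete_delete: "delete_verts (delete_verts G S) T = delete_verts G (S \<union> T)"
  unfolding delete_verts_def by (auto simp: induced_subgraph_def)

lemma induced_delete:
  "C \<inter> S = {} \<Longrightarrow> C \<subseteq> verts G \<Longrightarrow> induced_subgraph (delete_verts G S) C = induced_subgraph G C"
  unfolding delete_verts_def by (rule induced_subgraph_nested) auto

lemma component_sets_delete:
  assumes G: "adj G \<subseteq> verts G \<times> verts G" "sym (adj G)" and S: "isolated_set G S"
  shows "component_sets (delete_verts G S) = {C \<in> component_sets G. C \<inter> S = {}}"
proof -
  have D: "adj (delete_verts G S) \<subseteq> verts (delete_verts G S) \<times> verts (delete_verts G S)"
    "sym (adj (delete_verts G S))"
    using G unfolding delete_verts_def by (auto simp: sym_def)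
  have "induced_subgraph (delete_verts G S) C = induced_subgraph G C"
    if "isolated_set (delete_verts G S) C" for C
    by (rule induced_delete) (use that in \<open>auto simp: isolated_set_def\<close>)
  then show ?thesis
    using component_sets_iff[OF D] component_sets_iff[OF G] isolated_set_delete[OF S G(2)] by auto
qed

text \<open>Source of the recursion for the counts and of the bookkeeping in the game: the other
  components survive unchanged, so exactly one isomorphism type loses one copy.\<close>

lemma component_count_delete:
  assumes G: "finite_simple_graph G" and S: "S \<in> component_sets G"
  shows "component_count G H = component_count (delete_verts G S) H +
    of_bool (induced_subgraph G S \<simeq> H)"
proof -
  have G': "adj G \<subseteq> verts G \<times> verts G" "sym (adj G)"
    using G unfolding finite_simple_graph_def by auto
  have Si: "isolated_set G S" "S \<noteq> {}" using S component_sets_iff[OF G'] component_sets_nonempty by auto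
  let ?A = "{C \<in> component_sets G. C \<inter> S = {} \<and> induced_subgraph G C \<simeq> H}"
  have 1: "{C \<in> component_sets (delete_verts G S). induced_subgraph (delete_verts G S) C \<simeq> H} = ?A"
  proof -
    have "induced_subgraph (delete_verts G S) C = induced_subgraph G C"
      if "C \<in> component_sets G" "C \<inter> S = {}" for C
      using that component_sets_subset by (intro induced_delete) blast+
    then show ?thesis unfolding component_sets_delete[OF G' Si(1)] by auto
  qed
  \<comment> \<open>Both sets are components and isolated, so each contains the other as soon as
    they meet.\<close>
  have eq: "C = S" if "C \<in> component_sets G" "C \<inter> S \<noteq> {}" for C
    using component_sets_disjoint[OF G' that(1) Si(1) that(2)]
      component_sets_disjoint[OF G' S, of C] that component_sets_iff[OF G'] by blast
  have 2: "{C \<in> component_sets G. induced_subgraph G C \<simeq> H} =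
    ?A \<union> (if induced_subgraph G S \<simeq> H then {S} else {})"
    using eq S by (auto split: if_splits)
  have fin: "finite ?A"
    by (rule finite_subset[of _ "Pow (verts G)"])
      (use G component_sets_subset in \<open>auto simp: finite_simple_graph_def\<close>)
  have "card (?A \<union> (if induced_subgraph G S \<simeq> H then {S} else {})) =
    card ?A + of_bool (induced_subgraph G S \<simeq> H)"
    using fin Si(2) by (auto simp: card_insert_if)
  with 1 2 show ?thesis unfolding component_count_def by simp
qed

lemma connected_graph_neighbour:
  assumes "connected_graph G" "u \<in> verts G" "card (verts G) \<noteq> 1"
  obtains v where "(u, v) \<in> adj G"
proof -
  have "verts G \<noteq> {u}" using assms(3) by auto
  then obtain w where "w \<in> verts G" "w \<noteq> u" using assms(2) by blast
  then have "(u, w) \<in> (adj G)\<^sup>*" using assms unfolding connected_graph_def by blast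
  then show ?thesis by (cases rule: converse_rtranclE) (use \<open>w \<noteq> u\<close> that in auto)
qed

text \<open>Every vertex of a connected graph with more than one vertex has a neighbour, so no copy
  of \<open>H\<close> uses a vertex that is isolated in \<open>G\<close>. This is what makes the
  removal of a few vertices almost free.\<close>

lemma component_count_delete_isolated:
  assumes G: "finite_simple_graph G" and H: "connected_graph H" "card (verts H) \<noteq> 1"
    "adj H \<subseteq> verts H \<times> verts H"
    and S: "\<And>u. u \<in> S \<Longrightarrow> isolated_set G {u}"
  shows "component_count (delete_verts G S) H = component_count G H"
proof -
  have G': "adj G \<subseteq> verts G \<times> verts G" "sym (adj G)"
    using G unfolding finite_simple_graph_def by auto
  have Si: "isolated_set G S" unfolding isolated_set_def
    using S G unfolding isolated_set_def finite_simple_graph_def irrefl_def by blast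
  have dis: "C \<inter> S = {}" if C: "C \<in> component_sets G" "induced_subgraph G C \<simeq> H" for C
  proof (rule ccontr)
    assume "C \<inter> S \<noteq> {}"
    then obtain u where u: "u \<in> C" "u \<in> S" by blast
    have "card (verts (induced_subgraph G C)) \<noteq> 1" using graph_iso_card[OF C(2)] H by simp
    moreover have "connected_graph (induced_subgraph G C)" using C(1) component_sets_iff[OF G'] by blast
    ultimately obtain v where "(u, v) \<in> adj (induced_subgraph G C)"
      using connected_graph_neighbour u(1) by (metis verts_induced)
    then show False using S[OF u(2)] G unfolding isolated_set_def finite_simple_graph_def irrefl_def
      by auto
  qed
  have "{C \<in> component_sets (delete_verts G S). induced_subgraph (delete_verts G S) C \<simeq> H} =
     {C \<in> component_sets G. induced_subgraph G C \<simeq> H}"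
  proof -
    have "induced_subgraph (delete_verts G S) C = induced_subgraph G C"
      if "C \<in> component_sets G" "C \<inter> S = {}" for C
      using that component_sets_subset by (intro induced_delete) blast+
    then show ?thesis unfolding component_sets_delete[OF G' Si] using dis by auto
  qed
  then show ?thesis unfolding component_count_def by simp
qed

lemma component_count_iso:
  assumes "H \<simeq> K"
  shows "component_count G H = component_count G K"
proof -
  have "induced_subgraph G C \<simeq> H \<longleftrightarrow> induced_subgraph G C \<simeq> K" for C
    using graph_iso_trans[OF _ assms] graph_iso_trans[OF _ graph_iso_sym[OF assms]] by blast
  then show ?thesis unfolding component_count_def by simp
qed

text \<open>Moves an arbitrary graph to the type \<open>nat graph\<close>, over which
  \<open>counts_agree\<close> quantifies; the vertex set \<open>{1..s}\<close> leaves only finitely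
  many graphs for each \<open>s\<close>.\<close>

lemma ex_nat_graph:
  fixes G :: "'a graph"
  assumes "finite_simple_graph G"
  obtains H where "finite_simple_graph H" "verts H = {1..card (verts G)}" "G \<simeq> H"
proof -
  have "finite (verts G)" using assms unfolding finite_simple_graph_def by blast
  then obtain f where f: "bij_betw f (verts G) {1..card (verts G)}"
    using ex_bij_betw_finite_nat[of "verts G"]  finite_same_card_bij[of "verts G" "{1..card (verts G)}"] by auto
  define H where "H = Graph {1..card (verts G)} ((\<lambda>(u, v). (f u, f v)) ` (adj G))"
  have sub: "adj G \<subseteq> verts G \<times> verts G" using assms unfolding finite_simple_graph_def by blast
  have "G \<simeq> H" unfolding graph_iso_def
  proof (intro exI[of _ f] conjI ballI)
    show "bij_betw f (verts G) (verts H)" using f by (simp add: H_def)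
    fix u v assume uv: "u \<in> verts G" "v \<in> verts G"
    have "(u, v) \<in> adj G" if "(u', v') \<in> adj G" "f u = f u'" "f v = f v'" for u' v'
    proof -
      have "u = u'" "v = v'" using f uv sub that by (auto simp: bij_betw_def dest: inj_onD)
      then show ?thesis using that by simp
    qed
    then show "(u, v) \<in> adj G \<longleftrightarrow> (f u, f v) \<in> adj H" unfolding H_def by auto
  qed
  moreover have "finite_simple_graph H"
    by (rule finite_simple_iso[OF calculation assms]) (use f sub in \<open>auto simp: H_def bij_betw_def\<close>)
  ultimately show ?thesis using that[of H] by (simp add: H_def)
qed


section \<open>First-order equivalence of disjoint unions\<close>


primrec quantifier_depth :: "fo \<Rightarrow> nat" where
  "quantifier_depth (Equal x y) = 0"
| "quantifier_depth (Edge x y) = 0"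
| "quantifier_depth (Neg p) = quantifier_depth p"
| "quantifier_depth (Conj p q) = max (quantifier_depth p) (quantifier_depth q)"
| "quantifier_depth (Exists x p) = Suc (quantifier_depth p)"

text \<open>A single type of test graphs serves two graphs with different vertex types, and by
  \<open>ex_nat_graph\<close> it misses no finite one.\<close>

definition counts_agree :: "nat \<Rightarrow> 'a graph \<Rightarrow> 'b graph \<Rightarrow> bool" where
  "counts_agree j G G' \<longleftrightarrow> (\<forall>H :: nat graph. component_count G H = component_count G' H \<or>
     j \<le> component_count G H \<and> j \<le> component_count G' H)"

lemma counts_agree_sym: "counts_agree j G G' \<Longrightarrow> counts_agree j G' G"
  unfolding counts_agree_def by metis

lemma counts_agree_mono: "counts_agree j G G' \<Longrightarrow> i \<le> j \<Longrightarrow> counts_agree i G G'"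
  unfolding counts_agree_def by (meson order_trans)

text \<open>A position of the game in which every component touched so far has been added as a
  whole. Since \<open>W\<close> and \<open>W'\<close> are isolated, the rest of each graph can be
  treated as a graph of its own.\<close>

definition partial_iso :: "'a graph \<Rightarrow> 'b graph \<Rightarrow> 'a set \<Rightarrow> 'b set \<Rightarrow> ('a \<Rightarrow> 'b) \<Rightarrow> bool" where
  "partial_iso G G' W W' f \<longleftrightarrow> isolated_set G W \<and> isolated_set G' W' \<and> bij_betw f W W' \<and>
     (\<forall>u\<in>W. \<forall>v\<in>W. (u, v) \<in> adj G \<longleftrightarrow> (f u, f v) \<in> adj G')"

lemma partial_iso_sym:
  assumes "partial_iso G G' W W' f"
  shows "partial_iso G' G W' W (the_inv_into W f)"
proof -
  let ?g = "the_inv_into W f"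
  have f: "bij_betw f W W'" using assms unfolding partial_iso_def by blast
  have g: "bij_betw ?g W' W" by (rule bij_betw_the_inv_into[OF f])
  have "(u, v) \<in> adj G' \<longleftrightarrow> (?g u, ?g v) \<in> adj G" if "u \<in> W'" "v \<in> W'" for u v
  proof -
    have "?g u \<in> W" "?g v \<in> W" using g that by (auto simp: bij_betw_def)
    moreover have "f (?g u) = u" "f (?g v) = v"
      using f that by (auto simp: bij_betw_def f_the_inv_into_f)
    ultimately show ?thesis using assms unfolding partial_iso_def by metis
  qed
  with g assms show ?thesis unfolding partial_iso_def by blast
qed

lemma component_count_pos:
  assumes "finite_simple_graph G" "C \<in> component_sets G" "induced_subgraph G C \<simeq> H"
  shows "0 < component_count G H"
proof -
  have "finite {C \<in> component_sets G. induced_subgraph G C \<simeq> H}"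
    by (rule finite_subset[of _ "Pow (verts G)"])
      (use assms component_sets_subset in \<open>auto simp: finite_simple_graph_def\<close>)
  then show ?thesis using assms unfolding component_count_def by (auto simp: card_gt_0_iff)
qed

lemma component_count_posD:
  assumes "0 < component_count G H"
  obtains C where "C \<in> component_sets G" "induced_subgraph G C \<simeq> H"
proof -
  have "{C \<in> component_sets G. induced_subgraph G C \<simeq> H} \<noteq> {}"
    using assms unfolding component_count_def by (metis card.empty less_irrefl)
  then show ?thesis using that by blast
qed

text \<open>One round of the game. A vertex outside \<open>W\<close> lies in a component
  \<open>C\<close> of the rest; agreement up to \<open>Suc j\<close> provides an isomorphic
  component \<open>C'\<close> of the other rest. Removing both lowers the same count on both sides,
  so one level of agreement is spent.\<close>

lemma partial_iso_extend:
  assumes G: "finite_simple_graph G" and G': "finite_simple_graph G'"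
    and iso: "partial_iso G G' W W' f"
    and agree: "counts_agree (Suc j) (delete_verts G W) (delete_verts G' W')"
    and v: "v \<in> verts G"
  obtains V V' g where "partial_iso G G' V V' g" "W \<subseteq> V" "\<And>x. x \<in> W \<Longrightarrow> g x = f x" "v \<in> V"
    "counts_agree j (delete_verts G V) (delete_verts G' V')"
proof (cases "v \<in> W")
  case True
  then show ?thesis using that[OF iso] counts_agree_mono[OF agree, of j] by auto
next
  case False
  have W: "isolated_set G W" "isolated_set G' W'" using iso unfolding partial_iso_def by auto
  let ?D = "delete_verts G W" and ?D' = "delete_verts G' W'"
  have D: "finite_simple_graph ?D" "finite_simple_graph ?D'"
    by (auto intro: finite_simple_delete G G')
  have sG: "adj G \<subseteq> verts G \<times> verts G" "sym (adj G)" "adj G' \<subseteq> verts G' \<times> verts G'" "sym (adj G')"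
    using G G' unfolding finite_simple_graph_def by auto
  have sD: "adj ?D \<subseteq> verts ?D \<times> verts ?D" "sym (adj ?D)" using D unfolding finite_simple_graph_def by auto
  obtain C where C: "C \<in> component_sets ?D" "v \<in> C"
    using ex_component[OF sD, of v] v False by auto
  have CW: "C \<in> component_sets G" "C \<inter> W = {}"
    using C component_sets_delete[OF sG(1,2) W(1)] by auto
  have Ci: "isolated_set G C" "C \<subseteq> verts G"
    using component_sets_iff[OF sG(1,2)] CW(1) by (auto simp: isolated_set_def)
  have "C \<subseteq> verts ?D" using C component_sets_subset by blast
  then obtain H :: "nat graph" where H: "induced_subgraph ?D C \<simeq> H"
    using ex_nat_graph[OF finite_simple_induced[OF D(1)]] by metis
  have "0 < component_count ?D H" by (rule component_count_pos[OF D(1) C(1) H])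
  \<comment> \<open>Whether the two counts are equal or both at least \<open>Suc j\<close>, a
    positive count on one side forces a positive one on the other.\<close>
  then have "0 < component_count ?D' H" using agree unfolding counts_agree_def
    by (metis less_le_trans zero_less_Suc)
  then obtain C' where C': "C' \<in> component_sets ?D'" "induced_subgraph ?D' C' \<simeq> H"
    by (rule component_count_posD)
  have CW': "C' \<in> component_sets G'" "C' \<inter> W' = {}"
    using C' component_sets_delete[OF sG(3,4) W(2)] by auto
  have Ci': "isolated_set G' C'" "C' \<subseteq> verts G'"
    using component_sets_iff[OF sG(3,4)] CW'(1) by (auto simp: isolated_set_def)
  have CC': "induced_subgraph ?D C \<simeq> induced_subgraph ?D' C'"
    by (rule graph_iso_trans[OF H graph_iso_sym[OF C'(2)]])
  then have "induced_subgraph G C \<simeq> induced_subgraph G' C'"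
    using induced_delete[OF CW(2) Ci(2)] induced_delete[OF CW'(2) Ci'(2)] by simp
  then obtain h where h: "bij_betw h C C'"
    "\<forall>u\<in>C. \<forall>v\<in>C. (u, v) \<in> adj G \<longleftrightarrow> (h u, h v) \<in> adj G'"
    unfolding graph_iso_def bij_betw_def by auto
  define g where "g x = (if x \<in> W then f x else h x)" for x
  have f: "bij_betw f W W'" "\<forall>u\<in>W. \<forall>v\<in>W. (u, v) \<in> adj G \<longleftrightarrow> (f u, f v) \<in> adj G'"
    using iso unfolding partial_iso_def by auto
  have gC: "g x = h x" if "x \<in> C" for x using that CW(2) unfolding g_def by auto
  have gW: "g x = f x" if "x \<in> W" for x using that unfolding g_def by auto
  have bij: "bij_betw g (W \<union> C) (W' \<union> C')"
  proof (rule bij_betw_combine)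
    show "bij_betw g W W'" using f(1) gW by (simp cong: bij_betw_cong)
    show "bij_betw g C C'" using h(1) gC by (simp cong: bij_betw_cong)
    show "W' \<inter> C' = {}" using CW'(2) by blast
  qed
  have gin: "\<And>x. x \<in> W \<Longrightarrow> g x \<in> W'" "\<And>x. x \<in> C \<Longrightarrow> g x \<in> C'"
    using f(1) h(1) gW gC by (auto simp: bij_betw_def)
  \<comment> \<open>\<open>W\<close> and \<open>C\<close> are isolated and disjoint, so mixed pairs
    are non-edges on both sides and \<open>g\<close> need only be checked inside each part.\<close>
  have cross: "(x, y) \<notin> adj G \<and> (y, x) \<notin> adj G" if "x \<in> W" "y \<in> C" for x y
    using that W(1) Ci CW(2) unfolding isolated_set_def by blast
  have cross': "(x, y) \<notin> adj G' \<and> (y, x) \<notin> adj G'" if "x \<in> W'" "y \<in> C'" for x y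
    using that W(2) Ci' CW'(2) unfolding isolated_set_def by blast
  have "(x, y) \<in> adj G \<longleftrightarrow> (g x, g y) \<in> adj G'" if "x \<in> W \<union> C" "y \<in> W \<union> C" for x y
    using that
  proof (elim UnE)
    assume "x \<in> W" "y \<in> W" then show ?thesis using f(2) gW by simp
  next
    assume "x \<in> C" "y \<in> C" then show ?thesis using h(2) gC by simp
  next
    assume "x \<in> W" "y \<in> C" then show ?thesis using cross cross' gin by blast
  next
    assume "x \<in> C" "y \<in> W" then show ?thesis using cross cross' gin by blast
  qed
  then have P: "partial_iso G G' (W \<union> C) (W' \<union> C') g"
    unfolding partial_iso_def using bij isolated_set_Un[OF W(1) Ci(1)] isolated_set_Un[OF W(2) Ci'(1)]
    by blast
  have "counts_agree j (delete_verts G (W \<union> C)) (delete_verts G' (W' \<union> C'))"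
    unfolding counts_agree_def
  proof
    fix K :: "nat graph"
    have 1: "component_count ?D K = component_count (delete_verts G (W \<union> C)) K
        + of_bool (induced_subgraph ?D C \<simeq> K)"
      using component_count_delete[OF D(1) C(1), of K] delete_delete[of G W C] by simp
    have 2: "component_count ?D' K = component_count (delete_verts G' (W' \<union> C')) K
        + of_bool (induced_subgraph ?D' C' \<simeq> K)"
      using component_count_delete[OF D(2) C'(1), of K] delete_delete[of G' W' C'] by simp
    have 3: "induced_subgraph ?D C \<simeq> K \<longleftrightarrow> induced_subgraph ?D' C' \<simeq> K"
      using graph_iso_trans[OF CC'] graph_iso_trans[OF graph_iso_sym[OF CC']] by blast
    have "component_count ?D K = component_count ?D' K \<or>
        Suc j \<le> component_count ?D K \<and> Suc j \<le> component_count ?D' K"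
      using agree unfolding counts_agree_def by blast
    with 1 2 3 show "component_count (delete_verts G (W \<union> C)) K = component_count (delete_verts G' (W' \<union> C')) K \<or>
       j \<le> component_count (delete_verts G (W \<union> C)) K \<and> j \<le> component_count (delete_verts G' (W' \<union> C')) K"
      by (cases "induced_subgraph ?D C \<simeq> K") auto
  qed
  with that[OF P] gW C(2) show ?thesis by blast
qed

text \<open>The duplicator's strategy in the Ehrenfeucht-Fraisse game: answer inside the components
  already visited by the partial isomorphism, and open an isomorphic fresh component whenever
  the spoiler does.\<close>

lemma sat_partial_iso:
  assumes G: "finite_simple_graph G" and G': "finite_simple_graph G'"
    and "partial_iso G G' W W' f"
    and "counts_agree (quantifier_depth p) (delete_verts G W) (delete_verts G' W')"
    and "\<And>x. x \<in> free_vars p \<Longrightarrow> e x \<in> W \<and> e' x = f (e x)"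
  shows "sat G e p \<longleftrightarrow> sat G' e' p"
  using assms(3-5)
proof (induction p arbitrary: e e' W W' f)
  case (Equal x y)
  have "inj_on f W" using Equal(1) unfolding partial_iso_def bij_betw_def by blast
  then show ?case using Equal(3)[of x] Equal(3)[of y] by (auto dest: inj_onD)
next
  case (Edge x y)
  show ?case using Edge(1) Edge(3)[of x] Edge(3)[of y] unfolding partial_iso_def by auto
next
  case (Neg p)
  have "sat G e p \<longleftrightarrow> sat G' e' p"
    by (rule Neg.IH[OF Neg.prems(1)]) (use Neg.prems in auto)
  then show ?case by simp
next
  case (Conj p q)
  have "sat G e p \<longleftrightarrow> sat G' e' p"
    by (rule Conj.IH(1)[OF Conj.prems(1)])
      (use Conj.prems in \<open>auto intro: counts_agree_mono\<close>)
  moreover have "sat G e q \<longleftrightarrow> sat G' e' q"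
    by (rule Conj.IH(2)[OF Conj.prems(1)])
      (use Conj.prems in \<open>auto intro: counts_agree_mono\<close>)
  ultimately show ?case by simp
next
  case (Exists x p)
  have agree: "counts_agree (Suc (quantifier_depth p)) (delete_verts G W) (delete_verts G' W')"
    using Exists.prems(2) by simp
  have step: "sat G (e(x := v)) p \<longleftrightarrow> sat G' (e'(x := g v)) p"
    if "partial_iso G G' V V' g" "W \<subseteq> V" "\<And>x. x \<in> W \<Longrightarrow> g x = f x" "v \<in> V"
      "counts_agree (quantifier_depth p) (delete_verts G V) (delete_verts G' V')" for V V' g v
    by (rule Exists.IH[OF that(1,5)]) (use Exists.prems(3) that in auto)
  show ?case
  proof
    assume "sat G e (Exists x p)"
    then obtain v where v: "v \<in> verts G" "sat G (e(x := v)) p" by auto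
    obtain V V' g where V: "partial_iso G G' V V' g" "W \<subseteq> V" "\<And>x. x \<in> W \<Longrightarrow> g x = f x" "v \<in> V"
      "counts_agree (quantifier_depth p) (delete_verts G V) (delete_verts G' V')"
      using partial_iso_extend[OF G G' Exists.prems(1) agree v(1)] by blast
    have "g v \<in> verts G'" using V(1,4) unfolding partial_iso_def isolated_set_def bij_betw_def by blast
    then show "sat G' e' (Exists x p)" using step[OF V] v(2) by auto
  next
    \<comment> \<open>A move in \<open>G'\<close> is answered by extending the inverse partial
      isomorphism. The induction hypothesis is about maps from \<open>G\<close> to
      \<open>G'\<close>, so the extension is inverted again.\<close>
    assume "sat G' e' (Exists x p)"
    then obtain w where w: "w \<in> verts G'" "sat G' (e'(x := w)) p" by auto
    let ?h = "the_inv_into W f"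
    obtain V V' h where V: "partial_iso G' G V' V h" "W' \<subseteq> V'" "\<And>x. x \<in> W' \<Longrightarrow> h x = ?h x" "w \<in> V'"
      "counts_agree (quantifier_depth p) (delete_verts G' V') (delete_verts G V)"
      using partial_iso_extend[OF G' G partial_iso_sym[OF Exists.prems(1)] counts_agree_sym[OF agree] w(1)]
      by metis
    let ?g = "the_inv_into V' h"
    have f: "bij_betw f W W'" using Exists.prems(1) unfolding partial_iso_def by blast
    have h: "bij_betw h V' V" using V(1) unfolding partial_iso_def by blast
    have g: "partial_iso G G' V V' ?g" by (rule partial_iso_sym[OF V(1)])
    \<comment> \<open>The inverse of the extension still agrees with \<open>f\<close> on
      \<open>W\<close>, as the values of the variables assigned earlier require.\<close>
    have WV: "z \<in> V \<and> ?g z = f z" if "z \<in> W" for z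
    proof -
      have "f z \<in> W'" "?h (f z) = z" using f that by (auto simp: bij_betw_def the_inv_into_f_f)
      then have "h (f z) = z" "f z \<in> V'" using V by auto
      then show ?thesis using h by (metis bij_betw_def image_eqI the_inv_into_f_f)
    qed
    have hw: "h w \<in> V" "?g (h w) = w" using h V(4) by (auto simp: bij_betw_def the_inv_into_f_f)
    have "sat G (e(x := h w)) p \<longleftrightarrow> sat G' (e'(x := ?g (h w))) p"
      by (rule step[OF g _ _ hw(1) counts_agree_sym[OF V(5)]]) (use WV in auto)
    moreover have "h w \<in> verts G" using hw(1) V(1) unfolding partial_iso_def isolated_set_def by blast
    ultimately show "sat G e (Exists x p)" using w(2) hw(2) by auto
  qed
qed

lemma models_counts_agree:
  assumes "finite_simple_graph G" "finite_simple_graph G'"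
    and "counts_agree (quantifier_depth p) G G'" "sentence p"
  shows "G \<Turnstile> p \<longleftrightarrow> G' \<Turnstile> p"
proof -
  have 0: "delete_verts G {} = G"
    using assms(1) induced_subgraph_verts unfolding delete_verts_def finite_simple_graph_def by auto
  have z2: "delete_verts G' {} = G'"
    using assms(2) induced_subgraph_verts unfolding delete_verts_def finite_simple_graph_def by auto
  have 1: "partial_iso G G' {} {} undefined"
    unfolding partial_iso_def isolated_set_def bij_betw_def by auto
  \<comment> \<open>The game starts with nothing visited. A sentence has no free variables, so the
    two assignments may be unrelated.\<close>
  have "sat G e p \<longleftrightarrow> sat G' e' p" for e e'
    by (rule sat_partial_iso[OF assms(1,2) 1]) (use assms(3,4) 0 in \<open>auto simp: sentence_def z2\<close>)
  then show ?thesis unfolding models_def by blast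
qed

section \<open>Disjoint unions of connected graphs\<close>

lemma disjoint_copies_simple:
  assumes S: "finite S" "\<And>H. H \<in> S \<Longrightarrow> finite_simple_graph H"
  shows "finite_simple_graph (disjoint_copies S c)"
proof -
  have "verts (disjoint_copies S c) \<subseteq> (SIGMA H:S. {..<c H} \<times> verts H)"
    unfolding disjoint_copies_def by auto
  moreover have "finite (SIGMA H:S. {..<c H} \<times> verts H)"
    using S by (auto simp: finite_simple_graph_def)
  ultimately have "finite (verts (disjoint_copies S c))" by (rule finite_subset)
  moreover have "u \<in> verts H" "v \<in> verts H" "(v, u) \<in> adj H"
    if "H \<in> S" "(u, v) \<in> adj H" for H u v
    using S(2)[OF that(1)] that(2) unfolding finite_simple_graph_def
    by (auto dest: symD)
  moreover have "(u, u) \<notin> adj H" if "H \<in> S" for H u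
    using S(2)[OF that] unfolding finite_simple_graph_def by (auto dest: irreflD)
  ultimately have "adj (disjoint_copies S c) \<subseteq> verts (disjoint_copies S c) \<times> verts (disjoint_copies S c)"
    "sym (adj (disjoint_copies S c))" "irrefl (adj (disjoint_copies S c))"
    "finite (verts (disjoint_copies S c))"
    unfolding disjoint_copies_def by (auto intro!: symI irreflI)
  then show ?thesis unfolding finite_simple_graph_def by simp
qed

text \<open>Each copy is isolated and connected, hence a component; since the copies cover all
  vertices and a component lies inside any isolated set that it meets, there are no others.\<close>

lemma component_sets_disjoint_copies:
  assumes S: "finite S" "\<And>H. H \<in> S \<Longrightarrow> finite_simple_graph H" "\<And>H. H \<in> S \<Longrightarrow> connected_graph H"
  shows "component_sets (disjoint_copies S c) = {(\<lambda>v. (H, i, v)) ` verts H | H i. H \<in> S \<and> i < c H}"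
    and "H \<in> S \<Longrightarrow> i < c H \<Longrightarrow>
      induced_subgraph (disjoint_copies S c) ((\<lambda>v. (H, i, v)) ` verts H) \<simeq> H"
proof -
  let ?D = "disjoint_copies S c"
  have D: "adj ?D \<subseteq> verts ?D \<times> verts ?D" "sym (adj ?D)"
    using disjoint_copies_simple[OF S(1,2)] unfolding finite_simple_graph_def by auto
  define cp where "cp H i = (\<lambda>v. (H, i, v)) ` verts H" for H :: "'a graph" and i :: nat
  have iso: "H \<simeq> induced_subgraph ?D (cp H i)" if "H \<in> S" "i < c H" for H i
    unfolding graph_iso_def
  proof (intro exI[of _ "\<lambda>v. (H, i, v)"] conjI ballI)
    show "bij_betw (\<lambda>v. (H, i, v)) (verts H) (verts (induced_subgraph ?D (cp H i)))"
      unfolding cp_def by (auto simp: bij_betw_def inj_on_def)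
  qed (use that S(2)[OF that(1)] in \<open>auto simp: cp_def disjoint_copies_def\<close>)
  then show "H \<in> S \<Longrightarrow> i < c H \<Longrightarrow> induced_subgraph ?D ((\<lambda>v. (H, i, v)) ` verts H) \<simeq> H"
    using graph_iso_sym unfolding cp_def by blast
  have iso': "isolated_set ?D (cp H i)" if "H \<in> S" "i < c H" for H i
    using that S(2)[OF that(1)]
    unfolding isolated_set_def cp_def disjoint_copies_def finite_simple_graph_def by auto
  have comp: "cp H i \<in> component_sets ?D" if "H \<in> S" "i < c H" for H i
  proof -
    have "adj H \<subseteq> verts H \<times> verts H" using S(2)[OF that(1)] unfolding finite_simple_graph_def by blast
    then show ?thesis
      unfolding component_sets_iff[OF D]
      using iso'[OF that] graph_iso_connected[OF iso[OF that] S(3)[OF that(1)]] by blast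
  qed
  have "\<exists>H i. C = cp H i \<and> H \<in> S \<and> i < c H" if C: "C \<in> component_sets ?D" for C
  proof -
    obtain x where x: "x \<in> C" using component_sets_nonempty[OF C] by blast
    obtain H i v where "x = (H, i, v)" by (cases x)
    moreover have "x \<in> verts ?D" using x C component_sets_subset by blast
    ultimately have H: "H \<in> S" "i < c H" "x \<in> cp H i" unfolding disjoint_copies_def cp_def by auto
    have "C \<subseteq> cp H i" by (rule component_sets_disjoint[OF D C iso'[OF H(1,2)]]) (use x H in auto)
    moreover have "isolated_set ?D C" using C component_sets_iff[OF D] by blast
    then have "cp H i \<subseteq> C"
      by (rule component_sets_disjoint[OF D comp[OF H(1,2)]]) (use x H in auto)
    ultimately show ?thesis using H by blast
  qed
  then show "component_sets ?D = {(\<lambda>v. (H, i, v)) ` verts H | H i. H \<in> S \<and> i < c H}"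
    using comp unfolding cp_def by blast
qed

text \<open>Without \<open>dist\<close> the copies of two isomorphic members of \<open>S\<close>
  would be pooled into one count.\<close>

lemma component_count_disjoint_copies:
  assumes S: "finite S" "\<And>H. H \<in> S \<Longrightarrow> finite_simple_graph H" "\<And>H. H \<in> S \<Longrightarrow> connected_graph H"
    and dist: "\<And>H H'. H \<in> S \<Longrightarrow> H' \<in> S \<Longrightarrow> H \<simeq> H' \<Longrightarrow> H = H'"
  shows "H \<in> S \<Longrightarrow> H \<simeq> K \<Longrightarrow> component_count (disjoint_copies S c) K = c H"
    and "(\<And>H. H \<in> S \<Longrightarrow> \<not> H \<simeq> K) \<Longrightarrow> component_count (disjoint_copies S c) K = 0"
proof -
  let ?D = "disjoint_copies S c"
  have cs1: "component_sets ?D = {(\<lambda>v. (H, i, v)) ` verts H | H i. H \<in> S \<and> i < c H}"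
    by (rule component_sets_disjoint_copies(1)[OF S])
  have cs2: "induced_subgraph ?D ((\<lambda>v. (H, i, v)) ` verts H) \<simeq> H" if "H \<in> S" "i < c H" for H i
    by (rule component_sets_disjoint_copies(2)[OF S]) (use that in auto)
  define cp where "cp H i = (\<lambda>v. (H, i, v)) ` verts H" for H :: "'a graph" and i :: nat
  have eq: "{C \<in> component_sets ?D. induced_subgraph ?D C \<simeq> K} = {cp H i | H i. H \<in> S \<and> i < c H \<and> H \<simeq> K}"
  proof -
    have "induced_subgraph ?D (cp H i) \<simeq> K \<longleftrightarrow> H \<simeq> K" if "H \<in> S" "i < c H" for H i
      using graph_iso_trans[OF cs2[OF that, folded cp_def]]
        graph_iso_trans[OF graph_iso_sym[OF cs2[OF that, folded cp_def]]] by blast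
    then show ?thesis unfolding cs1[folded cp_def] by blast
  qed
  {
    assume H: "H \<in> S" "H \<simeq> K"
    have uniq: "H' = H" if "H' \<in> S" "H' \<simeq> K" for H'
      using dist[OF that(1) H(1)] graph_iso_trans[OF that(2) graph_iso_sym[OF H(2)]] by blast
    have "{cp H i | H i. H \<in> S \<and> i < c H \<and> H \<simeq> K} = cp H ` {..<c H}"
    proof (intro equalityI subsetI)
      fix x assume "x \<in> {cp H i | H i. H \<in> S \<and> i < c H \<and> H \<simeq> K}"
      then obtain H' i where H': "x = cp H' i" "H' \<in> S" "i < c H'" "H' \<simeq> K" by blast
      then have "H' = H" using uniq by blast
      with H' show "x \<in> cp H ` {..<c H}" by simp
    qed (use H in blast)
    \<comment> \<open>The index \<open>i\<close> can be read off from a copy because the vertex set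
      of \<open>H\<close> is nonempty.\<close>
    moreover have "inj_on (cp H) {..<c H}"
    proof -
      have "(fst \<circ> snd) ` cp H i = {i}" for i
        using S(3)[OF H(1)] unfolding connected_graph_def cp_def by (auto simp: image_image)
      then show ?thesis by (metis inj_onI singleton_inject)
    qed
    ultimately show "component_count ?D K = c H"
      unfolding component_count_def eq by (simp add: card_image)
  }
  {
    assume "\<And>H. H \<in> S \<Longrightarrow> \<not> H \<simeq> K"
    then have "{cp H i | H i. H \<in> S \<and> i < c H \<and> H \<simeq> K} = {}" by blast
    then show "component_count ?D K = 0" unfolding component_count_def eq by (simp only: card.empty)
  }
qed

text \<open>A type either has a representative in \<open>S\<close>, where \<open>c\<close> compares
  the multiplicities, or it occurs in neither graph.\<close>

lemma models_disjoint_copies: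
  assumes S: "finite S" "\<And>H. H \<in> S \<Longrightarrow> finite_simple_graph H" "\<And>H. H \<in> S \<Longrightarrow> connected_graph H"
      "\<And>H H'. H \<in> S \<Longrightarrow> H' \<in> S \<Longrightarrow> H \<simeq> H' \<Longrightarrow> H = H'"
    and G: "finite_simple_graph G" "\<And>C. C \<in> component_sets G \<Longrightarrow> \<exists>H\<in>S. induced_subgraph G C \<simeq> H"
    and c: "\<And>H. H \<in> S \<Longrightarrow> component_count G H = c H \<or>
      quantifier_depth p \<le> component_count G H \<and> quantifier_depth p \<le> c H"
    and p: "sentence p"
  shows "G \<Turnstile> p \<longleftrightarrow> disjoint_copies S c \<Turnstile> p"
proof (rule models_counts_agree[OF G(1) disjoint_copies_simple[OF S(1,2)] _ p])
  show "counts_agree (quantifier_depth p) G (disjoint_copies S c)"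
    unfolding counts_agree_def
  proof
    fix K :: "nat graph"
    show "component_count G K = component_count (disjoint_copies S c) K \<or>
      quantifier_depth p \<le> component_count G K \<and> quantifier_depth p \<le> component_count (disjoint_copies S c) K"
    proof (cases "\<exists>H\<in>S. H \<simeq> K")
      case True
      then obtain H where H: "H \<in> S" "H \<simeq> K" by blast
      then show ?thesis
        using c[OF H(1)] component_count_iso[OF H(2), of G] component_count_disjoint_copies(1)[OF S H, where c = c]
        by simp
    next
      case False
      then have "component_count (disjoint_copies S c) K = 0"
        using component_count_disjoint_copies(2)[OF S] by blast
      moreover have "component_count G K = 0"
      proof (rule ccontr)
        assume "component_count G K \<noteq> 0"
        then obtain C where C: "C \<in> component_sets G" "induced_subgraph G C \<simeq> K"
          using component_count_posD by blast
        then obtain H where "H \<in> S" "induced_subgraph G C \<simeq> H" using G(2) by blast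
        then show False using False graph_iso_trans[OF graph_iso_sym C(2)] by blast
      qed
      ultimately show ?thesis by simp
    qed
  qed
qed

section \<open>A sentence asserting the existence of a clique\<close>

primrec edges_to :: "nat \<Rightarrow> nat \<Rightarrow> fo" where
  "edges_to j 0 = Equal j j"
| "edges_to j (Suc i) = Conj (edges_to j i) (Edge i j)"

text \<open>The base cases here and in \<open>edges_to\<close> are true equations standing for the
  empty conjunction. \<open>Equal 0 0\<close> has the free variable 0, so
  \<open>clique_sentence s\<close> is closed only for \<open>s > 0\<close>.\<close>

primrec clique_formula :: "nat \<Rightarrow> fo" where
  "clique_formula 0 = Equal 0 0"
| "clique_formula (Suc j) = Conj (clique_formula j) (edges_to j j)"

primrec exists_below :: "nat \<Rightarrow> fo \<Rightarrow> fo" where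
  "exists_below 0 p = p"
| "exists_below (Suc j) p = exists_below j (Exists j p)"

definition clique_sentence :: "nat \<Rightarrow> fo" where
  "clique_sentence s = exists_below s (clique_formula s)"

lemma free_vars_edges_to: "free_vars (edges_to j i) \<subseteq> {..<i} \<union> {j}"
  by (induction i) auto

lemma free_vars_clique_formula: "free_vars (clique_formula j) \<subseteq> insert 0 {..<j}"
proof (induction j)
  case (Suc j)
  then show ?case using free_vars_edges_to[of j j] by auto
qed simp

lemma free_vars_exists_below: "free_vars (exists_below j p) = free_vars p - {..<j}"
  by (induction j arbitrary: p) auto

lemma sentence_clique: "s > 0 \<Longrightarrow> sentence (clique_sentence s)"
  unfolding sentence_def clique_sentence_def free_vars_exists_below
  using free_vars_clique_formula[of s] by auto

lemma sat_edges_to: "sat G e (edges_to j i) \<longleftrightarrow> (\<forall>l<i. (e l, e j) \<in> adj G)"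
  by (induction i) (auto simp: less_Suc_eq)

lemma sat_clique_formula: "sat G e (clique_formula s) \<longleftrightarrow> (\<forall>j<s. \<forall>l<j. (e l, e j) \<in> adj G)"
  by (induction s) (auto simp: less_Suc_eq sat_edges_to)

lemma sat_exists_below:
  "sat G e (exists_below s p) \<longleftrightarrow>
    (\<exists>g. (\<forall>i<s. g i \<in> verts G) \<and> sat G (\<lambda>i. if i < s then g i else e i) p)"
proof (induction s arbitrary: p)
  case (Suc s)
  have "sat G e (exists_below (Suc s) p) \<longleftrightarrow> (\<exists>g. (\<forall>i<s. g i \<in> verts G) \<and>
      (\<exists>v\<in>verts G. sat G ((\<lambda>i. if i < s then g i else e i)(s := v)) p))"
    using Suc by simp
  also have "\<dots> \<longleftrightarrow> (\<exists>g. (\<forall>i<Suc s. g i \<in> verts G) \<and> sat G (\<lambda>i. if i < Suc s then g i else e i) p)"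
  proof
    assume "\<exists>g. (\<forall>i<s. g i \<in> verts G) \<and>
      (\<exists>v\<in>verts G. sat G ((\<lambda>i. if i < s then g i else e i)(s := v)) p)"
    then obtain g v where g: "\<forall>i<s. g i \<in> verts G" "v \<in> verts G"
      "sat G ((\<lambda>i. if i < s then g i else e i)(s := v)) p" by blast
    have "(\<lambda>i. if i < s then g i else e i)(s := v) = (\<lambda>i. if i < Suc s then (g(s := v)) i else e i)"
      by (auto simp: fun_eq_iff)
    then show "\<exists>g. (\<forall>i<Suc s. g i \<in> verts G) \<and> sat G (\<lambda>i. if i < Suc s then g i else e i) p"
      using g by (intro exI[of _ "g(s := v)"]) (auto simp: less_Suc_eq)
  next
    assume "\<exists>g. (\<forall>i<Suc s. g i \<in> verts G) \<and> sat G (\<lambda>i. if i < Suc s then g i else e i) p"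
    then obtain g where g: "\<forall>i<Suc s. g i \<in> verts G" "sat G (\<lambda>i. if i < Suc s then g i else e i) p"
      by blast
    have "(\<lambda>i. if i < s then g i else e i)(s := g s) = (\<lambda>i. if i < Suc s then g i else e i)"
      by (auto simp: fun_eq_iff)
    then show "\<exists>g. (\<forall>i<s. g i \<in> verts G) \<and>
      (\<exists>v\<in>verts G. sat G ((\<lambda>i. if i < s then g i else e i)(s := v)) p)"
      using g by (intro exI[of _ g]) (auto intro!: bexI[of _ "g s"])
  qed
  finally show ?case .
qed auto

definition complete_graph :: "nat \<Rightarrow> nat graph" where
  "complete_graph s = Graph {1..s} {(i, j). i \<in> {1..s} \<and> j \<in> {1..s} \<and> i \<noteq> j}"

text \<open>The formula does not demand distinct vertices; since no vertex is adjacent to itself,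
  adjacency of \<open>g i\<close> and \<open>g j\<close> already makes \<open>g\<close>
  injective.\<close>

lemma models_clique_iff:
  assumes G: "finite_simple_graph G"
  shows "G \<Turnstile> clique_sentence s \<longleftrightarrow>
    (\<exists>C\<subseteq>verts G. card C = s \<and> (\<forall>u\<in>C. \<forall>v\<in>C. u \<noteq> v \<longrightarrow> (u, v) \<in> adj G))"
proof
  have sG: "sym (adj G)" "irrefl (adj G)" "finite (verts G)" using G unfolding finite_simple_graph_def by auto
  {
    assume "G \<Turnstile> clique_sentence s"
    then have "sat G (\<lambda>_. undefined) (clique_sentence s)" unfolding models_def by blast
    then obtain g where g: "\<And>i. i < s \<Longrightarrow> g i \<in> verts G" and
      "\<forall>j<s. \<forall>l<j. ((if l < s then g l else undefined), (if j < s then g j else undefined)) \<in> adj G"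
      unfolding clique_sentence_def sat_exists_below sat_clique_formula by blast
    then have adj: "(g i, g j) \<in> adj G" if "j < s" "i < j" for i j
      using that by (simp split: if_splits)
    have sym: "(g i, g j) \<in> adj G" if "i < s" "j < s" "i \<noteq> j" for i j
      using adj that sG(1) by (metis linorder_neqE_nat symD)
    then have "inj_on g {..<s}" using sG(2) unfolding inj_on_def irrefl_def by (metis lessThan_iff)
    then have "card (g ` {..<s}) = s" by (simp add: card_image)
    then show "\<exists>C\<subseteq>verts G. card C = s \<and> (\<forall>u\<in>C. \<forall>v\<in>C. u \<noteq> v \<longrightarrow> (u, v) \<in> adj G)"
      using g sym by (intro exI[of _ "g ` {..<s}"]) auto
  }
  {
    assume "\<exists>C\<subseteq>verts G. card C = s \<and> (\<forall>u\<in>C. \<forall>v\<in>C. u \<noteq> v \<longrightarrow> (u, v) \<in> adj G)"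
    then obtain C where C: "C \<subseteq> verts G" "card C = s" "\<And>u v. u \<in> C \<Longrightarrow> v \<in> C \<Longrightarrow> u \<noteq> v \<Longrightarrow> (u, v) \<in> adj G"
      by blast
    have "finite C" using C(1) sG(3) finite_subset by blast
    then obtain g where g: "bij_betw g {..<s} C"
      using C(2) ex_bij_betw_nat_finite[of C] by (auto simp: atLeast0LessThan)
    have gC: "g i \<in> C" if "i < s" for i using g that by (auto simp: bij_betw_def)
    have neq: "g i \<noteq> g j" if "i < s" "j < s" "i \<noteq> j" for i j
      using g that by (auto simp: bij_betw_def inj_on_def)
    show "G \<Turnstile> clique_sentence s"
      unfolding models_def clique_sentence_def sat_exists_below sat_clique_formula
    proof (intro allI exI[of _ g] conjI impI)
      fix e :: "nat \<Rightarrow> 'a" and i j assume ij: "i < s" "j < i"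
      then have "(g j, g i) \<in> adj G" using C(3) gC neq by (metis order_less_trans nat_neq_iff)
      then show "(if j < s then g j else e j, if i < s then g i else e i) \<in> adj G" using ij by auto
    qed (use gC C(1) in blast)
  }
qed


section \<open>Unwrapping the torus\<close>


text \<open>The representative of \<open>t\<close> modulo the integers in the half-open interval
  from -1/2 to 1/2: \<open>round\<close> sends 1/2 to 1, so -1/2 is attained and 1/2 is not.\<close>

definition centered :: "real \<Rightarrow> real" where
  "centered t = t - of_int (round t)"

lemma circle_norm_eq: "circle_norm t = \<bar>centered t\<bar>"
  unfolding circle_norm_def centered_def
proof (rule antisym)
  have "bdd_below (range (\<lambda>m::int. \<bar>t - of_int m\<bar>))" by (rule bdd_belowI[of _ 0]) auto
  then show "(INF m::int. \<bar>t - of_int m\<bar>) \<le> \<bar>t - of_int (round t)\<bar>" by (rule cINF_lower) auto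
  show "\<bar>t - of_int (round t)\<bar> \<le> (INF m::int. \<bar>t - of_int m\<bar>)"
    by (rule cINF_greatest) (auto intro: round_diff_minimal)
qed

lemma centered_add_int: "centered (t + of_int m) = centered t"
proof -
  have "t + of_int m + 1/2 = t + 1/2 + of_int m" by simp
  then show ?thesis unfolding centered_def round_def by (simp only: floor_add_int) simp
qed

lemma circle_norm_cong: "t = s + of_int m \<Longrightarrow> circle_norm t = circle_norm s"
  by (simp add: circle_norm_eq centered_add_int)

lemma circle_norm_le: "circle_norm t \<le> \<bar>t - of_int m\<bar>"
  unfolding circle_norm_eq centered_def by (rule round_diff_minimal)

lemma circle_norm_triangle: "circle_norm (s + t) \<le> circle_norm s + circle_norm t"
proof -
  have "circle_norm (s + t) \<le> \<bar>s + t - of_int (round s + round t)\<bar>" by (rule circle_norm_le)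
  also have "\<dots> \<le> circle_norm s + circle_norm t" unfolding circle_norm_eq centered_def by simp
  finally show ?thesis .
qed

lemma circle_norm_minus: "circle_norm (- t) = circle_norm t"
proof (rule antisym)
  show "circle_norm (- t) \<le> circle_norm t"
    using circle_norm_le[of "- t" "- round t"] unfolding circle_norm_eq[of t] centered_def by simp
  show "circle_norm t \<le> circle_norm (- t)"
    using circle_norm_le[of t "- round (- t)"] unfolding circle_norm_eq[of "-t"] centered_def by simp
qed

lemma centered_small: "\<bar>t\<bar> < 1/2 \<Longrightarrow> centered t = t"
  unfolding centered_def by (simp add: round_unique'[of t 0])

lemma circle_norm_small:
  assumes "\<bar>t\<bar> \<le> 1/2"
  shows "circle_norm t = \<bar>t\<bar>"
proof (cases "\<bar>t\<bar> < 1/2")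
  case True
  then show ?thesis by (simp add: circle_norm_eq centered_small)
next
  case False
  with assms have "t = 1/2 \<or> t = -1/2" by linarith
  then show ?thesis
  proof
    assume "t = 1/2"
    then have "round t = 1" unfolding round_def by (simp only:) simp
    with \<open>t = 1/2\<close> show ?thesis by (simp add: circle_norm_eq centered_def)
  next
    assume "t = -1/2"
    then have "round t = 0" unfolding round_def by (simp only:) simp
    with \<open>t = -1/2\<close> show ?thesis by (simp add: circle_norm_eq centered_def)
  qed
qed

lemma infnorm_vec: "infnorm (x :: real ^ 'd) = Max (range (\<lambda>i. \<bar>x $ i\<bar>))"
  unfolding infnorm_cart by (subst cSup_eq_Max[symmetric]) (auto simp: full_SetCompr_eq)

lemma infnorm_vec_le_iff: "infnorm (x :: real ^ 'd) \<le> c \<longleftrightarrow> (\<forall>i. \<bar>x $ i\<bar> \<le> c)"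
  unfolding infnorm_vec by (subst Max_le_iff) auto

lemma infnorm_vec_less_iff: "infnorm (x :: real ^ 'd) < c \<longleftrightarrow> (\<forall>i. \<bar>x $ i\<bar> < c)"
  unfolding infnorm_vec by (subst Max_less_iff) auto

lemma torus_dist_le_iff: "torus_dist x y \<le> r \<longleftrightarrow> (\<forall>i. circle_norm (x $ i - y $ i) \<le> r)"
  unfolding torus_dist_def by (subst Max_le_iff) auto

lemma torus_dist_commute: "torus_dist x y = torus_dist y x"
  unfolding torus_dist_def using circle_norm_minus[of "y $ i - x $ i" for i] by simp

text \<open>The chart of the torus around \<open>v\<close>, rescaled by \<open>1/r\<close>.\<close>

definition unwrap :: "real \<Rightarrow> real ^ 'd \<Rightarrow> real ^ 'd \<Rightarrow> real ^ 'd" where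
  "unwrap r v x = (\<chi> i. centered (x $ i - v $ i) / r)"

lemma unwrap_nth [simp]: "unwrap r v x $ i = centered (x $ i - v $ i) / r"
  unfolding unwrap_def by simp

lemma unwrap_self [simp]: "unwrap r v v = 0"
  by (simp add: vec_eq_iff centered_small)

text \<open>Coordinates of size at most 1/4 relative to \<open>v\<close> have differences of size at
  most 1/2, where the circle norm is the absolute value. There the chart is an isometry up to the
  factor \<open>r\<close>.\<close>

lemma torus_dist_unwrap:
  assumes "r > 0"
    and "\<And>i. \<bar>unwrap r v x $ i\<bar> * r \<le> 1/4" "\<And>i. \<bar>unwrap r v y $ i\<bar> * r \<le> 1/4"
  shows "torus_dist x y = r * infnorm (unwrap r v x - unwrap r v y)"
proof -
  have c: "circle_norm (x $ i - y $ i) = r * \<bar>(unwrap r v x - unwrap r v y) $ i\<bar>" for i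
  proof -
    have "x $ i - y $ i = centered (x $ i - v $ i) - centered (y $ i - v $ i)
        + of_int (round (x $ i - v $ i) - round (y $ i - v $ i))"
      unfolding centered_def by simp
    then have "circle_norm (x $ i - y $ i) = circle_norm (centered (x $ i - v $ i) - centered (y $ i - v $ i))"
      by (rule circle_norm_cong)
    also have "\<dots> = \<bar>centered (x $ i - v $ i) - centered (y $ i - v $ i)\<bar>"
    proof (rule circle_norm_small)
      have "\<bar>centered (x $ i - v $ i)\<bar> \<le> 1/4" "\<bar>centered (y $ i - v $ i)\<bar> \<le> 1/4"
        using assms(2)[of i] assms(3)[of i] assms(1) by (auto simp: abs_divide)
      then show "\<bar>centered (x $ i - v $ i) - centered (y $ i - v $ i)\<bar> \<le> 1/2" by linarith
    qed
    also have "\<dots> = r * \<bar>(unwrap r v x - unwrap r v y) $ i\<bar>"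
      using assms(1) by (simp add: diff_divide_distrib[symmetric] abs_divide)
    finally show ?thesis .
  qed
  have "torus_dist x y = Max ((\<lambda>t. r * t) ` range (\<lambda>i. \<bar>(unwrap r v x - unwrap r v y) $ i\<bar>))"
    unfolding torus_dist_def c by (simp add: image_image)
  also have "\<dots> = r * infnorm (unwrap r v x - unwrap r v y)"
    unfolding infnorm_vec
    by (rule mono_Max_commute[symmetric]) (use assms(1) in \<open>auto intro!: monoI mult_left_mono\<close>)
  finally show ?thesis .
qed

text \<open>The number of steps from \<open>u\<close> to \<open>v\<close> is at most the number of edges.\<close>

lemma connected_additive_bound:
  fixes f :: "'a \<Rightarrow> 'a \<Rightarrow> real"
  assumes "connected_graph G" "finite_simple_graph G" "u \<in> verts G" "v \<in> verts G"
    and "r \<ge> 0" "\<And>u v. (u, v) \<in> adj G \<Longrightarrow> f u v \<le> r" "\<And>u v w. f u w \<le> f u v + f v w" "\<And>u. f u u = 0"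
  shows "f u v \<le> real ((card (verts G))\<^sup>2) * r"
proof -
  have G: "finite (verts G)" "adj G \<subseteq> verts G \<times> verts G" using assms(2) unfolding finite_simple_graph_def by auto
  then have fin: "finite (adj G)" by (metis finite_SigmaI finite_subset)
  have "(u, v) \<in> (adj G)\<^sup>*" using assms(1,3,4) unfolding connected_graph_def by blast
  then obtain m where m: "m \<le> card (adj G)" "(u, v) \<in> adj G ^^ m"
    using rtrancl_finite_eq_relpow[OF fin] by auto
  have "(u, v) \<in> adj G ^^ m \<Longrightarrow> f u v \<le> real m * r" for m v
  proof (induction m arbitrary: v)
    case (Suc m)
    then obtain w where w: "(u, w) \<in> adj G ^^ m" "(w, v) \<in> adj G" by auto
    show ?case using Suc.IH[OF w(1)] assms(6)[OF w(2)] assms(7)[of u v w] by (simp add: algebra_simps)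
  qed (simp add: assms(8))
  then have "f u v \<le> real m * r" using m by blast
  \<comment> \<open>\<open>adj G\<close> consists of ordered pairs of vertices. The bound is crude,
    but all that matters is that it depends on the number of vertices alone.\<close>
  also have "m \<le> (card (verts G))\<^sup>2"
    using m(1) card_mono[OF _ G(2)] G(1) by (simp add: card_cartesian_product power2_eq_square)
  then have "real m * r \<le> real ((card (verts G))\<^sup>2) * r" using assms(5) by (intro mult_right_mono) auto
  finally show ?thesis .
qed

section \<open>Geometric graphs on the torus and in flat space\<close>

definition point_graph :: "'a set \<Rightarrow> real \<Rightarrow> ('a \<Rightarrow> real ^ 'd) \<Rightarrow> 'a graph" where
  "point_graph A r x = Graph A {(i, j). i \<in> A \<and> j \<in> A \<and> i \<noteq> j \<and> torus_dist (x i) (x j) \<le> r}"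

lemma torus_graph_point_graph: "torus_graph n r x = point_graph {1..n} r x"
  unfolding torus_graph_def point_graph_def ..

lemma verts_point_graph [simp]: "verts (point_graph A r x) = A"
  unfolding point_graph_def by simp

lemma adj_point_graph [simp]: "(i, j) \<in> adj (point_graph A r x) \<longleftrightarrow>
    i \<in> A \<and> j \<in> A \<and> i \<noteq> j \<and> torus_dist (x i) (x j) \<le> r"
  unfolding point_graph_def by simp

lemma finite_simple_point_graph: "finite A \<Longrightarrow> finite_simple_graph (point_graph A r x)"
  unfolding finite_simple_graph_def by (auto intro!: symI irreflI simp: torus_dist_commute)

lemma graph_eqI: "verts G = verts H \<Longrightarrow> (\<And>u v. (u, v) \<in> adj G \<longleftrightarrow> (u, v) \<in> adj H) \<Longrightarrow> G = H"
  by (cases G; cases H) auto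

lemma induced_point_graph: "B \<subseteq> A \<Longrightarrow> induced_subgraph (point_graph A r x) B = point_graph B r x"
  by (rule graph_eqI) auto

lemma point_graph_cong: "(\<And>i. i \<in> A \<Longrightarrow> x i = y i) \<Longrightarrow> point_graph A r x = point_graph A r y"
  by (rule graph_eqI) auto

lemma point_graph_reindex:
  assumes "bij_betw e B A"
  shows "point_graph B r (x \<circ> e) \<simeq> point_graph A r x"
  unfolding graph_iso_def
  by (rule exI[of _ e]) (use assms in \<open>auto simp: bij_betw_def inj_on_def\<close>)

text \<open>In each coordinate the circle norm of the difference grows by at most \<open>r\<close>
  along an edge. So a connected set of \<open>s\<close> points stays within \<open>s^2 * r\<close>
  of \<open>v\<close>, where the chart is exact.\<close>

lemma unwrap_connected:
  assumes A: "finite A" "connected_graph (point_graph A r x)" "v \<in> A"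
    and r: "0 < r" "real ((card A)\<^sup>2) * r \<le> 1/4" and uw: "u \<in> A" "w \<in> A"
  shows "torus_dist (x u) (x w) = r * infnorm (unwrap r (x v) (x u) - unwrap r (x v) (x w))"
proof -
  have "\<bar>unwrap r (x v) (x u) $ i\<bar> * r \<le> 1/4" if "u \<in> A" for u i
  proof -
    have "circle_norm (x u $ i - x v $ i) \<le> real ((card (verts (point_graph A r x)))\<^sup>2) * r"
      by (rule connected_additive_bound[OF A(2) finite_simple_point_graph[OF A(1)],
            where f = "\<lambda>u v. circle_norm (x u $ i - x v $ i)"])
        (use that A r circle_norm_triangle[of "x u $ i - x v $ i" "x v $ i - x w $ i" for u v w]
          in \<open>auto simp: torus_dist_le_iff circle_norm_small\<close>)
    then show ?thesis using r by (simp add: circle_norm_eq abs_divide)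
  qed
  then show ?thesis using uw r by (intro torus_dist_unwrap) auto
qed

lemma verts_euclidean_graph [simp]: "verts (euclidean_graph s z) = {1..s}"
  unfolding euclidean_graph_def by simp

lemma adj_euclidean_graph [simp]: "(i, j) \<in> adj (euclidean_graph s z) \<longleftrightarrow>
    i \<in> {1..s} \<and> j \<in> {1..s} \<and> i \<noteq> j \<and> infnorm (z i - z j) \<le> 1"
  unfolding euclidean_graph_def by simp

lemma finite_simple_euclidean_graph: "finite_simple_graph (euclidean_graph s z)"
  unfolding finite_simple_graph_def by (auto intro!: symI irreflI simp: infnorm_sub)

lemma euclidean_connected_bound:
  assumes "connected_graph (euclidean_graph s z)" "z 1 = 0" "u \<in> {1..s}"
  shows "\<bar>z u $ i\<bar> \<le> real (s\<^sup>2)"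
proof -
  have "\<bar>z u $ i - z 1 $ i\<bar> \<le> real ((card (verts (euclidean_graph s z)))\<^sup>2) * 1"
  proof (rule connected_additive_bound[OF assms(1) finite_simple_euclidean_graph,
        where f = "\<lambda>u v. \<bar>z u $ i - z v $ i\<bar>"])
    fix u v assume "(u, v) \<in> adj (euclidean_graph s z)"
    then have "infnorm (z u - z v) \<le> 1" by simp
    then show "\<bar>z u $ i - z v $ i\<bar> \<le> 1" unfolding infnorm_vec_le_iff by simp
  qed (use assms(3) in auto)
  then show ?thesis using assms(2) by simp
qed

lemma connected_iso_right:
  assumes "G \<simeq> H" "connected_graph H" "adj H \<subseteq> verts H \<times> verts H"
  shows "connected_graph G"
  using graph_iso_connected[OF graph_iso_sym[OF assms(1)] assms(2,3)] .

text \<open>Whichever graph is assumed isomorphic to \<open>H\<close> is connected, and its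
  connectivity gives the bound that makes the chart exact: through \<open>unwrap_connected\<close>
  on the torus, through \<open>euclidean_connected_bound\<close> in flat space. The two graphs are
  then equal.\<close>

lemma unwrap_iso_iff:
  assumes H: "connected_graph H" "finite_simple_graph H"
    and s: "1 \<le> s" and r: "0 < r" "real (s\<^sup>2) * r \<le> 1/4"
  shows "point_graph {1..s} r x \<simeq> H \<longleftrightarrow> euclidean_graph s (\<lambda>i. unwrap r (x 1) (x i)) \<simeq> H"
proof -
  let ?y = "\<lambda>i. unwrap r (x 1) (x i)"
  have sub: "adj H \<subseteq> verts H \<times> verts H" using H(2) unfolding finite_simple_graph_def by blast
  have eq: "point_graph {1..s} r x = euclidean_graph s ?y"
    if "\<And>u w. u \<in> {1..s} \<Longrightarrow> w \<in> {1..s} \<Longrightarrow> torus_dist (x u) (x w) = r * infnorm (?y u - ?y w)"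
    by (rule graph_eqI) (use that r in auto)
  show ?thesis
  proof
    assume *: "point_graph {1..s} r x \<simeq> H"
    have "connected_graph (point_graph {1..s} r x)" using connected_iso_right[OF * H(1) sub] .
    then have "point_graph {1..s} r x = euclidean_graph s ?y"
      by (intro eq unwrap_connected[of "{1..s}"]) (use s r in auto)
    then show "euclidean_graph s ?y \<simeq> H" using * by simp
  next
    assume *: "euclidean_graph s ?y \<simeq> H"
    have c: "connected_graph (euclidean_graph s ?y)" using connected_iso_right[OF * H(1) sub] .
    have "\<bar>?y u $ i\<bar> * r \<le> 1/4" if "u \<in> {1..s}" for u i
    proof -
      have "\<bar>?y u $ i\<bar> * r \<le> real (s\<^sup>2) * r"
        using euclidean_connected_bound[OF c _ that, of i] r by (intro mult_right_mono) auto
      with r show ?thesis by linarith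
    qed
    then have "point_graph {1..s} r x = euclidean_graph s ?y"
      by (intro eq torus_dist_unwrap) (use r in auto)
    then show "point_graph {1..s} r x \<simeq> H" using * by simp
  qed
qed

text \<open>The rescaled chart is the required configuration; excluding distances equal to
  \<open>r\<close> turns adjacency at distance at most \<open>r\<close> into the strict inequalities
  of the definition.\<close>

lemma strictly_geometric_point_graph:
  assumes A: "finite A" "connected_graph (point_graph A r x)"
    and r: "0 < r" "real ((card A)\<^sup>2) * r \<le> 1/4"
    and ne: "\<And>u w. u \<in> A \<Longrightarrow> w \<in> A \<Longrightarrow> u \<noteq> w \<Longrightarrow> torus_dist (x u) (x w) \<noteq> r"
  shows "strictly_geometric TYPE('d) (point_graph A r (x :: 'a \<Rightarrow> real ^ 'd))"
proof -
  obtain v where v: "v \<in> A" using A(2) unfolding connected_graph_def by auto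
  define z where "z u = unwrap r (x v) (x u)" for u
  have eq: "torus_dist (x u) (x w) = r * infnorm (z u - z w)" if "u \<in> A" "w \<in> A" for u w
    unfolding z_def by (rule unwrap_connected[OF A v r that])
  have "\<forall>u\<in>A. \<forall>w\<in>A. u \<noteq> w \<longrightarrow> (torus_dist (x u) (x w) \<le> r \<longrightarrow> infnorm (z u - z w) < 1) \<and>
      (\<not> torus_dist (x u) (x w) \<le> r \<longrightarrow> infnorm (z u - z w) > 1)"
  proof (intro ballI impI)
    fix u w assume uw: "u \<in> A" "w \<in> A" "u \<noteq> w"
    with ne have "r * infnorm (z u - z w) \<noteq> r" using eq by metis
    then show "(torus_dist (x u) (x w) \<le> r \<longrightarrow> infnorm (z u - z w) < 1) \<and>
      (\<not> torus_dist (x u) (x w) \<le> r \<longrightarrow> infnorm (z u - z w) > 1)"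
      unfolding eq[OF uw(1,2)] using r(1) by auto
  qed
  then show ?thesis unfolding strictly_geometric_def
    using finite_simple_point_graph[OF A(1)] A(2) by (intro conjI disjI2 exI[of _ z]) auto
qed


section \<open>Measurability, and the uniform distribution seen in a chart\<close>

lemma borel_measurable_vec_iff:
  fixes f :: "'b \<Rightarrow> real ^ 'd"
  shows "f \<in> borel_measurable M \<longleftrightarrow> (\<forall>i. (\<lambda>x. f x $ i) \<in> borel_measurable M)"
proof -
  have "f \<in> borel_measurable M \<longleftrightarrow> (\<forall>b\<in>Basis. (\<lambda>x. f x \<bullet> b) \<in> borel_measurable M)"
    by (rule borel_measurable_euclidean_space)
  then show ?thesis by (auto simp: Basis_vec_def inner_axis)
qed

lemma borel_measurable_vec_nth [measurable]: "(\<lambda>x :: real ^ 'd. x $ i) \<in> borel_measurable borel"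
  using borel_measurable_vec_iff[of "\<lambda>x :: real ^ 'd. x" borel] by simp

lemma centered_measurable [measurable]: "centered \<in> borel_measurable borel"
  unfolding centered_def round_def by measurable

lemma unwrap_measurable [measurable]: "unwrap r v \<in> borel_measurable borel"
  unfolding borel_measurable_vec_iff unwrap_nth by measurable

lemma torus_dist_le_measurable [measurable]:
  assumes [measurable]: "f \<in> borel_measurable M" "g \<in> borel_measurable M"
  shows "Measurable.pred M (\<lambda>x. torus_dist (f x) (g x :: real ^ 'd) \<le> r)"
  unfolding torus_dist_le_iff circle_norm_eq by measurable

lemma torus_dist_measurable [measurable]:
  assumes [measurable]: "f \<in> borel_measurable M" "g \<in> borel_measurable M"
  shows "(\<lambda>x. torus_dist (f x) (g x :: real ^ 'd)) \<in> borel_measurable M"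
  by (rule borel_measurableI_le) (simp add: pred_def[symmetric])

lemma infnorm_measurable [measurable]:
  assumes "f \<in> borel_measurable M"
  shows "(\<lambda>x. infnorm (f x :: real ^ 'd)) \<in> borel_measurable M"
  by (rule measurable_compose[OF assms borel_measurable_continuous_onI])
    (auto intro: continuous_on_infnorm)

text \<open>Half-open because \<open>centered\<close> omits 1/2: for positive \<open>r\<close> and
  \<open>h = 1 / (2 * r)\<close> this is exactly the image of \<open>unwrap r v\<close>.\<close>

definition half_cube :: "real \<Rightarrow> (real ^ 'd) set" where
  "half_cube h = {y. \<forall>i. - h \<le> y $ i \<and> y $ i < h}"

lemma half_cube_measurable [measurable]: "half_cube h \<in> sets borel"
proof -
  have "{y :: real ^ 'd. \<forall>i. - h \<le> y $ i \<and> y $ i < h} \<in> sets borel" by measurable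
  then show ?thesis unfolding half_cube_def .
qed

lemma vec_cube_measurable [measurable]:
  "{x :: real ^ 'd. \<forall>i. x $ i - w $ i \<in> {0..<1}} \<in> sets borel"
  unfolding atLeastLessThan_iff by measurable

lemma emeasure_unit_cube: "emeasure lborel {x :: real ^ 'd. \<forall>i. x $ i \<in> {0..<1}} = 1"
proof (rule antisym)
  have B: "b \<in> Basis \<Longrightarrow> (1 :: real ^ 'd) \<bullet> b = 1" for b :: "real ^ 'd"
    by (auto simp: Basis_vec_def inner_axis)
  have m: "{x :: real ^ 'd. \<forall>i. x $ i \<in> {0..<1}} \<in> sets lborel"
    using vec_cube_measurable[of 0] by simp
  have "emeasure lborel {x :: real ^ 'd. \<forall>i. x $ i \<in> {0..<1}} \<le> emeasure lborel (cbox 0 (1 :: real ^ 'd))"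
    by (rule emeasure_mono) (auto simp: mem_box_cart less_imp_le)
  then show "emeasure lborel {x :: real ^ 'd. \<forall>i. x $ i \<in> {0..<1}} \<le> 1"
    by (simp add: emeasure_lborel_cbox_eq B)
  have "emeasure lborel (box 0 (1 :: real ^ 'd)) \<le> emeasure lborel {x :: real ^ 'd. \<forall>i. x $ i \<in> {0..<1}}"
    by (rule emeasure_mono) (use m in \<open>auto simp: mem_box_cart less_imp_le\<close>)
  then show "1 \<le> emeasure lborel {x :: real ^ 'd. \<forall>i. x $ i \<in> {0..<1}}"
    by (simp add: emeasure_lborel_box_eq B)
qed

lemma sets_uniform_torus [simp, measurable_cong]: "sets uniform_torus = sets borel"
  unfolding uniform_torus_def by simp

lemma space_uniform_torus [simp]: "space uniform_torus = UNIV"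
  unfolding uniform_torus_def by simp

lemma emeasure_uniform_torus:
  assumes "A \<in> sets borel"
  shows "emeasure uniform_torus A = emeasure lborel (A \<inter> {x :: real ^ 'd. \<forall>i. x $ i \<in> {0..<1}})"
  unfolding uniform_torus_def using vec_cube_measurable[of "0 :: real ^ 'd"] assms
  by (subst emeasure_uniform_measure) (auto simp: emeasure_unit_cube[simplified] Int_commute divide_ennreal_def)

lemma prob_space_uniform_torus: "prob_space uniform_torus"
  by (rule prob_spaceI) (simp add: emeasure_uniform_torus emeasure_unit_cube[simplified])

lemma emeasure_lborel_translate:
  assumes "S \<in> sets borel"
  shows "emeasure lborel {x :: real ^ 'd. x + m \<in> S} = emeasure lborel S"
proof -
  have "emeasure lborel S = emeasure (distr lborel borel ((+) m)) S"
    using lborel_distr_plus[of m] by simp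
  also have "\<dots> = emeasure lborel {x. x + m \<in> S}"
    using assms by (subst emeasure_distr) (auto simp: vimage_def add.commute)
  finally show ?thesis by simp
qed

text \<open>The unit cubes at 0 and at \<open>w\<close> are both fundamental domains of the integer
  lattice. One is cut into the pieces that lattice vectors carry into the other, and each piece of a
  periodic set keeps its measure.\<close>

lemma periodic_emeasure_shift:
  fixes A :: "(real ^ 'd) set"
  assumes A [measurable]: "A \<in> sets borel"
    and per: "\<And>(m :: int ^ 'd) x. x + (\<chi> i. of_int (m $ i)) \<in> A \<longleftrightarrow> x \<in> A"
  shows "emeasure lborel (A \<inter> {x. \<forall>i. x $ i \<in> {0..<1}}) =
    emeasure lborel (A \<inter> {x. \<forall>i. x $ i - w $ i \<in> {0..<1}})"
proof -
  define iv where "iv m = (\<chi> i. real_of_int (m $ i))" for m :: "int ^ 'd"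
  define Q where "Q w = {x :: real ^ 'd. \<forall>i. x $ i - w $ i \<in> {0..<1}}" for w
  have Qm [measurable]: "Q w \<in> sets borel" for w unfolding Q_def by measurable
  have iv_nth [simp]: "iv m $ i = of_int (m $ i)" for m i unfolding iv_def by simp
  \<comment> \<open>Coordinatewise, the only integer shift that brings \<open>x\<close> into the
    cube at \<open>w\<close> is minus the floor of \<open>x - w\<close>.\<close>
  have tile: "\<exists>!m. x + iv m \<in> Q w" for x w
  proof (rule ex1I)
    show "x + iv (\<chi> i. - \<lfloor>x $ i - w $ i\<rfloor>) \<in> Q w"
      unfolding Q_def by (auto simp: algebra_simps) linarith+
    fix m assume "x + iv m \<in> Q w"
    then have "m $ i = - \<lfloor>x $ i - w $ i\<rfloor>" for i
      unfolding Q_def by (auto dest!: spec[of _ i]) linarith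
    then show "m = (\<chi> i. - \<lfloor>x $ i - w $ i\<rfloor>)" by (simp add: vec_eq_iff)
  qed
  have tile': "\<exists>!m. x - iv m \<in> Q w" for x w
  proof -
    have neg: "iv (- m) = - iv m" for m by (simp add: vec_eq_iff)
    obtain m where m: "x + iv m \<in> Q w" "\<And>m'. x + iv m' \<in> Q w \<Longrightarrow> m' = m" using tile[of x w] by blast
    show ?thesis
    proof (rule ex1I)
      show "x - iv (- m) \<in> Q w" using m(1) by (simp add: neg)
      fix m' assume "x - iv m' \<in> Q w"
      then have "x + iv (- m') \<in> Q w" by (simp add: neg)
      then show "m' = - m" using m(2) by force
    qed
  qed
  have ex: "\<exists>m. x + iv m \<in> Q w" and uniq: "x + iv m \<in> Q w \<Longrightarrow> x + iv m' \<in> Q w \<Longrightarrow> m = m'"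
    and ex': "\<exists>m. x - iv m \<in> Q w" and uniq': "x - iv m \<in> Q w \<Longrightarrow> x - iv m' \<in> Q w \<Longrightarrow> m = m'"
    for x w m m'
    using tile[of x w] tile'[of x w] by blast+
  have T [measurable]: "{x. x + iv m \<in> Q w} \<in> sets borel" "{x. x - iv m \<in> Q w} \<in> sets borel" for m w
    by measurable
  have "emeasure lborel (A \<inter> Q 0) = emeasure lborel (\<Union>m. A \<inter> Q 0 \<inter> {x. x + iv m \<in> Q w})"
    by (rule arg_cong[where f = "emeasure lborel"]) (use ex in blast)
  also have "\<dots> = (\<integral>\<^sup>+m. emeasure lborel (A \<inter> Q 0 \<inter> {x. x + iv m \<in> Q w}) \<partial>count_space UNIV)"
    by (rule emeasure_UN_countable) (use uniq in \<open>auto simp: disjoint_family_on_def\<close>)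
  also have "\<dots> = (\<integral>\<^sup>+m. emeasure lborel (A \<inter> {x. x - iv m \<in> Q 0} \<inter> Q w) \<partial>count_space UNIV)"
  proof (rule nn_integral_cong)
    fix m
    \<comment> \<open>Translation by \<open>iv m\<close> maps the piece of \<open>Q 0\<close> that
      lands in \<open>Q w\<close> onto the piece of \<open>Q w\<close> that comes from
      \<open>Q 0\<close>; periodicity preserves membership in \<open>A\<close>.\<close>
    have "{x. x + iv m \<in> A \<inter> {x. x - iv m \<in> Q 0} \<inter> Q w} = A \<inter> Q 0 \<inter> {x. x + iv m \<in> Q w}"
      using per[of _ m, folded iv_def] by auto
    then show "emeasure lborel (A \<inter> Q 0 \<inter> {x. x + iv m \<in> Q w}) =
        emeasure lborel (A \<inter> {x. x - iv m \<in> Q 0} \<inter> Q w)"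
      using emeasure_lborel_translate[of "A \<inter> {x. x - iv m \<in> Q 0} \<inter> Q w" "iv m"] by simp
  qed
  also have "\<dots> = emeasure lborel (\<Union>m. A \<inter> {x. x - iv m \<in> Q 0} \<inter> Q w)"
    by (rule emeasure_UN_countable[symmetric]) (use uniq' in \<open>auto simp: disjoint_family_on_def\<close>)
  also have "\<dots> = emeasure lborel (A \<inter> Q w)"
    by (rule arg_cong[where f = "emeasure lborel"]) (use ex' in blast)
  finally show ?thesis unfolding Q_def by simp
qed

lemma emeasure_lborel_scale:
  fixes B :: "(real ^ 'd) set"
  assumes [measurable]: "B \<in> sets borel" and r: "0 < r"
  shows "emeasure lborel {x. (1 / r) *\<^sub>R (x - v) \<in> B} = ennreal (r ^ CARD('d)) * emeasure lborel B"
proof -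
  have m: "{x. (1 / r) *\<^sub>R (x - v) \<in> B} \<in> sets borel" by measurable
  have "emeasure lborel {x. (1 / r) *\<^sub>R (x - v) \<in> B} =
      emeasure (density (distr lborel borel (\<lambda>x. v + r *\<^sub>R x)) (\<lambda>_. \<bar>r\<bar>^DIM(real ^ 'd)))
        {x. (1 / r) *\<^sub>R (x - v) \<in> B}"
    using lborel_affine[of r v] r by simp
  also have "\<dots> = ennreal (r ^ CARD('d)) * emeasure (distr lborel borel (\<lambda>x. v + r *\<^sub>R x)) {x. (1 / r) *\<^sub>R (x - v) \<in> B}"
    using m r by (subst emeasure_density_const) (auto simp: ennreal_power)
  also have "emeasure (distr lborel borel (\<lambda>x. v + r *\<^sub>R x)) {x. (1 / r) *\<^sub>R (x - v) \<in> B} = emeasure lborel B"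
    using m r by (subst emeasure_distr) (auto simp: vimage_def)
  finally show ?thesis .
qed

text \<open>By periodicity the cube of representatives may be replaced by the one centred at
  \<open>v\<close>, on which \<open>unwrap r v\<close> is the affine map \<open>(x - v) / r\<close>;
  the scaling gives the factor \<open>r ^ CARD('d)\<close>.\<close>

lemma distr_unwrap:
  fixes v :: "real ^ 'd"
  assumes r: "0 < r"
  shows "distr uniform_torus borel (unwrap r v) =
    density lborel (\<lambda>y. ennreal (r ^ CARD('d)) * indicator (half_cube (1 / (2 * r))) y)"
proof (rule measure_eqI)
  fix B :: "(real ^ 'd) set" assume "B \<in> sets (distr uniform_torus borel (unwrap r v))"
  then have B [measurable]: "B \<in> sets borel" by simp
  let ?A = "{x. unwrap r v x \<in> B}"
  \<comment> \<open>The lower corner of the unit cube centred at \<open>v\<close>.\<close>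
  define w where "w = v - (\<chi> i. 1/2)"
  have A [measurable]: "?A \<in> sets borel" by measurable
  have "emeasure (distr uniform_torus borel (unwrap r v)) B = emeasure uniform_torus ?A"
    by (subst emeasure_distr) (auto simp: vimage_def)
  also have "\<dots> = emeasure lborel (?A \<inter> {x. \<forall>i. x $ i \<in> {0..<1}})"
    by (rule emeasure_uniform_torus) fact
  also have "\<dots> = emeasure lborel (?A \<inter> {x. \<forall>i. x $ i - w $ i \<in> {0..<1}})"
  proof (rule periodic_emeasure_shift[OF A])
    fix m :: "int ^ 'd" and x
    have "unwrap r v (x + (\<chi> i. of_int (m $ i))) = unwrap r v x"
      using centered_add_int[of "x $ i - v $ i" "m $ i" for i] by (simp add: vec_eq_iff algebra_simps)
    then show "x + (\<chi> i. of_int (m $ i)) \<in> ?A \<longleftrightarrow> x \<in> ?A" by simp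
  qed
  also have "?A \<inter> {x. \<forall>i. x $ i - w $ i \<in> {0..<1}} = {x. (1 / r) *\<^sub>R (x - v) \<in> B \<inter> half_cube (1 / (2 * r))}"
  proof (rule set_eqI)
    fix x
    have 1: "(\<forall>i. x $ i - w $ i \<in> {0..<1}) \<longleftrightarrow> (1 / r) *\<^sub>R (x - v) \<in> half_cube (1 / (2 * r))"
    proof -
      have "x $ i - w $ i \<in> {0..<1} \<longleftrightarrow>
          - (1 / (2 * r)) \<le> ((1 / r) *\<^sub>R (x - v)) $ i \<and> ((1 / r) *\<^sub>R (x - v)) $ i < 1 / (2 * r)" for i
      proof -
        have "- (1 / (2 * r)) \<le> ((1 / r) *\<^sub>R (x - v)) $ i \<longleftrightarrow> - (1/2) \<le> x $ i - v $ i"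
          "((1 / r) *\<^sub>R (x - v)) $ i < 1 / (2 * r) \<longleftrightarrow> x $ i - v $ i < 1/2"
        proof -
          have "- (1 / (2 * r)) \<le> (1 / r) * z \<longleftrightarrow> - (1/2) \<le> z" "(1 / r) * z < 1 / (2 * r) \<longleftrightarrow> z < 1/2" for z
            using r by (auto simp: field_simps)
          from this[of "x $ i - v $ i"] show "- (1 / (2 * r)) \<le> ((1 / r) *\<^sub>R (x - v)) $ i \<longleftrightarrow> - (1/2) \<le> x $ i - v $ i"
            "((1 / r) *\<^sub>R (x - v)) $ i < 1 / (2 * r) \<longleftrightarrow> x $ i - v $ i < 1/2" by simp_all
        qed
        then show ?thesis unfolding w_def by auto
      qed
      then show ?thesis unfolding half_cube_def by simp
    qed
    have 2: "unwrap r v x = (1 / r) *\<^sub>R (x - v)" if "\<forall>i. x $ i - w $ i \<in> {0..<1}"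
    proof -
      have "centered (x $ i - v $ i) = x $ i - v $ i" for i
      proof -
        have "0 \<le> x $ i - v $ i + 1/2" "x $ i - v $ i + 1/2 < 1"
          using that unfolding w_def by (auto simp: algebra_simps)
        then have "round (x $ i - v $ i) = 0" unfolding round_def by linarith
        then show ?thesis unfolding centered_def by simp
      qed
      then show ?thesis by (simp add: vec_eq_iff)
    qed
    show "x \<in> ?A \<inter> {x. \<forall>i. x $ i - w $ i \<in> {0..<1}} \<longleftrightarrow>
        x \<in> {x. (1 / r) *\<^sub>R (x - v) \<in> B \<inter> half_cube (1 / (2 * r))}"
      using 1 2 by auto
  qed
  also have "emeasure lborel \<dots> = ennreal (r ^ CARD('d)) * emeasure lborel (B \<inter> half_cube (1 / (2 * r)))"
    by (rule emeasure_lborel_scale[OF _ r]) measurable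
  also have "\<dots> = (\<integral>\<^sup>+y. ennreal (r ^ CARD('d)) * indicator (B \<inter> half_cube (1 / (2 * r))) y \<partial>lborel)"
    by (subst nn_integral_cmult_indicator) auto
  also have "\<dots> = (\<integral>\<^sup>+y. (ennreal (r ^ CARD('d)) * indicator (half_cube (1 / (2 * r))) y) * indicator B y \<partial>lborel)"
    by (rule nn_integral_cong) (auto simp: indicator_def)
  also have "\<dots> = emeasure (density lborel (\<lambda>y. ennreal (r ^ CARD('d)) * indicator (half_cube (1 / (2 * r))) y)) B"
    by (subst emeasure_density) auto
  finally show "emeasure (distr uniform_torus borel (unwrap r v)) B =
    emeasure (density lborel (\<lambda>y. ennreal (r ^ CARD('d)) * indicator (half_cube (1 / (2 * r))) y)) B" .
qed simp

text \<open>Taken at scale 1, where the density is at most 1. The estimates derived from it thus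
  include the radius 0, at which \<open>unwrap r\<close> degenerates.\<close>

lemma emeasure_unwrap_le:
  fixes v :: "real ^ 'd"
  assumes [measurable]: "B \<in> sets borel"
  shows "emeasure uniform_torus {x. unwrap 1 v x \<in> B} \<le> emeasure lborel B"
proof -
  have "emeasure uniform_torus {x. unwrap 1 v x \<in> B} = emeasure (distr uniform_torus borel (unwrap 1 v)) B"
    by (subst emeasure_distr) (auto simp: vimage_def)
  also have "\<dots> = (\<integral>\<^sup>+y. ennreal (1 ^ CARD('d)) * indicator (half_cube (1 / (2 * 1))) y * indicator B y \<partial>lborel)"
    by (subst distr_unwrap) (auto simp: emeasure_density)
  also have "\<dots> \<le> (\<integral>\<^sup>+y. indicator B y \<partial>lborel)"
    by (rule nn_integral_mono) (auto simp: indicator_def)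
  finally show ?thesis by simp
qed

lemma emeasure_torus_ball_le:
  fixes v :: "real ^ 'd"
  assumes "0 \<le> r"
  shows "emeasure uniform_torus {x. torus_dist v x \<le> r} \<le> ennreal ((2 * r) ^ CARD('d))"
proof -
  have "{x. torus_dist v x \<le> r} = {x. unwrap 1 v x \<in> cbox (\<chi> i. - r) (\<chi> i. r)}"
    unfolding torus_dist_commute[of v] torus_dist_le_iff circle_norm_eq
    by (auto simp: mem_box_cart abs_le_iff minus_le_iff)
  then have "emeasure uniform_torus {x. torus_dist v x \<le> r} \<le> emeasure lborel (cbox (\<chi> i. - r) (\<chi> i. r ) :: (real ^ 'd) set)"
    using emeasure_unwrap_le[of "cbox (\<chi> i. - r) (\<chi> i. r)" v] by simp
  also have "\<dots> = ennreal ((2 * r) ^ CARD('d))"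
  proof -
    have "((\<chi> i. r) - (\<chi> i. - r)) \<bullet> b = 2 * r" "(\<chi> i. - r) \<bullet> b \<le> (\<chi> i. r) \<bullet> b" if "b \<in> Basis" for b :: "real ^ 'd"
      using that assms by (auto simp: Basis_vec_def inner_axis)
    then show ?thesis by (subst emeasure_lborel_cbox_eq) (use assms in \<open>auto simp: prod_ennreal\<close>)
  qed
  finally show ?thesis .
qed

text \<open>A point at distance exactly \<open>r\<close> has some chart coordinate equal to
  \<open>r\<close> or \<open>- r\<close>, and finitely many hyperplanes form a null set.\<close>

lemma emeasure_torus_sphere:
  fixes v :: "real ^ 'd"
  shows "emeasure uniform_torus {x. torus_dist v x = r} = 0"
proof -
  let ?N = "\<Union>i. {y :: real ^ 'd. y $ i = r} \<union> {y. y $ i = - r}"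
  have "{y :: real ^ 'd. y $ i = c} \<in> null_sets lborel" for i c
  proof -
    have "negligible {y :: real ^ 'd. y $ i = c}" using negligible_standard_hyperplane[of "axis i 1 :: real ^ 'd" c] by (simp add: inner_axis)
    moreover have "{y :: real ^ 'd. y $ i = c} \<in> sets borel" by measurable
    ultimately show ?thesis by (simp add: negligible_iff_null_sets null_sets_completion_iff)
  qed
  then have N: "?N \<in> null_sets lborel" by (intro null_sets_UN null_sets.Un) auto
  have sub: "{x. torus_dist v x = r} \<subseteq> {x. unwrap 1 v x \<in> ?N}"
  proof
    fix x assume "x \<in> {x. torus_dist v x = r}"
    then have "torus_dist x v = r" by (simp add: torus_dist_commute)
    then have "r \<in> range (\<lambda>i. circle_norm (x $ i - v $ i))"
      using Max_in[of "range (\<lambda>i. circle_norm (x $ i - v $ i))"] unfolding torus_dist_def by auto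
    then obtain i where "r = \<bar>centered (x $ i - v $ i)\<bar>" unfolding circle_norm_eq by auto
    then have "unwrap 1 v x $ i = r \<or> unwrap 1 v x $ i = - r" by (auto simp: abs_if)
    then show "x \<in> {x. unwrap 1 v x \<in> ?N}" by blast
  qed
  have "?N \<in> sets borel" using N by auto
  then have "emeasure uniform_torus {x. torus_dist v x = r} \<le> emeasure uniform_torus {x. unwrap 1 v x \<in> ?N}"
    by (intro emeasure_mono[OF sub]) simp
  also have "\<dots> \<le> emeasure lborel ?N" using \<open>?N \<in> sets borel\<close> by (rule emeasure_unwrap_le)
  also have "\<dots> = 0" using N by auto
  finally show ?thesis by simp
qed

lemma PiM_density:
  fixes f :: "'a::euclidean_space \<Rightarrow> ennreal" and I :: "'i set"
  assumes I: "finite I" and f [measurable]: "f \<in> borel_measurable borel"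
    and "sigma_finite_measure (density lborel f)"
  shows "PiM I (\<lambda>_. density lborel f) = density (PiM I (\<lambda>_. lborel)) (\<lambda>y. \<Prod>i\<in>I. f (y i))"
proof -
  interpret D: product_sigma_finite "\<lambda>_ :: 'i. density lborel f" using assms(3) by (simp add: product_sigma_finite_def)
  interpret L: product_sigma_finite "\<lambda>_ :: 'i. lborel :: 'a measure" by (simp add: product_sigma_finite_def sigma_finite_lborel)
  show ?thesis
  proof (rule D.PiM_eqI[symmetric, OF I])
    show "sets (density (PiM I (\<lambda>_. lborel)) (\<lambda>y. \<Prod>i\<in>I. f (y i))) = sets (PiM I (\<lambda>_. density lborel f))"
      by (simp cong: sets_PiM_cong)
    fix A assume "\<And>i. i \<in> I \<Longrightarrow> A i \<in> sets (density lborel f)"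
    then have A [measurable]: "\<And>i. i \<in> I \<Longrightarrow> A i \<in> sets borel" by simp
    have "emeasure (density (PiM I (\<lambda>_. lborel)) (\<lambda>y. \<Prod>i\<in>I. f (y i))) (Pi\<^sub>E I A) =
        (\<integral>\<^sup>+y. (\<Prod>i\<in>I. f (y i)) * indicator (Pi\<^sub>E I A) y \<partial>PiM I (\<lambda>_. lborel))"
      by (rule emeasure_density) (use I in \<open>auto intro!: sets_PiM_I_finite borel_measurable_prod\<close>)
    also have "\<dots> = (\<integral>\<^sup>+y. (\<Prod>i\<in>I. f (y i) * indicator (A i) (y i)) \<partial>PiM I (\<lambda>_. lborel))"
    proof (rule nn_integral_cong)
      fix y assume "y \<in> space (PiM I (\<lambda>_. lborel :: 'a measure))"
      then have "indicator (Pi\<^sub>E I A) y = (\<Prod>i\<in>I. indicator (A i) (y i) :: ennreal)"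
        using I by (auto simp: indicator_def space_PiM PiE_iff prod_zero_iff)
      then show "(\<Prod>i\<in>I. f (y i)) * indicator (Pi\<^sub>E I A) y = (\<Prod>i\<in>I. f (y i) * indicator (A i) (y i))"
        by (simp add: prod.distrib)
    qed
    also have "\<dots> = (\<Prod>i\<in>I. \<integral>\<^sup>+y. f y * indicator (A i) y \<partial>lborel)"
      by (rule L.product_nn_integral_prod[OF I]) measurable
    also have "\<dots> = (\<Prod>i\<in>I. emeasure (density lborel f) (A i))"
      by (rule prod.cong) (auto simp: emeasure_density)
    finally show "emeasure (density (PiM I (\<lambda>_. lborel)) (\<lambda>y. \<Prod>i\<in>I. f (y i))) (Pi\<^sub>E I A) =
      (\<Prod>i\<in>I. emeasure (density lborel f) (A i))" .
  qed
qed


section \<open>A recursion for component counts\<close>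


text \<open>All that the Poisson limit needs to know about the random graph: edges leaving a set are
  unlikely given the graph on the set, and disjoint sets carry independent graphs.\<close>

locale sparse_random_graph = prob_space L for L :: "nat graph measure" +
  fixes n :: nat and p :: real
  assumes sets_L: "sets L = UNIV"
    and AE_graph: "AE g in L. finite_simple_graph g \<and> verts g = {1..n}"
    and p_nonneg: "0 \<le> p"
    and edge_given: "\<lbrakk>S \<subseteq> {1..n}; i \<in> S; j \<in> {1..n} - S\<rbrakk> \<Longrightarrow>
      prob {g. Q (induced_subgraph g S) \<and> (i, j) \<in> adj g} \<le> p * prob {g. Q (induced_subgraph g S)}"
    and indep_induced: "\<lbrakk>S \<subseteq> {1..n}; T \<subseteq> {1..n}; S \<inter> T = {}\<rbrakk> \<Longrightarrow>
      prob {g. Q (induced_subgraph g S) \<and> R (induced_subgraph g T)} =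
      prob {g. Q (induced_subgraph g S)} * prob {g. R (induced_subgraph g T)}"
begin

lemma in_events [simp]: "A \<in> events"
  by (simp add: sets_L)

lemma space_L [simp]: "space L = UNIV"
  using sets.sets_into_space[of UNIV L] by auto

lemma measurable_L: "f \<in> borel_measurable L"
  by (simp add: measurable_def sets_L)

lemma prob_le:
  assumes "\<And>g. finite_simple_graph g \<Longrightarrow> verts g = {1..n} \<Longrightarrow> P g \<Longrightarrow> Q g"
  shows "prob {g. P g} \<le> prob {g. Q g}"
  by (rule finite_measure_mono_AE) (use AE_graph assms in auto)

lemma prob_Ex_le:
  assumes "finite I"
  shows "prob {g. \<exists>i\<in>I. P i g} \<le> (\<Sum>i\<in>I. prob {g. P i g})"
proof -
  have "{g. \<exists>i\<in>I. P i g} = (\<Union>i\<in>I. {g. P i g})" by auto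
  then show ?thesis using finite_measure_subadditive_finite[OF assms, of "\<lambda>i. {g. P i g}"] by (simp add: sets_L)
qed

lemma prob_or_le: "prob {g. P g \<or> Q g} \<le> prob {g. P g} + prob {g. Q g}"
proof -
  have "{g. P g \<or> Q g} = {g. P g} \<union> {g. Q g}" by auto
  then show ?thesis using measure_Un_le[of "{g. P g}" L "{g. Q g}"] by simp
qed

text \<open>Union bound over at most \<open>card S * n\<close> pairs. The probability of
  \<open>Q\<close> is kept as a factor because this error is later summed over all
  \<open>s\<close>-sets and must stay small compared with the expected number of copies.\<close>

lemma prob_not_isolated_given:
  assumes S: "S \<subseteq> {1..n}"
  shows "prob {g. Q (induced_subgraph g S) \<and> \<not> isolated_set g S} \<le>
    real (card S) * real n * p * prob {g. Q (induced_subgraph g S)}"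
proof -
  let ?q = "prob {g. Q (induced_subgraph g S)}"
  have fin: "finite S" using S finite_subset by blast
  have "prob {g. Q (induced_subgraph g S) \<and> \<not> isolated_set g S} \<le>
      prob {g. \<exists>i\<in>S. \<exists>j\<in>{1..n} - S. Q (induced_subgraph g S) \<and> (i, j) \<in> adj g}"
    by (rule prob_le) (use S in \<open>auto simp: isolated_set_def\<close>)
  also have "\<dots> \<le> (\<Sum>i\<in>S. prob {g. \<exists>j\<in>{1..n} - S. Q (induced_subgraph g S) \<and> (i, j) \<in> adj g})"
    by (rule prob_Ex_le[OF fin])
  also have "\<dots> \<le> (\<Sum>i\<in>S. real n * (p * ?q))"
  proof (rule sum_mono)
    fix i assume i: "i \<in> S"
    have "prob {g. \<exists>j\<in>{1..n} - S. Q (induced_subgraph g S) \<and> (i, j) \<in> adj g} \<le>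
        (\<Sum>j\<in>{1..n} - S. prob {g. Q (induced_subgraph g S) \<and> (i, j) \<in> adj g})"
      by (rule prob_Ex_le) auto
    also have "\<dots> \<le> (\<Sum>j\<in>{1..n} - S. p * ?q)"
      by (rule sum_mono) (use edge_given[OF S i] in auto)
    also have "\<dots> = real (card ({1..n} - S)) * (p * ?q)" by simp
    also have "\<dots> \<le> real n * (p * ?q)"
      using card_mono[of "{1..n}" "{1..n} - S"] p_nonneg by (intro mult_right_mono) auto
    finally show "prob {g. \<exists>j\<in>{1..n} - S. Q (induced_subgraph g S) \<and> (i, j) \<in> adj g} \<le> real n * (p * ?q)" .
  qed
  also have "\<dots> = real (card S) * real n * p * ?q" by simp
  finally show ?thesis .
qed

lemma prob_ex_not_isolated:
  assumes S: "S \<subseteq> {1..n}"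
  shows "prob {g. \<exists>u\<in>S. \<not> isolated_set g {u}} \<le> real (card S) * real n * p"
proof -
  have "prob {g. \<exists>u\<in>S. \<not> isolated_set g {u}} \<le> (\<Sum>u\<in>S. prob {g. \<not> isolated_set g {u}})"
    by (rule prob_Ex_le) (use S finite_subset in blast)
  also have "\<dots> \<le> (\<Sum>u\<in>S. real n * p)"
  proof (rule sum_mono)
    fix u assume u: "u \<in> S"
    show "prob {g. \<not> isolated_set g {u}} \<le> real n * p"
      using prob_not_isolated_given[of "{u}" "\<lambda>_. True"] u S prob_space by auto
  qed
  finally show ?thesis by simp
qed

section \<open>The recursion for components on \<open>s\<close> vertices\<close>

context
  fixes A :: "nat graph set" and s :: nat and H :: "nat graph" and \<pi> :: real
  assumes A: "\<And>K. K \<in> A \<Longrightarrow> connected_graph K" "\<And>K. K \<in> A \<Longrightarrow> finite_simple_graph K"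
      "\<And>K. K \<in> A \<Longrightarrow> card (verts K) = s"
      "\<And>K K'. K \<in> A \<Longrightarrow> K' \<in> A \<Longrightarrow> K \<simeq> K' \<Longrightarrow> K = K'"
    and s: "2 \<le> s" and H: "H \<in> A"
    and \<pi>: "\<And>S. S \<subseteq> {1..n} \<Longrightarrow> card S = s \<Longrightarrow> prob {g. induced_subgraph g S \<simeq> H} = \<pi>"
begin

abbreviation "subsets \<equiv> {S. S \<subseteq> {1..n} \<and> card S = s}"

lemma finite_subsets: "finite subsets" and card_subsets: "card subsets = n choose s"
  using n_subsets[of "{1..n}" s] by (auto intro: finite_subset[of _ "Pow {1..n}"])

lemma component_count_sum:
  assumes "finite_simple_graph g" "verts g = {1..n}"
  shows "real (component_count g H) =
    (\<Sum>S\<in>subsets. indicator {g. S \<in> component_sets g \<and> induced_subgraph g S \<simeq> H} g)"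
proof -
  let ?P = "\<lambda>S. S \<in> component_sets g \<and> induced_subgraph g S \<simeq> H"
  have "{S \<in> component_sets g. induced_subgraph g S \<simeq> H} = subsets \<inter> {S. ?P S}"
  proof -
    have "S \<in> subsets" if "?P S" for S
    proof -
      have "card (verts (induced_subgraph g S)) = card (verts H)" using that by (intro graph_iso_card) simp
      then show ?thesis using that component_sets_subset[of g] assms(2) A(3)[OF H] by auto
    qed
    then show ?thesis by blast
  qed
  then have "component_count g H = card (subsets \<inter> {S. ?P S})" unfolding component_count_def by simp
  moreover have "real (card (subsets \<inter> {S. ?P S})) = (\<Sum>S\<in>subsets. of_bool (?P S))"
    using finite_subsets by (simp only: sum_of_bool_eq)
  ultimately show ?thesis by (simp add: indicator_def)
qed

text \<open>Double counting: on the event \<open>count_vector A g = m\<close> the number of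
  components isomorphic to \<open>H\<close> is the constant \<open>m H\<close>; it is also a sum of
  indicators over the \<open>s\<close>-sets.\<close>

lemma weighted_count_prob:
  "real (m H) * prob {g. count_vector A g = m} =
    (\<Sum>S\<in>subsets. prob {g. S \<in> component_sets g \<and> induced_subgraph g S \<simeq> H \<and> count_vector A g = m})"
proof -
  let ?E = "\<lambda>S. {g. S \<in> component_sets g \<and> induced_subgraph g S \<simeq> H \<and> count_vector A g = m}"
  have "(\<Sum>S\<in>subsets. prob (?E S)) = (\<Sum>S\<in>subsets. expectation (indicator (?E S)))" by simp
  also have "\<dots> = expectation (\<lambda>g. \<Sum>S\<in>subsets. indicator (?E S) g)"
    by (rule Bochner_Integration.integral_sum[symmetric]) (auto simp: integrable_indicator_iff less_top[symmetric])
  also have "\<dots> = expectation (\<lambda>g. real (m H) * indicator {g. count_vector A g = m} g)"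
  proof (rule integral_cong_AE)
    show "AE g in L. (\<Sum>S\<in>subsets. indicator (?E S) g) = real (m H) * indicator {g. count_vector A g = m} g"
      using AE_graph
    proof eventually_elim
      case (elim g)
      show ?case
      proof (cases "count_vector A g = m")
        case True
        then have "real (m H) = (\<Sum>S\<in>subsets. indicator {g. S \<in> component_sets g \<and> induced_subgraph g S \<simeq> H} g)"
          using H component_count_sum[of g] elim by (auto simp: count_vector_def)
        also have "\<dots> = (\<Sum>S\<in>subsets. indicator (?E S) g)"
          using True by (intro sum.cong) (auto simp: indicator_def)
        finally show ?thesis using True by simp
      qed (simp add: indicator_def)
    qed
  qed (rule measurable_L)+
  also have "\<dots> = real (m H) * prob {g. count_vector A g = m}" by simp
  finally show ?thesis by simp
qed

text \<open>Markov's inequality, with the mean bounded by the expected number of induced copies of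
  \<open>H\<close>; it later supplies tightness.\<close>

lemma count_le:
  "real k * prob {g. k \<le> component_count g H} \<le> real (n choose s) * \<pi>"
proof -
  let ?E = "\<lambda>S. {g. S \<in> component_sets g \<and> induced_subgraph g S \<simeq> H}"
  have "real k * prob {g. k \<le> component_count g H} = expectation (\<lambda>g. real k * indicator {g. k \<le> component_count g H} g)"
    by simp
  also have "\<dots> \<le> expectation (\<lambda>g. \<Sum>S\<in>subsets. indicator (?E S) g)"
  proof (rule integral_mono_AE)
    show "AE g in L. real k * indicator {g. k \<le> component_count g H} g \<le> (\<Sum>S\<in>subsets. indicator (?E S) g)"
      using AE_graph
    proof eventually_elim
      case (elim g)
      have "(\<Sum>S\<in>subsets. indicator (?E S) g) = real (component_count g H)"
        using component_count_sum[of g] elim by simp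
      then show ?case by (simp add: indicator_def del: of_bool_eq)
    qed
  qed (auto simp: integrable_indicator_iff less_top[symmetric])
  also have "\<dots> = (\<Sum>S\<in>subsets. prob (?E S))"
    by (subst Bochner_Integration.integral_sum) (auto simp: integrable_indicator_iff less_top[symmetric])
  also have "\<dots> \<le> (\<Sum>S\<in>subsets. \<pi>)"
  proof (rule sum_mono)
    fix S assume "S \<in> subsets"
    then show "prob (?E S) \<le> \<pi>" using \<pi>[of S] prob_le[of "\<lambda>g. S \<in> component_sets g \<and> induced_subgraph g S \<simeq> H"
        "\<lambda>g. induced_subgraph g S \<simeq> H"] by auto
  qed
  also have "\<dots> = real (n choose s) * \<pi>" using card_subsets by simp
  finally show ?thesis .
qed

text \<open>Two replacements, each costing at most \<open>\<pi> * (s * n * p)\<close>: being a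
  component is weakened to being an induced copy of \<open>H\<close>, and the counts on the
  complement of \<open>S\<close> are replaced by those on the whole graph. In between, independence
  of the two induced graphs gives the product.\<close>

lemma component_prob:
  assumes S: "S \<subseteq> {1..n}" "card S = s" and m: "m H \<ge> 1"
  shows "\<bar>prob {g. S \<in> component_sets g \<and> induced_subgraph g S \<simeq> H \<and> count_vector A g = m}
    - \<pi> * prob {g. count_vector A g = m(H := m H - 1)}\<bar> \<le> \<pi> * (2 * real s * real n * p)"
proof -
  let ?T = "{1..n} - S"
  let ?m = "m(H := m H - 1)"
  let ?comp = "\<lambda>g. S \<in> component_sets g \<and> induced_subgraph g S \<simeq> H \<and> count_vector A g = m"
  let ?ind = "\<lambda>g. induced_subgraph g S \<simeq> H \<and> count_vector A (induced_subgraph g ?T) = ?m"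
  have \<pi>0: "0 \<le> \<pi>" using \<pi>[OF S] measure_nonneg[of L] by metis
  have subH: "adj H \<subseteq> verts H \<times> verts H" using A(2)[OF H] unfolding finite_simple_graph_def by blast
  have del: "delete_verts g S = induced_subgraph g ?T" if "verts g = {1..n}" for g
    using that unfolding delete_verts_def by simp
  \<comment> \<open>Removing the component \<open>S\<close> lowers only the count of
    \<open>H\<close>: distinct members of \<open>A\<close> are not isomorphic.\<close>
  have cv: "count_vector A g = m \<longleftrightarrow> count_vector A (induced_subgraph g ?T) = ?m"
    if g: "finite_simple_graph g" "verts g = {1..n}" "S \<in> component_sets g" "induced_subgraph g S \<simeq> H" for g
  proof -
    have "count_vector A g K = count_vector A (induced_subgraph g ?T) K + of_bool (K = H)" for K
    proof (cases "K \<in> A")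
      case True
      have "induced_subgraph g S \<simeq> K \<longleftrightarrow> K = H"
        using A(4)[OF H True] graph_iso_trans[OF graph_iso_sym[OF g(4)]] g(4) by blast
      then show ?thesis using component_count_delete[OF g(1,3), of K] True del[OF g(2)]
        by (simp add: count_vector_def)
    qed (use H in \<open>auto simp: count_vector_def\<close>)
    moreover have "m K = ?m K + of_bool (K = H)" for K using m by simp
    ultimately have "count_vector A g K = m K \<longleftrightarrow> count_vector A (induced_subgraph g ?T) K = ?m K" for K
      by (metis add_right_cancel)
    then show ?thesis by (simp only: fun_eq_iff)
  qed
  have iso_comp: "S \<in> component_sets g \<longleftrightarrow> isolated_set g S"
    if "finite_simple_graph g" "induced_subgraph g S \<simeq> H" for g
    by (rule component_sets_iso[of g H]) (use that A(1)[OF H] subH in \<open>auto simp: finite_simple_graph_def\<close>)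
  have ub: "prob {g. ?comp g} \<le> prob {g. ?ind g}" by (rule prob_le) (use cv in blast)
  have "prob {g. ?ind g} \<le> prob {g. ?comp g \<or> (induced_subgraph g S \<simeq> H \<and> \<not> isolated_set g S)}"
    by (rule prob_le) (use cv iso_comp in blast)
  also have "\<dots> \<le> prob {g. ?comp g} + prob {g. induced_subgraph g S \<simeq> H \<and> \<not> isolated_set g S}"
    by (rule prob_or_le)
  also have "prob {g. induced_subgraph g S \<simeq> H \<and> \<not> isolated_set g S} \<le> real s * real n * p * \<pi>"
    using prob_not_isolated_given[OF S(1), of "\<lambda>g. g \<simeq> H"] \<pi>[OF S] S(2) by simp
  finally have lb: "prob {g. ?ind g} \<le> prob {g. ?comp g} + real s * real n * p * \<pi>" by simp
  \<comment> \<open>The counts on \<open>?T\<close> are read off a graph independent of the one on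
    \<open>S\<close>; this is the purpose of passing to \<open>?ind\<close>.\<close>
  have ind: "prob {g. ?ind g} = \<pi> * prob {g. count_vector A (induced_subgraph g ?T) = ?m}"
    using indep_induced[OF S(1), of ?T "\<lambda>g. g \<simeq> H" "\<lambda>g. count_vector A g = ?m"] \<pi>[OF S] by simp
  \<comment> \<open>Here \<open>2 \<le> s\<close> enters: deleting isolated vertices changes no
    count in \<open>A\<close>.\<close>
  have same: "count_vector A (induced_subgraph g ?T) = count_vector A g"
    if g: "finite_simple_graph g" "verts g = {1..n}" "\<And>u. u \<in> S \<Longrightarrow> isolated_set g {u}" for g
  proof
    fix K
    show "count_vector A (induced_subgraph g ?T) K = count_vector A g K"
    proof (cases "K \<in> A")
      case True
      then have "component_count (delete_verts g S) K = component_count g K"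
        using A(1-3)[OF True] s g(3)
        by (intro component_count_delete_isolated[OF g(1)]) (auto simp: finite_simple_graph_def)
      then show ?thesis using del[OF g(2)] by (simp add: count_vector_def)
    qed (simp add: count_vector_def)
  qed
  have ni: "prob {g. \<exists>u\<in>S. \<not> isolated_set g {u}} \<le> real s * real n * p"
    using prob_ex_not_isolated[OF S(1)] S(2) by simp
  let ?a = "prob {g. count_vector A (induced_subgraph g ?T) = ?m}" and ?b = "prob {g. count_vector A g = ?m}"
  have "?a \<le> prob {g. count_vector A g = ?m \<or> (\<exists>u\<in>S. \<not> isolated_set g {u})}"
    by (rule prob_le) (use same in metis)
  then have 1: "?a \<le> ?b + real s * real n * p"
    using prob_or_le[of "\<lambda>g. count_vector A g = ?m" "\<lambda>g. \<exists>u\<in>S. \<not> isolated_set g {u}"] ni by linarith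
  have "?b \<le> prob {g. count_vector A (induced_subgraph g ?T) = ?m \<or> (\<exists>u\<in>S. \<not> isolated_set g {u})}"
    by (rule prob_le) (use same in metis)
  then have 2: "?b \<le> ?a + real s * real n * p"
    using prob_or_le[of "\<lambda>g. count_vector A (induced_subgraph g ?T) = ?m" "\<lambda>g. \<exists>u\<in>S. \<not> isolated_set g {u}"] ni
    by linarith
  have "\<bar>\<pi> * ?a - \<pi> * ?b\<bar> \<le> \<pi> * (real s * real n * p)"
    using 1 2 \<pi>0 by (simp add: abs_mult right_diff_distrib[symmetric] abs_le_iff mult_left_mono)
  moreover have "\<bar>prob {g. ?comp g} - \<pi> * ?a\<bar> \<le> \<pi> * (real s * real n * p)"
    using ub lb ind p_nonneg \<pi>0 by (simp add: abs_le_iff algebra_simps)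
  ultimately show ?thesis by (simp add: algebra_simps)
qed

text \<open>The asymptotic form \<open>m H * P(m) = \<lambda> * P(m - e\<^sub>H)\<close> of this recursion characterises the
  product of Poisson distributions; it replaces the computation of factorial moments.\<close>

lemma count_recursion:
  assumes m: "m H \<ge> 1"
  shows "\<bar>real (m H) * prob {g. count_vector A g = m}
      - real (n choose s) * \<pi> * prob {g. count_vector A g = m(H := m H - 1)}\<bar>
    \<le> real (n choose s) * \<pi> * (2 * real s * real n * p)"
proof -
  let ?b = "prob {g. count_vector A g = m(H := m H - 1)}"
  let ?c = "\<lambda>S. prob {g. S \<in> component_sets g \<and> induced_subgraph g S \<simeq> H \<and> count_vector A g = m}"
  have "real (m H) * prob {g. count_vector A g = m} - real (n choose s) * \<pi> * ?b = (\<Sum>S\<in>subsets. ?c S - \<pi> * ?b)"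
    unfolding weighted_count_prob sum_subtractf using card_subsets by simp
  then have "\<bar>real (m H) * prob {g. count_vector A g = m} - real (n choose s) * \<pi> * ?b\<bar>
      \<le> (\<Sum>S\<in>subsets. \<bar>?c S - \<pi> * ?b\<bar>)" by (simp only: sum_abs)
  also have "\<dots> \<le> (\<Sum>S\<in>subsets. \<pi> * (2 * real s * real n * p))"
    by (rule sum_mono) (use component_prob m in auto)
  also have "\<dots> = real (n choose s) * \<pi> * (2 * real s * real n * p)" using card_subsets by simp
  finally show ?thesis .
qed

end

end


section \<open>The probability of a given induced subgraph\<close>


text \<open>With a fixed finite vertex set there are finitely many values, and each is determined by
  finitely many edge events.\<close>

lemma graph_valued_measurable:
  assumes A: "finite A" and g: "\<And>x. x \<in> space M \<Longrightarrow> verts (g x) = A" "\<And>x. x \<in> space M \<Longrightarrow> adj (g x) \<subseteq> A \<times> A"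
    and [measurable]: "\<And>i j. i \<in> A \<Longrightarrow> j \<in> A \<Longrightarrow> Measurable.pred M (\<lambda>x. (i, j) \<in> adj (g x))"
  shows "g \<in> measurable M (count_space UNIV)"
proof -
  let ?R = "Graph A ` Pow (A \<times> A)"
  have mem: "g x \<in> ?R" if "x \<in> space M" for x
    using g[OF that] by (cases "g x") auto
  have "g \<in> measurable M (count_space ?R)"
  proof (subst measurable_count_space_eq2)
    show "finite ?R" using A by simp
    have "g -` {K} \<inter> space M \<in> sets M" if "K \<in> ?R" for K
    proof -
      obtain E where K: "K = Graph A E" "E \<subseteq> A \<times> A" using \<open>K \<in> ?R\<close> by auto
      have "g x = K \<longleftrightarrow> (\<forall>i\<in>A. \<forall>j\<in>A. (i, j) \<in> adj (g x) \<longleftrightarrow> (i, j) \<in> E)" if "x \<in> space M" for x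
        using g[OF that] K by (cases "g x") auto
      then have "g -` {K} \<inter> space M = {x \<in> space M. \<forall>i\<in>A. \<forall>j\<in>A. (i, j) \<in> adj (g x) \<longleftrightarrow> (i, j) \<in> E}"
        by auto
      moreover have "{x \<in> space M. \<forall>i\<in>A. \<forall>j\<in>A. (i, j) \<in> adj (g x) \<longleftrightarrow> (i, j) \<in> E} \<in> sets M"
        using A by measurable
      ultimately show ?thesis by simp
    qed
    then show "g \<in> space M \<rightarrow> ?R \<and> (\<forall>a\<in>?R. g -` {a} \<inter> space M \<in> sets M)" using mem by blast
  qed
  then show ?thesis using measurable_compose[OF _ measurable_count_space] by fast
qed

lemma point_graph_measurable:
  assumes "finite A" and [measurable]: "\<And>i. i \<in> A \<Longrightarrow> (\<lambda>x. f x i) \<in> borel_measurable M"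
  shows "(\<lambda>x. point_graph A r (f x)) \<in> measurable M (count_space UNIV)"
  by (rule graph_valued_measurable[OF assms(1)]) (auto simp: pred_def[symmetric])

lemma euclidean_graph_measurable:
  assumes [measurable]: "\<And>i. i \<in> {1..s} \<Longrightarrow> (\<lambda>x. f x i) \<in> borel_measurable M"
  shows "(\<lambda>x. euclidean_graph s (f x)) \<in> measurable M (count_space UNIV)"
  by (rule graph_valued_measurable[of "{1..s}"]) (auto simp: pred_def[symmetric])

lemma euclidean_graph_cong:
  "(\<And>i. i \<in> {1..s} \<Longrightarrow> x i = y i) \<Longrightarrow> euclidean_graph s x = euclidean_graph s y"
  by (rule graph_eqI) auto

lemma component_borel_measurable:
  assumes "i \<in> I" "\<And>i. sets (M i) = sets borel"
  shows "(\<lambda>x. x i) \<in> borel_measurable (PiM I M)"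
  using measurable_component_singleton[OF assms(1), of M] measurable_cong_sets[OF refl assms(2)] by blast

text \<open>The first point is fixed at \<open>v\<close> and the others are viewed in the chart
  around \<open>v\<close>, where each has density \<open>r ^ CARD('d)\<close> on a cube of side
  \<open>1 / r\<close>. A connected copy of \<open>H\<close> stays inside that cube, so the
  truncation of the density is invisible and the value does not depend on \<open>v\<close>.\<close>

lemma emeasure_point_graph_iso:
  fixes H :: "'a graph"
  assumes H: "connected_graph H" "finite_simple_graph H" and s: "s = card (verts H)"
    and r: "0 < r" "real (s\<^sup>2) * r \<le> 1/4"
  shows "emeasure (PiM {1..s} (\<lambda>_. uniform_torus :: (real ^ 'd) measure))
      {x \<in> space (PiM {1..s} (\<lambda>_. uniform_torus)). point_graph {1..s} r x \<simeq> H} =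
    ennreal (r ^ (CARD('d) * (s - 1))) * emeasure (PiM {2..s} (\<lambda>_. lborel :: (real ^ 'd) measure))
      {y \<in> space (PiM {2..s} (\<lambda>_. lborel)). euclidean_graph s (y(1 := 0)) \<simeq> H}"
proof -
  let ?U = "\<lambda>_::nat. uniform_torus :: (real ^ 'd) measure"
  let ?L = "\<lambda>_::nat. lborel :: (real ^ 'd) measure"
  let ?I = "{2..s}"
  define h where "h g = (indicator {g. g \<simeq> H} g :: ennreal)" for g :: "nat graph"
  \<comment> \<open>The density of one rescaled point, from \<open>distr_unwrap\<close>.\<close>
  define f where "f y = ennreal (r ^ CARD('d)) * indicator (half_cube (1 / (2 * r))) y" for y :: "real ^ 'd"
  have f_meas [measurable]: "f \<in> borel_measurable borel" unfolding f_def by measurable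
  have s1: "1 \<le> s" using H unfolding s connected_graph_def finite_simple_graph_def
    by (simp add: Suc_le_eq card_gt_0_iff)
  have ins: "{1..s} = insert 1 ?I" using s1 by auto
  interpret U: product_sigma_finite ?U
    by (simp add: product_sigma_finite_def prob_space_uniform_torus prob_space_imp_sigma_finite)
  have hm: "(\<lambda>x. h (gr x)) \<in> borel_measurable M" if "gr \<in> measurable M (count_space UNIV)" for gr and M :: "'b measure"
    by (rule measurable_compose[OF that]) simp
  have pgU: "(\<lambda>x. point_graph {1..s} r x) \<in> measurable (PiM {1..s} ?U) (count_space UNIV)"
    by (rule point_graph_measurable) (auto intro: component_borel_measurable)
  have egm: "(\<lambda>y. euclidean_graph s (y(1 := 0))) \<in> measurable (PiM ?I M) (count_space UNIV)"
    if "\<And>i. sets (M i) = sets borel" for M :: "nat \<Rightarrow> (real ^ 'd) measure"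
  proof (rule euclidean_graph_measurable)
    fix i assume "i \<in> {1..s}"
    then show "(\<lambda>y. (y(1 := 0)) i) \<in> borel_measurable (PiM ?I M)"
      using component_borel_measurable[of i ?I M, OF _ that] by (cases "i = 1") auto
  qed
  have E: "emeasure M {x \<in> space M. gr x \<simeq> H} = (\<integral>\<^sup>+x. h (gr x) \<partial>M)"
    if "gr \<in> measurable M (count_space UNIV)" for gr and M :: "(nat \<Rightarrow> real ^ 'd) measure"
  proof -
    have "{x \<in> space M. gr x \<simeq> H} = gr -` {g. g \<simeq> H} \<inter> space M" by auto
    then have "{x \<in> space M. gr x \<simeq> H} \<in> sets M" using measurable_sets[OF that, of "{g. g \<simeq> H}"] by simp
    then have "emeasure M {x \<in> space M. gr x \<simeq> H} = (\<integral>\<^sup>+x. indicator {x \<in> space M. gr x \<simeq> H} x \<partial>M)"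
      by simp
    also have "\<dots> = (\<integral>\<^sup>+x. h (gr x) \<partial>M)"
      by (rule nn_integral_cong) (auto simp: h_def indicator_def)
    finally show ?thesis .
  qed
  have egL: "(\<lambda>y. euclidean_graph s (y(1 := 0))) \<in> measurable (PiM ?I ?L) (count_space UNIV)"
    by (rule egm) simp
  have hL: "(\<lambda>y. h (euclidean_graph s (y(1 := 0)))) \<in> borel_measurable (PiM ?I ?L)"
    by (rule hm[OF egL])
  have fL: "(\<lambda>y. \<Prod>i\<in>?I. f (y i)) \<in> borel_measurable (PiM ?I ?L)"
    by measurable
  define V where "V = emeasure (PiM ?I ?L) {y \<in> space (PiM ?I ?L). euclidean_graph s (y(1 := 0)) \<simeq> H}"
  have inner: "(\<integral>\<^sup>+x. h (point_graph {1..s} r (x(1 := v))) \<partial>PiM ?I ?U) = ennreal (r ^ (CARD('d) * (s - 1))) * V" for v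
  proof -
    have dist: "distr (PiM ?I ?U) (PiM ?I ?U) (compose ?I (unwrap r v)) = density (PiM ?I ?L) (\<lambda>y. \<Prod>i\<in>?I. f (y i))"
    proof -
      have d: "distr uniform_torus uniform_torus (unwrap r v) = density lborel f"
      proof -
        have "distr uniform_torus uniform_torus (unwrap r v) = distr uniform_torus borel (unwrap r v)"
          by (rule distr_cong) auto
        also have "\<dots> = density lborel f" unfolding distr_unwrap[OF r(1)] f_def ..
        finally show ?thesis .
      qed
      have "prob_space (distr uniform_torus uniform_torus (unwrap r v))"
        by (rule prob_space.prob_space_distr[OF prob_space_uniform_torus]) measurable
      then have sf: "sigma_finite_measure (density lborel f)" unfolding d by (rule prob_space_imp_sigma_finite)
      have "distr (PiM ?I ?U) (PiM ?I ?U) (compose ?I (unwrap r v)) = PiM ?I (\<lambda>_. distr uniform_torus uniform_torus (unwrap r v))"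
        by (rule distr_PiM_finite_prob_space') (auto simp: prob_space_uniform_torus)
      then show ?thesis unfolding d using PiM_density[OF _ f_meas sf, of ?I] by simp
    qed
    have cm: "compose ?I (unwrap r v) \<in> measurable (PiM ?I ?U) (PiM ?I ?U)"
      unfolding compose_def
    proof (rule measurable_restrict)
      fix i assume "i \<in> ?I"
      then have [measurable]: "(\<lambda>x. x i) \<in> borel_measurable (PiM ?I ?U)" by (rule component_borel_measurable) simp
      show "(\<lambda>x. unwrap r v (x i)) \<in> measurable (PiM ?I ?U) uniform_torus" by measurable
    qed
    have "(\<integral>\<^sup>+x. h (point_graph {1..s} r (x(1 := v))) \<partial>PiM ?I ?U) =
        (\<integral>\<^sup>+x. h (euclidean_graph s ((compose ?I (unwrap r v) x)(1 := 0))) \<partial>PiM ?I ?U)"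
    proof (rule nn_integral_cong)
      fix x :: "nat \<Rightarrow> real ^ 'd"
      have "point_graph {1..s} r (x(1 := v)) \<simeq> H \<longleftrightarrow>
          euclidean_graph s (\<lambda>i. unwrap r ((x(1 := v)) 1) ((x(1 := v)) i)) \<simeq> H"
        by (rule unwrap_iso_iff[OF H s1 r])
      also have "euclidean_graph s (\<lambda>i. unwrap r ((x(1 := v)) 1) ((x(1 := v)) i)) =
          euclidean_graph s ((compose ?I (unwrap r v) x)(1 := 0))"
        by (rule euclidean_graph_cong) (auto simp: compose_def)
      finally show "h (point_graph {1..s} r (x(1 := v))) = h (euclidean_graph s ((compose ?I (unwrap r v) x)(1 := 0)))"
        unfolding h_def indicator_def mem_Collect_eq by (simp only:)
    qed
    also have "\<dots> = (\<integral>\<^sup>+y. h (euclidean_graph s (y(1 := 0))) \<partial>distr (PiM ?I ?U) (PiM ?I ?U) (compose ?I (unwrap r v)))"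
      by (rule nn_integral_distr[symmetric, OF cm]) (simp only: measurable_distr_eq1, rule hm[OF egm], simp)
    also have "\<dots> = (\<integral>\<^sup>+y. (\<Prod>i\<in>?I. f (y i)) * h (euclidean_graph s (y(1 := 0))) \<partial>PiM ?I ?L)"
      unfolding dist by (rule nn_integral_density[OF fL hL])
    also have "\<dots> = (\<integral>\<^sup>+y. ennreal (r ^ (CARD('d) * (s - 1))) * h (euclidean_graph s (y(1 := 0))) \<partial>PiM ?I ?L)"
    proof (rule nn_integral_cong)
      fix y :: "nat \<Rightarrow> real ^ 'd"
      show "(\<Prod>i\<in>?I. f (y i)) * h (euclidean_graph s (y(1 := 0))) =
          ennreal (r ^ (CARD('d) * (s - 1))) * h (euclidean_graph s (y(1 := 0)))"
      proof (cases "euclidean_graph s (y(1 := 0)) \<simeq> H")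
        case True
        have c: "connected_graph (euclidean_graph s (y(1 := 0)))"
          using connected_iso_right[OF True H(1)] H(2) unfolding finite_simple_graph_def by blast
        \<comment> \<open>In a connected copy all coordinates are at most \<open>s^2\<close>, which
          is at most \<open>1 / (4 * r)\<close> and so within the support of
          \<open>f\<close>.\<close>
        have "f (y i) = ennreal (r ^ CARD('d))" if i: "i \<in> ?I" for i
        proof -
          have "\<bar>y i $ j\<bar> < 1 / (2 * r)" for j
          proof -
            have "\<bar>(y(1 := 0)) i $ j\<bar> \<le> real (s\<^sup>2)"
              by (rule euclidean_connected_bound[OF c]) (use i in auto)
            then have "\<bar>y i $ j\<bar> \<le> real (s\<^sup>2)" using i by auto
            also have "\<dots> \<le> 1 / (4 * r)" using r by (simp add: field_simps)
            also have "\<dots> < 1 / (2 * r)" using r by (simp add: field_simps)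
            finally show ?thesis .
          qed
          then have "y i \<in> half_cube (1 / (2 * r))" unfolding half_cube_def
            by (auto simp: abs_less_iff less_imp_le) (metis less_imp_le minus_less_iff)
          then show ?thesis unfolding f_def by simp
        qed
        \<comment> \<open>\<open>{2..s}\<close> has \<open>s - 1\<close> elements: the first point
          contributes no factor.\<close>
        then have "(\<Prod>i\<in>?I. f (y i)) = ennreal (r ^ CARD('d)) ^ (s - 1)" by simp
        also have "\<dots> = ennreal (r ^ (CARD('d) * (s - 1)))"
          using r(1) by (simp add: ennreal_power power_mult)
        finally show ?thesis by simp
      qed (simp add: h_def)
    qed
    also have "\<dots> = ennreal (r ^ (CARD('d) * (s - 1))) * V"
      unfolding V_def E[OF egL] by (rule nn_integral_cmult[OF hL])
    finally show ?thesis .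
  qed
  have "emeasure (PiM {1..s} ?U) {x \<in> space (PiM {1..s} ?U). point_graph {1..s} r x \<simeq> H} =
      (\<integral>\<^sup>+x. h (point_graph {1..s} r x) \<partial>PiM {1..s} ?U)"
    by (rule E[OF pgU])
  also have "\<dots> = (\<integral>\<^sup>+v. \<integral>\<^sup>+x. h (point_graph {1..s} r (x(1 := v))) \<partial>PiM ?I ?U \<partial>uniform_torus)"
    using hm[OF pgU] unfolding ins by (intro U.product_nn_integral_insert_rev) auto
  also have "\<dots> = (\<integral>\<^sup>+v. ennreal (r ^ (CARD('d) * (s - 1))) * V \<partial>(uniform_torus :: (real ^ 'd) measure))"
    unfolding inner ..
  also have "\<dots> = ennreal (r ^ (CARD('d) * (s - 1))) * V"
    by (simp add: prob_space.emeasure_space_1[OF prob_space_uniform_torus, simplified])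
  finally show ?thesis unfolding V_def .
qed

section \<open>Finiteness and positivity of the geometric constants\<close>

lemma geometric_constant_measure:
  "geometric_constant TYPE('d::finite) H = measure (PiM {2..card (verts H)} (\<lambda>_. lborel :: (real ^ 'd) measure))
    {y \<in> space (PiM {2..card (verts H)} (\<lambda>_. lborel)). euclidean_graph (card (verts H)) (y(1 := 0)) \<simeq> H}"
proof -
  let ?M = "PiM {2..card (verts H)} (\<lambda>_. lborel :: (real ^ 'd) measure)"
  let ?A = "{y \<in> space ?M. euclidean_graph (card (verts H)) (y(1 := 0)) \<simeq> H}"
  have "geometric_constant TYPE('d) H = (\<integral>y. indicator ?A y \<partial>?M)"
    unfolding geometric_constant_def Let_def
    by (rule Bochner_Integration.integral_cong) (auto simp: indicator_def)
  also have "\<dots> = measure ?M ?A" by (simp add: Int_absorb2)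
  finally show ?thesis .
qed

lemma measure_point_graph_iso:
  assumes "connected_graph H" "finite_simple_graph H" "s = card (verts H)"
    and "0 < r" "real (s\<^sup>2) * r \<le> 1/4"
  shows "measure (PiM {1..s} (\<lambda>_. uniform_torus :: (real ^ 'd) measure))
      {x \<in> space (PiM {1..s} (\<lambda>_. uniform_torus)). point_graph {1..s} r x \<simeq> H} =
    r ^ (CARD('d) * (s - 1)) * geometric_constant TYPE('d) H"
  unfolding geometric_constant_measure measure_def emeasure_point_graph_iso[OF assms, where 'd = 'd]
  using assms by (simp add: enn2real_mult)

text \<open>At the radius \<open>1 / (4 * s^2)\<close> the volume times a positive factor is a
  probability. Finiteness matters because \<open>measure\<close> would return 0 for an infinite
  volume.\<close>

lemma emeasure_iso_volume_finite:
  assumes H: "connected_graph H" "finite_simple_graph H" "s = card (verts H)"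
  shows "emeasure (PiM {2..s} (\<lambda>_. lborel :: (real ^ 'd) measure))
    {y \<in> space (PiM {2..s} (\<lambda>_. lborel)). euclidean_graph s (y(1 := 0)) \<simeq> H} < \<infinity>" (is "?V < \<infinity>")
proof -
  have s1: "1 \<le> s" using H unfolding connected_graph_def finite_simple_graph_def
    by (simp add: Suc_le_eq card_gt_0_iff)
  define r where "r = 1 / (4 * real (s\<^sup>2))"
  have r: "0 < r" "real (s\<^sup>2) * r \<le> 1/4" using s1 unfolding r_def by auto
  interpret prob_space "PiM {1..s} (\<lambda>_. uniform_torus :: (real ^ 'd) measure)"
    by (rule prob_space_PiM) (rule prob_space_uniform_torus)
  have "ennreal (r ^ (CARD('d) * (s - 1))) * ?V < \<infinity>"
    unfolding emeasure_point_graph_iso[OF H r, where 'd = 'd, symmetric]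
    by (rule le_less_trans[OF emeasure_le_1]) simp
  then show ?thesis using r(1) by (auto simp: ennreal_mult_less_top)
qed

text \<open>Strict inequalities survive small perturbations, so a whole box of configurations around
  a witness induces \<open>H\<close>, and a box has positive volume.\<close>

lemma geometric_constant_pos:
  fixes H :: "'a graph"
  assumes H: "strictly_geometric TYPE('d::finite) H" and s: "2 \<le> card (verts H)"
  shows "0 < geometric_constant TYPE('d) H"
proof -
  define s where "s = card (verts H)"
  let ?I = "{2..s}"
  let ?L = "\<lambda>_::nat. lborel :: (real ^ 'd) measure"
  have fH: "finite_simple_graph H" "connected_graph H" using H unfolding strictly_geometric_def by auto
  obtain z :: "'a \<Rightarrow> real ^ 'd" where z: "\<And>u v. u \<in> verts H \<Longrightarrow> v \<in> verts H \<Longrightarrow> u \<noteq> v \<Longrightarrow>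
      ((u, v) \<in> adj H \<longrightarrow> infnorm (z u - z v) < 1) \<and> ((u, v) \<notin> adj H \<longrightarrow> infnorm (z u - z v) > 1)"
    using H s unfolding strictly_geometric_def by auto
  have "finite (verts H)" using fH unfolding finite_simple_graph_def by blast
  then obtain e where e: "bij_betw e {1..s} (verts H)"
    using finite_same_card_bij[of "{1..s}" "verts H"] unfolding s_def by auto
  \<comment> \<open>Translated so that the first vertex sits at 0, as in the definition of the
    constant.\<close>
  define w where "w i = z (e i) - z (e 1)" for i
  let ?P = "{(i, j). i \<in> {1..s} \<and> j \<in> {1..s} \<and> i \<noteq> j}"
  have finP: "finite ?P" by (rule finite_subset[of _ "{1..s} \<times> {1..s}"]) auto
  \<comment> \<open>Half the smallest gap between a distance and 1, capped by the inserted 1. Two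
    points moved by less than \<open>\<delta>\<close> change their distance by less than
    \<open>2 * \<delta>\<close>, so no distance crosses 1.\<close>
  define \<delta> where "\<delta> = Min (insert 1 ((\<lambda>(i, j). \<bar>infnorm (w i - w j) - 1\<bar>) ` ?P)) / 2"
  have ne: "infnorm (w i - w j) \<noteq> 1" and adj: "(e i, e j) \<in> adj H \<longleftrightarrow> infnorm (w i - w j) \<le> 1"
    if "i \<in> {1..s}" "j \<in> {1..s}" "i \<noteq> j" for i j
  proof -
    have "e i \<in> verts H" "e j \<in> verts H" "e i \<noteq> e j"
      using bij_betwE[OF e] inj_on_eq_iff[OF bij_betw_imp_inj_on[OF e]] that by auto
    from z[OF this] have "((e i, e j) \<in> adj H \<longrightarrow> infnorm (w i - w j) < 1) \<and>
        ((e i, e j) \<notin> adj H \<longrightarrow> infnorm (w i - w j) > 1)" by (simp add: w_def)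
    then show "infnorm (w i - w j) \<noteq> 1" "(e i, e j) \<in> adj H \<longleftrightarrow> infnorm (w i - w j) \<le> 1"
      by linarith+
  qed
  have "0 < Min (insert 1 ((\<lambda>(i, j). \<bar>infnorm (w i - w j) - 1\<bar>) ` ?P))"
    by (subst Min_gr_iff) (use finP ne in auto)
  then have \<delta>0: "0 < \<delta>" unfolding \<delta>_def by simp
  have \<delta>: "2 * \<delta> \<le> \<bar>infnorm (w i - w j) - 1\<bar>" if "i \<in> {1..s}" "j \<in> {1..s}" "i \<noteq> j" for i j
    unfolding \<delta>_def using that finP by (auto intro!: Min_le)
  define B where "B = Pi\<^sub>E ?I (\<lambda>i. box (w i - (\<chi> k. \<delta>)) (w i + (\<chi> k. \<delta>)))"
  let ?A = "{y \<in> space (PiM ?I ?L). euclidean_graph s (y(1 := 0)) \<simeq> H}"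
  have sub: "B \<subseteq> ?A"
  proof
    fix y assume y: "y \<in> B"
    have near: "infnorm ((y(1 := 0)) i - w i) < \<delta>" if "i \<in> {1..s}" for i
    proof (cases "i = 1")
      case True then show ?thesis using \<delta>0 by (simp add: w_def infnorm_0)
    next
      case False
      then have "i \<in> ?I" using that by auto
      then have "y i \<in> box (w i - (\<chi> k. \<delta>)) (w i + (\<chi> k. \<delta>))" using y unfolding B_def by auto
      then show ?thesis using False unfolding infnorm_vec_less_iff by (auto simp: mem_box_cart abs_less_iff)
          (smt (verit))+
    qed
    have "(i, j) \<in> adj (euclidean_graph s (y(1 := 0))) \<longleftrightarrow> (e i, e j) \<in> adj H"
      if ij: "i \<in> {1..s}" "j \<in> {1..s}" for i j
    proof (cases "i = j")
      case True
      then show ?thesis using fH(1) unfolding finite_simple_graph_def irrefl_def by auto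
    next
      case False
      let ?y = "y(1 := 0)"
      have "\<bar>infnorm (?y i - ?y j) - infnorm (w i - w j)\<bar> \<le> infnorm ((?y i - ?y j) - (w i - w j))"
        by (rule absdiff_infnorm)
      also have "(?y i - ?y j) - (w i - w j) = (?y i - w i) + - (?y j - w j)" by simp
      also have "infnorm \<dots> \<le> infnorm (?y i - w i) + infnorm (?y j - w j)"
        using infnorm_triangle[of "?y i - w i" "- (?y j - w j)"] by (simp only: infnorm_neg)
      also have "\<dots> < 2 * \<delta>" using near[OF ij(1)] near[OF ij(2)] by simp
      finally have "infnorm (?y i - ?y j) \<le> 1 \<longleftrightarrow> infnorm (w i - w j) \<le> 1"
        using \<delta>[OF ij False] by linarith
      then show ?thesis using adj[OF ij False] ij False by simp
    qed
    then have "euclidean_graph s (y(1 := 0)) \<simeq> H" unfolding graph_iso_def using e by (intro exI[of _ e]) auto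
    moreover have "y \<in> space (PiM ?I ?L)" using y unfolding B_def by (auto simp: space_PiM PiE_iff)
    ultimately show "y \<in> ?A" by blast
  qed
  interpret L: product_sigma_finite ?L by (simp add: product_sigma_finite_def sigma_finite_lborel)
  have "0 < emeasure (PiM ?I ?L) B"
  proof -
    have "emeasure (PiM ?I ?L) B = (\<Prod>i\<in>?I. emeasure lborel (box (w i - (\<chi> k. \<delta>)) (w i + (\<chi> k. \<delta>))))"
      unfolding B_def by (rule L.emeasure_PiM) auto
    moreover have "emeasure lborel (box (w i - (\<chi> k. \<delta>)) (w i + (\<chi> k. \<delta>))) \<noteq> 0" for i
    proof -
      have "(w i - (\<chi> k. \<delta>)) \<bullet> b \<le> (w i + (\<chi> k. \<delta>)) \<bullet> b"
        "((w i + (\<chi> k. \<delta>)) - (w i - (\<chi> k. \<delta>))) \<bullet> b = 2 * \<delta>" if "b \<in> Basis" for b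
        using that \<delta>0 by (auto simp: Basis_vec_def inner_axis)
      then show ?thesis using \<delta>0 by (subst emeasure_lborel_box_eq) (auto simp: prod_ennreal)
    qed
    ultimately show ?thesis by (simp add: zero_less_iff_neq_zero)
  qed
  also have "\<dots> \<le> emeasure (PiM ?I ?L) ?A"
  proof (rule emeasure_mono[OF sub])
    have "(\<lambda>y. euclidean_graph s (y(1 := 0))) \<in> measurable (PiM ?I ?L) (count_space UNIV)"
    proof (rule euclidean_graph_measurable)
      fix i assume "i \<in> {1..s}"
      then show "(\<lambda>y. (y(1 := 0)) i) \<in> borel_measurable (PiM ?I ?L)"
        using component_borel_measurable[of i ?I ?L] by (cases "i = 1") auto
    qed
    then have "(\<lambda>y. euclidean_graph s (y(1 := 0))) -` {g. g \<simeq> H} \<inter> space (PiM ?I ?L) \<in> sets (PiM ?I ?L)"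
      by (rule measurable_sets) simp
    then show "?A \<in> sets (PiM ?I ?L)" by (simp add: vimage_def Int_def conj_commute)
  qed
  finally have "0 < emeasure (PiM ?I ?L) ?A" .
  then show ?thesis
    unfolding geometric_constant_measure s_def[symmetric] measure_def
    using emeasure_iso_volume_finite[OF fH(2,1) s_def, where 'd = 'd] by (simp add: enn2real_positive_iff)
qed


section \<open>The law of the torus graph\<close>


locale torus_points = prob_space M for M :: "'w measure" +
  fixes X :: "nat \<Rightarrow> 'w \<Rightarrow> real ^ 'd" and n :: nat and r :: real
  assumes indep: "indep_vars (\<lambda>_. borel) X {1..n}"
    and uniform: "i \<in> {1..n} \<Longrightarrow> distr M borel (X i) = uniform_torus"
    and r_nonneg: "0 \<le> r"
begin

definition graph_on :: "nat set \<Rightarrow> 'w \<Rightarrow> nat graph" where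
  "graph_on S \<omega> = point_graph S r (\<lambda>i. X i \<omega>)"

text \<open>Every set of graphs is an event of the law, so that measurability is settled once and for all.\<close>

definition law :: "nat graph measure" where
  "law = distr M (count_space UNIV) (graph_on {1..n})"

lemma X_measurable: "i \<in> {1..n} \<Longrightarrow> X i \<in> borel_measurable M"
  using indep unfolding indep_vars_def by auto

lemma graph_on_measurable: "S \<subseteq> {1..n} \<Longrightarrow> graph_on S \<in> measurable M (count_space UNIV)"
  unfolding graph_on_def
proof (rule point_graph_measurable)
  assume S: "S \<subseteq> {1..n}"
  then show "finite S" using finite_subset by blast
  fix i assume "i \<in> S"
  with S have "i \<in> {1..n}" by blast
  then show "X i \<in> borel_measurable M" by (rule X_measurable)
qed

lemma graph_on_event: "S \<subseteq> {1..n} \<Longrightarrow> {\<omega> \<in> space M. Q (graph_on S \<omega>)} \<in> events"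
  using measurable_sets[OF graph_on_measurable, of S "{g. Q g}"] by (simp add: vimage_def Int_def conj_commute)

lemma measure_law: "measure law {g. Q g} = prob {\<omega> \<in> space M. Q (graph_on {1..n} \<omega>)}"
  unfolding law_def
  by (subst measure_distr[OF graph_on_measurable]) (auto intro!: arg_cong[where f = prob])

lemma sets_law: "sets law = UNIV"
  unfolding law_def by simp

lemma prob_space_law: "prob_space law"
  unfolding law_def by (rule prob_space_distr[OF graph_on_measurable]) simp

lemma induced_graph_on: "S \<subseteq> {1..n} \<Longrightarrow> induced_subgraph (graph_on {1..n} \<omega>) S = graph_on S \<omega>"
  unfolding graph_on_def by (rule induced_point_graph)

lemma restrict_measurable: "S \<subseteq> {1..n} \<Longrightarrow> (\<lambda>\<omega>. restrict (\<lambda>i. X i \<omega>) S) \<in> measurable M (PiM S (\<lambda>_. borel))"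
  by (rule measurable_restrict) (use X_measurable in auto)

lemma graph_on_restrict: "graph_on S \<omega> = point_graph S r (restrict (\<lambda>i. X i \<omega>) S)"
  unfolding graph_on_def by (rule point_graph_cong) simp

text \<open>\<open>X j\<close> is independent of the points indexed by \<open>S\<close>, so
  integrating over it first gives at most \<open>c\<close> whatever the point \<open>X i\<close> is.
  A general relation \<open>R\<close> covers both edges and distances equal to
  \<open>r\<close>.\<close>

lemma prob_given_le:
  assumes S: "S \<subseteq> {1..n}" "i \<in> S" "j \<in> {1..n} - S"
    and R [measurable]: "Measurable.pred (borel \<Otimes>\<^sub>M borel) (\<lambda>(v, x). R v x)"
    and bound: "\<And>v. emeasure uniform_torus {x. R v x} \<le> ennreal c" and c: "0 \<le> c"
  shows "prob {\<omega> \<in> space M. Q (graph_on S \<omega>) \<and> R (X i \<omega>) (X j \<omega>)} \<le> c * prob {\<omega> \<in> space M. Q (graph_on S \<omega>)}"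
proof -
  let ?Xs = "\<lambda>\<omega>. restrict (\<lambda>i. X i \<omega>) S"
  let ?P = "PiM S (\<lambda>_. borel :: (real ^ 'd) measure)"
  let ?D = "distr M ?P ?Xs"
  \<comment> \<open>\<open>X j\<close> appears as a family indexed by \<open>{j}\<close>, so that
    independence of the restrictions to the disjoint sets \<open>S\<close> and \<open>{j}\<close>
    can be used.\<close>
  let ?P' = "PiM {j} (\<lambda>_. borel :: (real ^ 'd) measure)"
  let ?Xj = "\<lambda>\<omega>. restrict (\<lambda>i. X i \<omega>) {j}"
  let ?D' = "distr M ?P' ?Xj"
  let ?E = "{z \<in> space (?P \<Otimes>\<^sub>M ?P'). Q (point_graph S r (fst z)) \<and> R (fst z i) (snd z j)}"
  have fin: "finite S" using S finite_subset by blast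
  note Xs = restrict_measurable[OF S(1)]
  have j: "j \<in> {1..n}" using S by blast
  have Xj: "?Xj \<in> measurable M ?P'" by (rule restrict_measurable) (use j in blast)
  have Xj' [measurable]: "X j \<in> borel_measurable M" using j by (rule X_measurable)
  have "indep_var ?P ?Xs ?P' ?Xj"
    by (rule indep_var_restrict[OF indep]) (use S in auto)
  then have joint: "?D \<Otimes>\<^sub>M ?D' = distr M (?P \<Otimes>\<^sub>M ?P') (\<lambda>\<omega>. (?Xs \<omega>, ?Xj \<omega>))"
    unfolding indep_var_distribution_eq by auto
  have pgP: "(\<lambda>x. point_graph S r x) \<in> measurable ?P (count_space UNIV)"
    by (rule point_graph_measurable[OF fin]) (auto intro: component_borel_measurable)
  have QP: "Measurable.pred ?P (\<lambda>x. Q (point_graph S r x))"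
    by (rule measurable_compose[OF pgP]) simp
  have iP [measurable]: "(\<lambda>x. x i) \<in> borel_measurable ?P" by (rule component_borel_measurable[OF S(2)]) simp
  have jP [measurable]: "(\<lambda>x. x j) \<in> borel_measurable ?P'" by (rule component_borel_measurable) auto
  have [measurable]: "Measurable.pred (?P \<Otimes>\<^sub>M ?P') (\<lambda>z. Q (point_graph S r (fst z)))"
    by (rule measurable_compose[OF measurable_fst QP])
  have "(\<lambda>z. (fst z i, snd z j)) \<in> measurable (?P \<Otimes>\<^sub>M ?P') (borel \<Otimes>\<^sub>M borel)"
    by measurable
  from measurable_compose[OF this R]
  have [measurable]: "Measurable.pred (?P \<Otimes>\<^sub>M ?P') (\<lambda>z. R (fst z i) (snd z j))" by simp
  have E: "?E \<in> sets (?P \<Otimes>\<^sub>M ?P')" by measurable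
  have Rv [measurable]: "{x. R v x} \<in> sets borel" for v
    using measurable_compose[OF measurable_Pair1'[of v borel borel] R] by (simp add: pred_def)
  have bound': "emeasure ?D' {y \<in> space ?P'. R v (y j)} \<le> ennreal c" for v
  proof -
    have "emeasure ?D' {y \<in> space ?P'. R v (y j)} = emeasure M {\<omega> \<in> space M. R v (X j \<omega>)}"
    proof (subst emeasure_distr[OF Xj])
      show "{y \<in> space ?P'. R v (y j)} \<in> sets ?P'"
        using measurable_sets[OF jP Rv[of v]] by (simp add: vimage_def Int_def conj_commute)
      have "?Xj \<omega> \<in> space ?P'" if "\<omega> \<in> space M" for \<omega> using measurable_space[OF Xj that] .
      then show "emeasure M (?Xj -` {y \<in> space ?P'. R v (y j)} \<inter> space M) = emeasure M {\<omega> \<in> space M. R v (X j \<omega>)}"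
        by (intro arg_cong[where f = "emeasure M"]) auto
    qed
    also have "\<dots> = emeasure (distr M borel (X j)) {x. R v x}"
      by (subst emeasure_distr[OF Xj' Rv]) (auto intro!: arg_cong[where f = "emeasure M"])
    also have "\<dots> \<le> ennreal c" using bound uniform[OF j] by simp
    finally show ?thesis .
  qed
  interpret D': prob_space ?D' by (rule prob_space_distr[OF Xj])
  have "emeasure M {\<omega> \<in> space M. Q (graph_on S \<omega>) \<and> R (X i \<omega>) (X j \<omega>)} =
      emeasure (distr M (?P \<Otimes>\<^sub>M ?P') (\<lambda>\<omega>. (?Xs \<omega>, ?Xj \<omega>))) ?E"
  proof (subst emeasure_distr[OF measurable_Pair[OF Xs Xj] E], rule arg_cong[where f = "emeasure M"])
    have "?Xs \<omega> \<in> space ?P" "?Xj \<omega> \<in> space ?P'" if "\<omega> \<in> space M" for \<omega>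
      using measurable_space[OF Xs that] measurable_space[OF Xj that] .
    then show "{\<omega> \<in> space M. Q (graph_on S \<omega>) \<and> R (X i \<omega>) (X j \<omega>)} =
        (\<lambda>\<omega>. (?Xs \<omega>, ?Xj \<omega>)) -` ?E \<inter> space M"
      using S(2) by (auto simp: graph_on_restrict space_pair_measure)
  qed
  also have "\<dots> = emeasure (?D \<Otimes>\<^sub>M ?D') ?E" unfolding joint ..
  also have "\<dots> = (\<integral>\<^sup>+x. emeasure ?D' (Pair x -` ?E) \<partial>?D)"
  proof (rule D'.emeasure_pair_measure_alt)
    have "sets (?D \<Otimes>\<^sub>M ?D') = sets (?P \<Otimes>\<^sub>M ?P')"
      by (rule sets_pair_measure_cong) auto
    then show "?E \<in> sets (?D \<Otimes>\<^sub>M ?D')" using E by simp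
  qed
  also have "\<dots> \<le> (\<integral>\<^sup>+x. ennreal c * indicator {x \<in> space ?D. Q (point_graph S r x)} x \<partial>?D)"
  proof (rule nn_integral_mono)
    fix x assume x: "x \<in> space ?D"
    show "emeasure ?D' (Pair x -` ?E) \<le> ennreal c * indicator {x \<in> space ?D. Q (point_graph S r x)} x"
    proof (cases "Q (point_graph S r x)")
      case True
      then have "Pair x -` ?E = {y \<in> space ?P'. R (x i) (y j)}" using x by (auto simp: space_pair_measure)
      then show ?thesis using True x bound'[of "x i"] by (simp add: indicator_def)
    qed (simp add: vimage_def)
  qed
  also have "\<dots> = ennreal c * emeasure ?D {x \<in> space ?D. Q (point_graph S r x)}"
    by (rule nn_integral_cmult_indicator) (use QP in \<open>simp add: pred_def\<close>)
  also have "emeasure ?D {x \<in> space ?D. Q (point_graph S r x)} = emeasure M {\<omega> \<in> space M. Q (graph_on S \<omega>)}"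
  proof (subst emeasure_distr[OF Xs])
    show "{x \<in> space ?D. Q (point_graph S r x)} \<in> sets ?P" using QP by (simp add: pred_def)
    have "?Xs \<omega> \<in> space ?P" if "\<omega> \<in> space M" for \<omega> using measurable_space[OF Xs that] .
    then show "emeasure M (?Xs -` {x \<in> space ?D. Q (point_graph S r x)} \<inter> space M) =
        emeasure M {\<omega> \<in> space M. Q (graph_on S \<omega>)}"
      by (intro arg_cong[where f = "emeasure M"]) (auto simp: graph_on_restrict)
  qed
  finally have "ennreal (prob {\<omega> \<in> space M. Q (graph_on S \<omega>) \<and> R (X i \<omega>) (X j \<omega>)}) \<le>
      ennreal (c * prob {\<omega> \<in> space M. Q (graph_on S \<omega>)})"
    using c by (simp add: emeasure_eq_measure ennreal_mult)
  then show ?thesis using c by (simp add: ennreal_le_iff)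
qed

lemma prob_indep:
  assumes S: "S \<subseteq> {1..n}" "T \<subseteq> {1..n}" "S \<inter> T = {}"
  shows "prob {\<omega> \<in> space M. Q (graph_on S \<omega>) \<and> R (graph_on T \<omega>)} =
    prob {\<omega> \<in> space M. Q (graph_on S \<omega>)} * prob {\<omega> \<in> space M. R (graph_on T \<omega>)}"
proof -
  let ?P = "\<lambda>S. PiM S (\<lambda>_. borel :: (real ^ 'd) measure)"
  let ?Xs = "\<lambda>S \<omega>. restrict (\<lambda>i. X i \<omega>) S"
  have pg: "point_graph A r \<in> measurable (?P A) (count_space UNIV)" if "A \<subseteq> {1..n}" for A
    by (rule point_graph_measurable) (use that in \<open>auto intro: component_borel_measurable finite_subset\<close>)
  have "indep_var (?P S) (?Xs S) (?P T) (?Xs T)"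
    by (rule indep_var_restrict[OF indep S(3,1,2)])
  then have "indep_var (count_space UNIV) (point_graph S r \<circ> ?Xs S) (count_space UNIV) (point_graph T r \<circ> ?Xs T)"
    by (rule indep_var_compose[OF _ pg[OF S(1)] pg[OF S(2)]])
  then have iv: "indep_var (count_space UNIV) (graph_on S) (count_space UNIV) (graph_on T)"
    by (simp add: comp_def graph_on_restrict[symmetric])
  have "prob ((\<lambda>\<omega>. (graph_on S \<omega>, graph_on T \<omega>)) -` ({g. Q g} \<times> {g. R g}) \<inter> space M) =
      prob (graph_on S -` {g. Q g} \<inter> space M) * prob (graph_on T -` {g. R g} \<inter> space M)"
    by (rule indep_varD[OF iv]) auto
  then show ?thesis by (simp add: vimage_def Int_def conj_commute)
qed

lemma sparse_law: "sparse_random_graph law n ((2 * r) ^ CARD('d))"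
proof -
  interpret L: prob_space law by (rule prob_space_law)
  show ?thesis
  proof unfold_locales
    show "sets law = UNIV" by (rule sets_law)
    show "AE g in law. finite_simple_graph g \<and> verts g = {1..n}"
      unfolding law_def
      by (subst AE_distr_iff[OF graph_on_measurable])
        (auto simp: graph_on_def intro: finite_simple_point_graph)
    show "0 \<le> (2 * r) ^ CARD('d)" using r_nonneg by simp
    fix S i j Q assume S: "S \<subseteq> {1..n}" "i \<in> S" "j \<in> {1..n} - S"
    have "prob {\<omega> \<in> space M. Q (graph_on S \<omega>) \<and> torus_dist (X i \<omega>) (X j \<omega>) \<le> r} \<le>
        (2 * r) ^ CARD('d) * prob {\<omega> \<in> space M. Q (graph_on S \<omega>)}"
    proof (rule prob_given_le[OF S])
      show "Measurable.pred (borel \<Otimes>\<^sub>M borel) (\<lambda>(v, x :: real ^ 'd). torus_dist v x \<le> r)"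
        unfolding case_prod_beta by measurable
    qed (use r_nonneg emeasure_torus_ball_le in auto)
    moreover have "(i, j) \<in> adj (graph_on {1..n} \<omega>) \<longleftrightarrow> torus_dist (X i \<omega>) (X j \<omega>) \<le> r" for \<omega>
      unfolding graph_on_def using S by auto
    ultimately show "L.prob {g. Q (induced_subgraph g S) \<and> (i, j) \<in> adj g} \<le>
        (2 * r) ^ CARD('d) * L.prob {g. Q (induced_subgraph g S)}"
      unfolding measure_law induced_graph_on[OF S(1)] by simp
  next
    fix S T Q R assume S: "S \<subseteq> {1..n}" "T \<subseteq> {1..n}" "S \<inter> T = {}"
    show "L.prob {g. Q (induced_subgraph g S) \<and> R (induced_subgraph g T)} =
        L.prob {g. Q (induced_subgraph g S)} * L.prob {g. R (induced_subgraph g T)}"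
      unfolding measure_law induced_graph_on[OF S(1)] induced_graph_on[OF S(2)] by (rule prob_indep[OF S])
  qed
qed

sublocale L: sparse_random_graph law n "(2 * r) ^ CARD('d)"
  by (rule sparse_law)

text \<open>The points are independent and identically distributed, so a bijection from
  \<open>{1..s}\<close> to \<open>S\<close> transports the computation; isomorphism to
  \<open>H\<close> ignores the relabelling.\<close>

lemma prob_induced_iso:
  assumes S: "S \<subseteq> {1..n}" "card S = s" and H: "connected_graph H" "finite_simple_graph H" "card (verts H) = s"
    and r: "0 < r" "real (s\<^sup>2) * r \<le> 1/4"
  shows "L.prob {g. induced_subgraph g S \<simeq> H} = r ^ (CARD('d) * (s - 1)) * geometric_constant TYPE('d) H"
proof -
  let ?U = "\<lambda>_::nat. uniform_torus :: (real ^ 'd) measure"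
  let ?P = "PiM S (\<lambda>_. borel :: (real ^ 'd) measure)"
  let ?Xs = "\<lambda>\<omega>. restrict (\<lambda>i. X i \<omega>) S"
  have fin: "finite S" using S finite_subset by blast
  have s1: "S \<noteq> {}" using S(2) H unfolding connected_graph_def finite_simple_graph_def by auto
  obtain e where e: "bij_betw e {1..s} S" using finite_same_card_bij[of "{1..s}" S] fin S(2) by auto
  have eS: "e i \<in> S" if "i \<in> {1..s}" for i using bij_betwE[OF e] that by blast
  let ?t = "\<lambda>x. \<lambda>i\<in>{1..s}. x (e i)"
  have XS: "random_variable borel (X i)" if "i \<in> S" for i using X_measurable S(1) that by blast
  have "distr M ?P ?Xs = PiM S (\<lambda>i. distr M borel (X i))"
    using indep_vars_iff_distr_eq_PiM'[where I = S and X = X and M' = "\<lambda>_. borel", OF s1 XS]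
      indep_vars_subset[OF indep S(1)] by simp
  also have "\<dots> = PiM S ?U" by (rule PiM_cong) (use uniform S(1) in auto)
  finally have dS: "distr M ?P ?Xs = PiM S ?U" .
  have dt: "distr (PiM S ?U) (PiM {1..s} ?U) ?t = PiM {1..s} ?U"
    by (rule distr_PiM_reindex) (use e in \<open>auto simp: bij_betw_def prob_space_uniform_torus\<close>)
  have tm: "?t \<in> measurable (PiM S ?U) (PiM {1..s} ?U)"
    by (rule measurable_restrict) (use eS in \<open>auto intro: measurable_component_singleton\<close>)
  have Xs: "?Xs \<in> measurable M (PiM S ?U)"
    using restrict_measurable[OF S(1)] measurable_cong_sets[OF refl, of ?P "PiM S ?U" M]
    by (simp cong: sets_PiM_cong)
  have dS': "distr M (PiM S ?U) ?Xs = PiM S ?U"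
    unfolding dS[symmetric] by (rule distr_cong) (auto cong: sets_PiM_cong)
  let ?A = "{x \<in> space (PiM {1..s} ?U). point_graph {1..s} r x \<simeq> H}"
  have pg: "point_graph {1..s} r \<in> measurable (PiM {1..s} ?U) (count_space UNIV)"
    by (rule point_graph_measurable) (auto intro: component_borel_measurable)
  have A: "?A \<in> sets (PiM {1..s} ?U)"
    using measurable_sets[OF pg, of "{g. g \<simeq> H}"] by (simp add: vimage_def Int_def conj_commute)
  have "measure (PiM {1..s} ?U) ?A = measure (distr (distr M (PiM S ?U) ?Xs) (PiM {1..s} ?U) ?t) ?A"
    unfolding dS' dt ..
  also have "\<dots> = prob ((?t \<circ> ?Xs) -` ?A \<inter> space M)"
    using A by (subst distr_distr[OF tm Xs], subst measure_distr[OF measurable_comp[OF Xs tm]]) auto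
  also have "(?t \<circ> ?Xs) -` ?A \<inter> space M = {\<omega> \<in> space M. graph_on S \<omega> \<simeq> H}"
  proof (rule set_eqI)
    fix \<omega>
    have "point_graph {1..s} r (?t (?Xs \<omega>)) = point_graph {1..s} r ((\<lambda>i. X i \<omega>) \<circ> e)"
      by (rule point_graph_cong) (use eS in auto)
    then have eq: "point_graph {1..s} r (?t (?Xs \<omega>)) \<simeq> graph_on S \<omega>"
      unfolding graph_on_def using point_graph_reindex[OF e] by simp
    have "point_graph {1..s} r (?t (?Xs \<omega>)) \<simeq> H \<longleftrightarrow> graph_on S \<omega> \<simeq> H"
      using graph_iso_trans[OF eq] graph_iso_trans[OF graph_iso_sym[OF eq]] by blast
    moreover have "?t (?Xs \<omega>) \<in> space (PiM {1..s} ?U)" by (auto simp: space_PiM)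
    ultimately show "\<omega> \<in> (?t \<circ> ?Xs) -` ?A \<inter> space M \<longleftrightarrow> \<omega> \<in> {\<omega> \<in> space M. graph_on S \<omega> \<simeq> H}"
      by auto
  qed
  finally have "prob {\<omega> \<in> space M. graph_on S \<omega> \<simeq> H} = measure (PiM {1..s} ?U) ?A" by simp
  also have "\<dots> = r ^ (CARD('d) * (s - 1)) * geometric_constant TYPE('d) H"
    by (rule measure_point_graph_iso[OF H(1,2) H(3)[symmetric] r])
  finally show ?thesis unfolding measure_law induced_graph_on[OF S(1)] .
qed

text \<open>A union over finitely many pairs, each null by \<open>prob_given_le\<close> with a
  trivial \<open>Q\<close> and the bound 0. It is what makes the small components strictly
  geometric.\<close>

lemma prob_touching: "prob {\<omega> \<in> space M. \<exists>i\<in>{1..n}. \<exists>j\<in>{1..n} - {i}. torus_dist (X i \<omega>) (X j \<omega>) = r} = 0"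
proof -
  have ev: "{\<omega> \<in> space M. torus_dist (X i \<omega>) (X j \<omega>) = r} \<in> events" if "i \<in> {1..n}" "j \<in> {1..n}" for i j
  proof -
    have [measurable]: "X i \<in> borel_measurable M" "X j \<in> borel_measurable M" using that X_measurable by auto
    show ?thesis by measurable
  qed
  have z: "{\<omega> \<in> space M. torus_dist (X i \<omega>) (X j \<omega>) = r} \<in> null_sets M" if ij: "i \<in> {1..n}" "j \<in> {1..n} - {i}" for i j
  proof -
    have "prob {\<omega> \<in> space M. (\<lambda>_. True) (graph_on {i} \<omega>) \<and> torus_dist (X i \<omega>) (X j \<omega>) = r} \<le>
        0 * prob {\<omega> \<in> space M. (\<lambda>_. True) (graph_on {i} \<omega>)}"
    proof (rule prob_given_le[where S = "{i}" and i = i and j = j and R = "\<lambda>v x. torus_dist v x = r"])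
      show "Measurable.pred (borel \<Otimes>\<^sub>M borel) (\<lambda>(v, x :: real ^ 'd). torus_dist v x = r)"
        unfolding case_prod_beta by measurable
    qed (use ij emeasure_torus_sphere in auto)
    then have "prob {\<omega> \<in> space M. torus_dist (X i \<omega>) (X j \<omega>) = r} = 0"
      using measure_nonneg[of M "{\<omega> \<in> space M. torus_dist (X i \<omega>) (X j \<omega>) = r}"] by simp
    then show ?thesis using ev[of i j] ij by (auto simp: null_sets_def emeasure_eq_measure)
  qed
  have "(\<Union>i\<in>{1..n}. \<Union>j\<in>{1..n} - {i}. {\<omega> \<in> space M. torus_dist (X i \<omega>) (X j \<omega>) = r}) \<in> null_sets M"
    by (intro null_sets_UN') (use z in auto)
  moreover have "{\<omega> \<in> space M. \<exists>i\<in>{1..n}. \<exists>j\<in>{1..n} - {i}. torus_dist (X i \<omega>) (X j \<omega>) = r} =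
      (\<Union>i\<in>{1..n}. \<Union>j\<in>{1..n} - {i}. {\<omega> \<in> space M. torus_dist (X i \<omega>) (X j \<omega>) = r})" by auto
  ultimately show ?thesis by (simp add: null_sets_def measure_def)
qed

end


section \<open>Poisson limits\<close>


lemma expectation_pmf_has_sum:
  fixes f :: "'a \<Rightarrow> real"
  assumes B: "\<And>x. \<bar>f x\<bar> \<le> B"
  shows "((\<lambda>x. f x * pmf W x) has_sum measure_pmf.expectation W f) UNIV"
proof -
  have "integrable (measure_pmf W) f"
    by (rule measure_pmf.integrable_const_bound[of _ B]) (use B in auto)
  then have "integrable (count_space UNIV) (\<lambda>x. pmf W x *\<^sub>R f x)"
    unfolding measure_pmf_eq_density by (subst (asm) integrable_density) auto
  then have abs: "Infinite_Set_Sum.abs_summable_on (\<lambda>x. pmf W x * f x) UNIV" by (simp add: abs_summable_on_def)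
  then have "(\<lambda>x. pmf W x * f x) summable_on UNIV"
    using abs_summable_equivalent abs_summable_summable by blast
  then have "((\<lambda>x. pmf W x * f x) has_sum measure_pmf.expectation W f) UNIV"
    unfolding pmf_expectation_eq_infsetsum infsetsum_infsum[OF abs] by (rule has_sum_infsum)
  then show ?thesis by (simp add: mult.commute)
qed

lemma pmf_finite_mass:
  assumes "0 < \<epsilon>"
  obtains F where "finite F" "1 - \<epsilon> \<le> sum (pmf W) F"
proof -
  have "((\<lambda>x. 1 * pmf W x) has_sum measure_pmf.expectation W (\<lambda>_. 1)) UNIV"
    by (rule expectation_pmf_has_sum[of _ 1]) simp
  then have "(pmf W has_sum 1) UNIV" by simp
  then obtain F where "finite F" "dist (sum (pmf W) F) 1 \<le> \<epsilon>"
    using has_sum_finite_approximation assms by blast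
  then show ?thesis using that by (auto simp: dist_real_def abs_le_iff)
qed

lemma sum_pmf_le_1: "finite F \<Longrightarrow> sum (pmf W) F \<le> 1"
  by (simp add: measure_measure_pmf_finite[symmetric])

text \<open>Only values outside \<open>F\<close> contribute to the difference, at most
  \<open>B\<close> times their mass. Applied both to the approximating laws and to the limit
  law.\<close>

lemma expectation_finite_part:
  fixes f :: "'b \<Rightarrow> real"
  assumes N: "prob_space N" "sets N = UNIV" and F: "finite F" and B: "\<And>y. \<bar>f y\<bar> \<le> B"
  shows "\<bar>(\<integral>x. f (Y x) \<partial>N) - (\<Sum>y\<in>F. f y * measure N {x. Y x = y})\<bar> \<le> B * (1 - (\<Sum>y\<in>F. measure N {x. Y x = y}))"
proof -
  interpret prob_space N by fact
  have sp: "space N = UNIV" using N(2) sets.sets_into_space[of UNIV N] by auto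
  have m [simp]: "g \<in> borel_measurable N" for g :: "'a \<Rightarrow> real" by (simp add: measurable_def N(2))
  have B0: "0 \<le> B" using B[of undefined] by simp
  have int: "integrable N (\<lambda>x. f (Y x))" by (rule integrable_const_bound[of _ B]) (use B in auto)
  have inti: "integrable N (\<lambda>x. c * indicator {x. Y x = y} x)" for c :: real and y
    by (intro integrable_mult_right integrable_real_indicator) (auto simp: N(2) less_top[symmetric])
  have sumF: "(\<Sum>y\<in>F. c y * indicator {x. Y x = y} x) = (if Y x \<in> F then c (Y x) else 0)" for c :: "'b \<Rightarrow> real" and x
  proof -
    have "(\<Sum>y\<in>F. c y * indicator {x. Y x = y} x) = (\<Sum>y\<in>F. if Y x = y then c y else 0)"
      by (rule sum.cong) (auto simp: indicator_def)
    then show ?thesis using F by simp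
  qed
  have e: "(\<integral>x. (\<Sum>y\<in>F. c y * indicator {x. Y x = y} x) \<partial>N) = (\<Sum>y\<in>F. c y * measure N {x. Y x = y})" for c :: "'b \<Rightarrow> real"
    by (subst Bochner_Integration.integral_sum, rule inti, simp add: sp)
  have ints: "integrable N (\<lambda>x. \<Sum>y\<in>F. c y * indicator {x. Y x = y} x)" for c :: "'b \<Rightarrow> real"
    by (rule Bochner_Integration.integrable_sum) (rule inti)
  have "(\<integral>x. f (Y x) \<partial>N) - (\<Sum>y\<in>F. f y * measure N {x. Y x = y}) =
      (\<integral>x. f (Y x) - (\<Sum>y\<in>F. f y * indicator {x. Y x = y} x) \<partial>N)"
    using int ints[of f] e[of f] by simp
  also have "\<bar>\<dots>\<bar> \<le> (\<integral>x. \<bar>f (Y x) - (\<Sum>y\<in>F. f y * indicator {x. Y x = y} x)\<bar> \<partial>N)"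
    by (rule integral_abs_bound)
  also have "\<dots> \<le> (\<integral>x. B * (1 - (\<Sum>y\<in>F. 1 * indicator {x. Y x = y} x)) \<partial>N)"
  proof (rule integral_mono)
    show "integrable N (\<lambda>x. \<bar>f (Y x) - (\<Sum>y\<in>F. f y * indicator {x. Y x = y} x)\<bar>)"
      using int ints[of f] by (intro integrable_abs Bochner_Integration.integrable_diff)
    show "integrable N (\<lambda>x. B * (1 - (\<Sum>y\<in>F. 1 * indicator {x. Y x = y} x)))"
      using ints[of "\<lambda>_. 1"] by (intro integrable_mult_right Bochner_Integration.integrable_diff) auto
    fix x show "\<bar>f (Y x) - (\<Sum>y\<in>F. f y * indicator {x. Y x = y} x)\<bar> \<le> B * (1 - (\<Sum>y\<in>F. 1 * indicator {x. Y x = y} x))"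
      unfolding sumF using B[of "Y x"] B0 by auto
  qed
  also have "\<dots> = B * (1 - (\<Sum>y\<in>F. measure N {x. Y x = y}))"
    using ints[of "\<lambda>_. 1"] e[of "\<lambda>_. 1"] by (simp add: prob_space)
  finally show ?thesis .
qed

text \<open>Scheffe's lemma for discrete laws.\<close>

lemma pointwise_pmf_limit_expectation:
  fixes f :: "'b \<Rightarrow> real"
  assumes N: "\<And>n. prob_space (N n)" "\<And>n. sets (N n) = UNIV"
    and lim: "\<And>y. (\<lambda>n. measure (N n) {x. Y x = y}) \<longlonglongrightarrow> pmf W y"
    and B: "\<And>y. \<bar>f y\<bar> \<le> B"
  shows "(\<lambda>n. \<integral>x. f (Y x) \<partial>N n) \<longlonglongrightarrow> measure_pmf.expectation W f"
proof (rule LIMSEQ_I)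
  fix \<epsilon> :: real assume \<epsilon>: "0 < \<epsilon>"
  \<comment> \<open>\<open>B + 1\<close> keeps the denominator positive when \<open>B = 0\<close>.
    The tails contribute at most \<open>2 * B * \<delta>\<close> and \<open>B * \<delta>\<close>,
    the finite part less than \<open>\<epsilon>/4\<close>.\<close>
  define \<delta> where "\<delta> = \<epsilon> / 4 / (B + 1)"
  have B0: "0 \<le> B" using B[of undefined] by simp
  have \<delta>: "0 < \<delta>" using \<epsilon> B0 unfolding \<delta>_def by simp
  obtain F where F: "finite F" "1 - \<delta> \<le> sum (pmf W) F" using pmf_finite_mass[OF \<delta>] .
  have l1: "(\<lambda>n. \<Sum>y\<in>F. f y * measure (N n) {x. Y x = y}) \<longlonglongrightarrow> (\<Sum>y\<in>F. f y * pmf W y)"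
    by (intro tendsto_sum tendsto_mult tendsto_const lim)
  have l2: "(\<lambda>n. \<Sum>y\<in>F. measure (N n) {x. Y x = y}) \<longlonglongrightarrow> sum (pmf W) F"
    by (intro tendsto_sum lim)
  have W: "\<bar>measure_pmf.expectation W f - (\<Sum>y\<in>F. f y * pmf W y)\<bar> \<le> B * (1 - sum (pmf W) F)"
    using expectation_finite_part[of "measure_pmf W" F f B "\<lambda>y. y", OF _ _ F(1) B]
    by (simp add: measure_pmf.prob_space_axioms measure_pmf_single)
  have "\<forall>\<^sub>F n in sequentially. dist (\<Sum>y\<in>F. f y * measure (N n) {x. Y x = y}) (\<Sum>y\<in>F. f y * pmf W y) < \<epsilon>/4"
    using tendstoD[OF l1, of "\<epsilon>/4"] \<epsilon> by simp
  moreover have "\<forall>\<^sub>F n in sequentially. dist (\<Sum>y\<in>F. measure (N n) {x. Y x = y}) (sum (pmf W) F) < \<delta>"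
    using tendstoD[OF l2 \<delta>] .
  ultimately have "\<forall>\<^sub>F n in sequentially. norm ((\<integral>x. f (Y x) \<partial>N n) - measure_pmf.expectation W f) < \<epsilon>"
  proof eventually_elim
    case (elim n)
    have 1: "\<bar>(\<integral>x. f (Y x) \<partial>N n) - (\<Sum>y\<in>F. f y * measure (N n) {x. Y x = y})\<bar> \<le> B * (1 - (\<Sum>y\<in>F. measure (N n) {x. Y x = y}))"
      by (rule expectation_finite_part[OF N F(1) B])
    have "1 - (\<Sum>y\<in>F. measure (N n) {x. Y x = y}) \<le> 2 * \<delta>"
      using elim(2) F(2) by (auto simp: dist_real_def)
    then have "B * (1 - (\<Sum>y\<in>F. measure (N n) {x. Y x = y})) \<le> B * (2 * \<delta>)" using B0 by (rule mult_left_mono)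
    moreover have "B * (1 - sum (pmf W) F) \<le> B * \<delta>" using F(2) B0 by (intro mult_left_mono) auto
    moreover have "B * (2 * \<delta>) + B * \<delta> < \<epsilon> * (3/4)"
    proof -
      have "B * \<delta> < (B + 1) * \<delta>" using \<delta> by simp
      also have "(B + 1) * \<delta> = \<epsilon> / 4" unfolding \<delta>_def using B0
        by (metis add_nonneg_pos less_irrefl nonzero_mult_div_cancel_left times_divide_eq_right zero_less_one)
      finally show ?thesis by simp
    qed
    moreover have "\<bar>(\<integral>x. f (Y x) \<partial>N n) - measure_pmf.expectation W f\<bar> \<le>
        \<bar>(\<integral>x. f (Y x) \<partial>N n) - (\<Sum>y\<in>F. f y * measure (N n) {x. Y x = y})\<bar> +
        \<bar>(\<Sum>y\<in>F. f y * measure (N n) {x. Y x = y}) - (\<Sum>y\<in>F. f y * pmf W y)\<bar> +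
        \<bar>measure_pmf.expectation W f - (\<Sum>y\<in>F. f y * pmf W y)\<bar>" by linarith
    ultimately have "\<bar>(\<integral>x. f (Y x) \<partial>N n) - measure_pmf.expectation W f\<bar> < \<epsilon> * (3/4) + \<epsilon> / 4"
      using 1 W elim(1) unfolding dist_real_def by linarith
    then show ?case by simp
  qed
  then show "\<exists>no. \<forall>n\<ge>no. norm ((\<integral>x. f (Y x) \<partial>N n) - measure_pmf.expectation W f) < \<epsilon>"
    by (simp add: eventually_sequentially)
qed

text \<open>If the masses are asymptotically \<open>c n\<close> times those of a probability law,
  then on a large finite set both total masses are close to 1, which forces \<open>c n\<close> to
  tend to 1.\<close>

lemma proportional_masses_limit:
  fixes P :: "nat \<Rightarrow> 'a \<Rightarrow> real"
  assumes le1: "\<And>n F. finite F \<Longrightarrow> sum (P n) F \<le> 1" and P0: "\<And>n y. 0 \<le> P n y" and c0: "\<And>n. 0 \<le> c n"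
    and propor: "\<And>y. (\<lambda>n. P n y - c n * pmf W y) \<longlonglongrightarrow> 0"
    and tight: "\<And>\<epsilon>. 0 < \<epsilon> \<Longrightarrow> \<exists>F. finite F \<and> (\<forall>\<^sub>F n in sequentially. 1 - \<epsilon> \<le> sum (P n) F)"
  shows "(\<lambda>n. P n y) \<longlonglongrightarrow> pmf W y"
proof -
  have "c \<longlonglongrightarrow> 1"
  proof (rule LIMSEQ_I)
    fix \<epsilon>' :: real assume \<epsilon>': "0 < \<epsilon>'"
    \<comment> \<open>The bound 1/2 gives \<open>c n \<le> 3\<close>, and then the errors add up to
      at most \<open>4 * \<epsilon>\<close>, at most half of \<open>\<epsilon>'\<close>.\<close>
    define \<epsilon> where "\<epsilon> = min (1/2) (\<epsilon>' / 8)"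
    have \<epsilon>: "0 < \<epsilon>" "\<epsilon> \<le> 1/2" "8 * \<epsilon> \<le> \<epsilon>'" using \<epsilon>' unfolding \<epsilon>_def by auto
    obtain F1 where F1: "finite F1" "\<forall>\<^sub>F n in sequentially. 1 - \<epsilon> \<le> sum (P n) F1" using tight[OF \<epsilon>(1)] by blast
    obtain F2 where F2: "finite F2" "1 - \<epsilon> \<le> sum (pmf W) F2" using pmf_finite_mass[OF \<epsilon>(1)] .
    \<comment> \<open>One set carries most of the mass of \<open>P n\<close>, the other most of the
      mass of \<open>W\<close>; the union serves both.\<close>
    let ?F = "F1 \<union> F2"
    have F: "finite ?F" using F1 F2 by simp
    have w: "1 - \<epsilon> \<le> sum (pmf W) ?F" "sum (pmf W) ?F \<le> 1"
      using F2 sum_mono2[of ?F F2 "pmf W"] F sum_pmf_le_1[OF F, of W] by auto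
    have "(\<lambda>n. \<Sum>y\<in>?F. P n y - c n * pmf W y) \<longlonglongrightarrow> (\<Sum>y\<in>?F. 0)" by (intro tendsto_sum propor)
    then have "(\<lambda>n. sum (P n) ?F - c n * sum (pmf W) ?F) \<longlonglongrightarrow> 0"
      by (simp add: sum_subtractf sum_distrib_left)
    from tendstoD[OF this \<epsilon>(1)]
    have "\<forall>\<^sub>F n in sequentially. \<bar>sum (P n) ?F - c n * sum (pmf W) ?F\<bar> < \<epsilon>" by (simp add: dist_real_def)
    with F1(2) have "\<forall>\<^sub>F n in sequentially. norm (c n - 1) < \<epsilon>'"
    proof eventually_elim
      case (elim n)
      have "sum (P n) F1 \<le> sum (P n) ?F" by (rule sum_mono2) (use F P0 in auto)
      then have p: "1 - \<epsilon> \<le> sum (P n) ?F" "sum (P n) ?F \<le> 1" using elim le1[OF F, of n] by auto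
      have lo: "1 - 2 * \<epsilon> \<le> c n * sum (pmf W) ?F" and hi: "c n * sum (pmf W) ?F \<le> 1 + \<epsilon>"
        using p elim(2) by linarith+
      have "c n * sum (pmf W) ?F \<le> c n * 1" using w c0 by (intro mult_left_mono) auto
      then have "1 - 2 * \<epsilon> \<le> c n" using lo by simp
      moreover have "c n \<le> 1 + 4 * \<epsilon>"
      proof -
        have "c n * (1/2) \<le> c n * sum (pmf W) ?F" using w \<epsilon> c0 by (intro mult_left_mono) auto
        then have c3: "c n \<le> 3" using hi \<epsilon> by linarith
        have "c n * (1 - \<epsilon>) \<le> c n * sum (pmf W) ?F" using w c0 by (intro mult_left_mono) auto
        then have "c n \<le> 1 + \<epsilon> + c n * \<epsilon>" using hi by (simp add: algebra_simps)
        also have "c n * \<epsilon> \<le> 3 * \<epsilon>" using c3 \<epsilon> by (intro mult_right_mono) auto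
        finally show ?thesis by simp
      qed
      ultimately show ?case using \<epsilon> by (simp add: abs_less_iff)
    qed
    then show "\<exists>no. \<forall>n\<ge>no. norm (c n - 1) < \<epsilon>'" by (simp add: eventually_sequentially)
  qed
  then have "(\<lambda>n. (P n y - c n * pmf W y) + c n * pmf W y) \<longlonglongrightarrow> 0 + 1 * pmf W y"
    by (intro tendsto_add tendsto_mult tendsto_const propor)
  then show ?thesis by simp
qed

section \<open>Limits of component counts in sparse sequences\<close>

locale sparse_sequence =
  fixes L :: "nat \<Rightarrow> nat graph measure" and p :: "nat \<Rightarrow> real"
  assumes sparse: "\<And>n. sparse_random_graph (L n) n (p n)"
    and sparse_degree: "(\<lambda>n. real n * p n) \<longlonglongrightarrow> 0"
begin

lemma prob_L: "prob_space (L n)" and sets_L: "sets (L n) = UNIV"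
proof -
  interpret sparse_random_graph "L n" n "p n" by (rule sparse)
  show "prob_space (L n)" by (rule prob_space_axioms)
  show "sets (L n) = UNIV" by (rule sets_L)
qed

lemma masses_le_1:
  assumes "finite F"
  shows "(\<Sum>y\<in>F. measure (L n) {g. Y g = y}) \<le> 1"
proof -
  interpret sparse_random_graph "L n" n "p n" by (rule sparse)
  have "(\<Sum>y\<in>F. prob {g. Y g = y}) = prob (\<Union>y\<in>F. {g. Y g = y})"
    by (rule finite_measure_finite_Union[symmetric]) (use assms in \<open>auto simp: disjoint_family_on_def sets_L\<close>)
  then show ?thesis by simp
qed

text \<open>The product of Poisson laws satisfies the limiting recursion exactly. Induction on the
  total of \<open>m\<close> therefore propagates proportionality, with the common factor
  \<open>c n\<close>, from the zero vector to every vector.\<close>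

lemma poisson_limit:
  fixes A :: "nat graph set"
  assumes A: "finite A" "\<And>K. K \<in> A \<Longrightarrow> connected_graph K" "\<And>K. K \<in> A \<Longrightarrow> finite_simple_graph K"
      "\<And>K. K \<in> A \<Longrightarrow> card (verts K) = s"
      "\<And>K K'. K \<in> A \<Longrightarrow> K' \<in> A \<Longrightarrow> K \<simeq> K' \<Longrightarrow> K = K'"
    and s: "2 \<le> s"
    and \<pi>: "\<forall>\<^sub>F n in sequentially. \<forall>H\<in>A. \<forall>S. S \<subseteq> {1..n} \<longrightarrow> card S = s \<longrightarrow>
      measure (L n) {g. induced_subgraph g S \<simeq> H} = \<pi> n H"
    and rate: "\<And>H. H \<in> A \<Longrightarrow> (\<lambda>n. real (n choose s) * \<pi> n H) \<longlonglongrightarrow> rate H"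
    and rate_pos: "\<And>H. H \<in> A \<Longrightarrow> 0 < rate H"
  shows "(\<lambda>n. measure (L n) {g. count_vector A g = m}) \<longlonglongrightarrow>
    pmf (Pi_pmf A 0 (\<lambda>H. poisson_pmf (rate H))) m"
proof -
  let ?W = "Pi_pmf A 0 (\<lambda>H. poisson_pmf (rate H))"
  define P where "P n m = measure (L n) {g. count_vector A g = m}" for n m
  have P0: "0 \<le> P n m" for n m unfolding P_def by simp
  have P1: "P n m \<le> 1" for n m unfolding P_def
    using prob_space.prob_le_1[OF prob_L] by blast
  have vec: "count_vector A g H = 0" if "H \<notin> A" for g :: "nat graph" and H using that unfolding count_vector_def by simp
  have W: "pmf ?W m = (\<Prod>H\<in>A. rate H ^ m H / fact (m H) * exp (- rate H))" if "\<And>H. H \<notin> A \<Longrightarrow> m H = 0" for m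
    using that A(1) rate_pos by (subst pmf_Pi') (auto intro!: prod.cong)
  have W0: "0 < pmf ?W (\<lambda>_. 0)" by (subst W) (auto intro!: prod_pos)
  \<comment> \<open>The factor by which the two laws differ at the zero vector, the start of the
    induction.\<close>
  define c where "c n = P n (\<lambda>_. 0) / pmf ?W (\<lambda>_. 0)" for n
  have c0: "0 \<le> c n" for n unfolding c_def using P0 W0 by simp
  have c_bound: "c n \<le> 1 / pmf ?W (\<lambda>_. 0)" for n unfolding c_def using P1 W0 by (intro divide_right_mono) auto
  have Wrec: "real (m H) * pmf ?W m = rate H * pmf ?W (m(H := m H - 1))"
    if m: "\<And>H. H \<notin> A \<Longrightarrow> m H = 0" and H: "H \<in> A" "1 \<le> m H" for m H
  proof -
    obtain j where j: "m H = Suc j" using H(2) by (cases "m H") auto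
    let ?t = "\<lambda>m H. rate H ^ m H / fact (m H) * exp (- rate H)"
    have W1: "pmf ?W m = ?t m H * (\<Prod>H\<in>A - {H}. ?t m H)"
      using W[OF m] prod.remove[OF A(1) H(1), of "?t m"] by simp
    have "(m(H := m H - 1)) K = 0" if "K \<notin> A" for K using m[OF that] H(1) that by auto
    then have "pmf ?W (m(H := m H - 1)) = (\<Prod>K\<in>A. ?t (m(H := m H - 1)) K)" by (rule W)
    also have "\<dots> = ?t (m(H := m H - 1)) H * (\<Prod>K\<in>A - {H}. ?t (m(H := m H - 1)) K)"
      by (rule prod.remove[OF A(1) H(1)])
    also have "(\<Prod>K\<in>A - {H}. ?t (m(H := m H - 1)) K) = (\<Prod>K\<in>A - {H}. ?t m K)"
      by (rule prod.cong) auto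
    finally have W2: "pmf ?W (m(H := m H - 1)) = ?t (m(H := m H - 1)) H * (\<Prod>K\<in>A - {H}. ?t m K)" .
    have "real (m H) * ?t m H = rate H * ?t (m(H := m H - 1)) H"
    proof -
      have "real (Suc j) / fact (Suc j) = 1 / fact j"
        unfolding fact_Suc of_nat_mult by (subst nonzero_divide_mult_cancel_left) auto
      then have "real (Suc j) / fact (Suc j) * (rate H ^ Suc j * exp (- rate H)) = 1 / fact j * (rate H ^ Suc j * exp (- rate H))"
        by simp
      then show ?thesis by (simp add: j del: fact_Suc of_nat_Suc)
    qed
    then have "real (m H) * ?t m H * (\<Prod>H\<in>A - {H}. ?t m H) =
        rate H * ?t (m(H := m H - 1)) H * (\<Prod>H\<in>A - {H}. ?t m H)" by (rule arg_cong)
    then show ?thesis unfolding W1 W2 by (simp only: mult.assoc)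
  qed
  have prop_vec: "(\<lambda>n. P n m - c n * pmf ?W m) \<longlonglongrightarrow> 0" if "\<And>H. H \<notin> A \<Longrightarrow> m H = 0" for m
    using that
  proof (induction "sum m A" arbitrary: m rule: less_induct)
    case less
    show ?case
    proof (cases "\<exists>H\<in>A. 1 \<le> m H")
      case False
      then have "m = (\<lambda>_. 0)" using less.prems by (force simp: fun_eq_iff)
      then show ?thesis unfolding c_def using W0 by simp
    next
      case True
      then obtain H where H: "H \<in> A" "1 \<le> m H" by blast
      let ?m = "m(H := m H - 1)"
      have lt: "sum ?m A < sum m A"
        by (rule sum_strict_mono_ex1) (use A(1) H in auto)
      have IH: "(\<lambda>n. P n ?m - c n * pmf ?W ?m) \<longlonglongrightarrow> 0"
        by (rule less.hyps[OF lt]) (use less.prems H in auto)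
      define \<mu> where "\<mu> n = real (n choose s) * \<pi> n H" for n
      have \<mu>: "\<mu> \<longlonglongrightarrow> rate H" using rate[OF H(1)] unfolding \<mu>_def .
      have err: "(\<lambda>n. real (m H) * P n m - \<mu> n * P n ?m) \<longlonglongrightarrow> 0"
      proof (rule Lim_null_comparison)
        show "\<forall>\<^sub>F n in sequentially. norm (real (m H) * P n m - \<mu> n * P n ?m) \<le> \<mu> n * (2 * real s * (real n * p n))"
          using \<pi>
        proof eventually_elim
          case (elim n)
          interpret sparse_random_graph "L n" n "p n" by (rule sparse)
          have "\<bar>real (m H) * prob {g. count_vector A g = m}
              - real (n choose s) * \<pi> n H * prob {g. count_vector A g = ?m}\<bar>
            \<le> real (n choose s) * \<pi> n H * (2 * real s * real n * p n)"
            by (rule count_recursion[where A = A and s = s and H = H and m = m and \<pi> = "\<pi> n H"]) (use A(2-5) s H elim in auto)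
          then show ?case unfolding P_def \<mu>_def by (simp add: mult.assoc)
        qed
        have "(\<lambda>n. \<mu> n * (2 * real s * (real n * p n))) \<longlonglongrightarrow> rate H * (2 * real s * 0)"
          by (intro tendsto_mult tendsto_const \<mu> sparse_degree)
        then show "(\<lambda>n. \<mu> n * (2 * real s * (real n * p n))) \<longlonglongrightarrow> 0" by simp
      qed
      \<comment> \<open>\<open>c n\<close> stays bounded because masses are at most 1, so
        \<open>\<mu> n\<close> may be replaced by its limit.\<close>
      have \<mu>0: "(\<lambda>n. (\<mu> n - rate H) * (c n * pmf ?W ?m)) \<longlonglongrightarrow> 0"
      proof (rule Lim_null_comparison)
        have "norm ((\<mu> n - rate H) * (c n * pmf ?W ?m)) \<le> \<bar>\<mu> n - rate H\<bar> * (1 / pmf ?W (\<lambda>_. 0) * 1)" for n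
          unfolding real_norm_def abs_mult
          by (intro mult_mono) (use c0 c_bound W0 in \<open>auto simp: pmf_le_1\<close>)
        then show "\<forall>\<^sub>F n in sequentially. norm ((\<mu> n - rate H) * (c n * pmf ?W ?m)) \<le>
            \<bar>\<mu> n - rate H\<bar> * (1 / pmf ?W (\<lambda>_. 0) * 1)" by simp
        have "(\<lambda>n. \<bar>\<mu> n - rate H\<bar> * (1 / pmf ?W (\<lambda>_. 0) * 1)) \<longlonglongrightarrow> \<bar>rate H - rate H\<bar> * (1 / pmf ?W (\<lambda>_. 0) * 1)"
          by (intro tendsto_mult tendsto_rabs tendsto_diff tendsto_const \<mu>)
        then show "(\<lambda>n. \<bar>\<mu> n - rate H\<bar> * (1 / pmf ?W (\<lambda>_. 0) * 1)) \<longlonglongrightarrow> 0" by simp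
      qed
      \<comment> \<open>Three errors: that of the recursion, that of the induction hypothesis and
        that of the rate.\<close>
      have "(\<lambda>n. (1 / real (m H)) * ((real (m H) * P n m - \<mu> n * P n ?m) + \<mu> n * (P n ?m - c n * pmf ?W ?m)
          + (\<mu> n - rate H) * (c n * pmf ?W ?m))) \<longlonglongrightarrow> (1 / real (m H)) * (0 + rate H * 0 + 0)"
        by (intro tendsto_mult tendsto_add tendsto_const err \<mu> IH \<mu>0)
      moreover have "(1 / real (m H)) * ((real (m H) * P n m - \<mu> n * P n ?m) + \<mu> n * (P n ?m - c n * pmf ?W ?m)
          + (\<mu> n - rate H) * (c n * pmf ?W ?m)) = P n m - c n * pmf ?W m" for n
      proof -
        have "(real (m H) * P n m - \<mu> n * P n ?m) + \<mu> n * (P n ?m - c n * pmf ?W ?m)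
          + (\<mu> n - rate H) * (c n * pmf ?W ?m) = real (m H) * P n m - c n * (rate H * pmf ?W ?m)"
          by (simp add: algebra_simps)
        also have "\<dots> = real (m H) * (P n m - c n * pmf ?W m)"
        proof -
          have "rate H * pmf ?W ?m = real (m H) * pmf ?W m" by (rule Wrec[symmetric]) (use less.prems H in auto)
          then show ?thesis by (simp only:) (simp add: algebra_simps)
        qed
        finally show ?thesis using H by simp
      qed
      ultimately show ?thesis by simp
    qed
  qed
  have propor: "(\<lambda>n. P n m - c n * pmf ?W m) \<longlonglongrightarrow> 0" for m
  proof (cases "\<forall>H. H \<notin> A \<longrightarrow> m H = 0")
    case True then show ?thesis using prop_vec by blast
  next
    case False
    \<comment> \<open>Neither the count vector nor the Poisson vector charges a vector that is
      nonzero somewhere outside \<open>A\<close>.\<close>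
    then have "P n m = 0" for n unfolding P_def using vec by (metis (mono_tags, lifting) empty_Collect_eq measure_empty)
    moreover have "pmf ?W m = 0" using False A(1) by (intro pmf_Pi_outside) auto
    ultimately show ?thesis by simp
  qed
  have tight: "\<exists>F. finite F \<and> (\<forall>\<^sub>F n in sequentially. 1 - \<epsilon> \<le> sum (P n) F)" if \<epsilon>: "0 < \<epsilon>" for \<epsilon>
  proof -
    \<comment> \<open>By Markov's inequality some count reaches \<open>l\<close> with probability at
      most \<open>R / l\<close>; the summand 1 leaves room for means that only converge to the
      rates.\<close>
    define R where "R = (\<Sum>H\<in>A. rate H + 1)"
    obtain l :: nat where l: "R / \<epsilon> < real l" using reals_Archimedean2 by blast
    define F where "F = PiE_dflt A (0::nat) (\<lambda>_. {..<l})"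
    have F: "finite F" unfolding F_def using A(1) by auto
    have R0: "0 \<le> R" unfolding R_def using rate_pos by (intro sum_nonneg) (auto simp: less_imp_le add_nonneg_nonneg)
    then have l0: "0 < real l" using l \<epsilon> by (meson divide_nonneg_pos le_less_trans)
    have "\<forall>\<^sub>F n in sequentially. \<forall>H\<in>A. real (n choose s) * \<pi> n H \<le> rate H + 1"
    proof (rule eventually_ball_finite[OF A(1)], rule ballI)
      fix H assume "H \<in> A"
      then have "\<forall>\<^sub>F n in sequentially. real (n choose s) * \<pi> n H < rate H + 1"
        by (intro order_tendstoD(2)[OF rate]) auto
      then show "\<forall>\<^sub>F n in sequentially. real (n choose s) * \<pi> n H \<le> rate H + 1"
        by (rule eventually_mono) simp
    qed
    with \<pi> have "\<forall>\<^sub>F n in sequentially. 1 - \<epsilon> \<le> sum (P n) F"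
    proof eventually_elim
      case (elim n)
      interpret sparse_random_graph "L n" n "p n" by (rule sparse)
      have le: "prob {g. l \<le> component_count g H} \<le> (rate H + 1) / real l" if H: "H \<in> A" for H
      proof -
        have "real l * prob {g. l \<le> component_count g H} \<le> real (n choose s) * \<pi> n H"
          by (rule count_le[where A = A]) (use A(2-5) s elim(1) H in auto)
        also have "\<dots> \<le> rate H + 1" using elim(2) H by blast
        finally show ?thesis using l0 by (simp add: field_simps)
      qed
      have "sum (P n) F = prob (\<Union>m\<in>F. {g. count_vector A g = m})"
        unfolding P_def by (rule finite_measure_finite_Union[symmetric])
          (use F in \<open>auto simp: disjoint_family_on_def sets_L\<close>)
      also have "\<dots> = prob {g. count_vector A g \<in> F}" by (rule arg_cong[where f = prob]) auto
      finally have "1 - sum (P n) F = prob {g. count_vector A g \<notin> F}"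
        using prob_compl[of "{g. count_vector A g \<in> F}"] by (simp add: Compl_eq[symmetric] Collect_neg_eq Compl_eq_Diff_UNIV)
      also have "\<dots> \<le> prob {g. \<exists>H\<in>A. l \<le> component_count g H}"
        by (rule prob_le) (auto simp: F_def PiE_dflt_def count_vector_def not_less split: if_splits)
      also have "\<dots> \<le> (\<Sum>H\<in>A. prob {g. l \<le> component_count g H})" by (rule prob_Ex_le[OF A(1)])
      also have "\<dots> \<le> (\<Sum>H\<in>A. (rate H + 1) / real l)" by (rule sum_mono) (rule le)
      also have "\<dots> = R / real l" unfolding R_def by (simp add: sum_divide_distrib)
      also have "\<dots> \<le> \<epsilon>" using l l0 \<epsilon> by (simp add: field_simps)
      finally show ?case by simp
    qed
    with F show ?thesis by blast
  qed
  have "(\<lambda>n. P n m) \<longlonglongrightarrow> pmf ?W m"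
  proof (rule proportional_masses_limit[OF _ P0 c0 propor tight])
    show "sum (P n) F \<le> 1" if "finite F" for n F unfolding P_def by (rule masses_le_1[OF that])
  qed
  then show ?thesis unfolding P_def .
qed

text \<open>In the recursion at the entry \<open>Suc j\<close> the mass at \<open>j\<close> carries
  the factor \<open>\<mu> n\<close>, while the term for \<open>Suc j\<close> is at most
  \<open>Suc j\<close>. Division by \<open>\<mu> n\<close> bounds the mass at \<open>j\<close> by
  \<open>Suc j / \<mu> n\<close> plus the sparse error.\<close>

lemma counts_diverge:
  fixes H :: "nat graph"
  assumes H: "connected_graph H" "finite_simple_graph H" "card (verts H) = s" "2 \<le> s"
    and \<pi>: "\<forall>\<^sub>F n in sequentially. \<forall>S. S \<subseteq> {1..n} \<longrightarrow> card S = s \<longrightarrow>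
      measure (L n) {g. induced_subgraph g S \<simeq> H} = \<pi> n"
    and mean: "filterlim (\<lambda>n. real (n choose s) * \<pi> n) at_top sequentially"
  shows "(\<lambda>n. measure (L n) {g. b \<le> component_count g H}) \<longlonglongrightarrow> 1"
proof -
  define \<mu> where "\<mu> n = real (n choose s) * \<pi> n" for n
  have \<mu>: "filterlim \<mu> at_top sequentially" using mean unfolding \<mu>_def .
  have "(\<lambda>n. measure (L n) {g. component_count g H = j}) \<longlonglongrightarrow> 0" for j
  proof (rule Lim_null_comparison)
    show "\<forall>\<^sub>F n in sequentially. norm (measure (L n) {g. component_count g H = j}) \<le>
        real (Suc j) * inverse (\<mu> n) + 2 * real s * (real n * p n)"
      using \<pi> filterlim_at_top_dense[THEN iffD1, OF \<mu>, rule_format, of 0]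
    proof eventually_elim
      case (elim n)
      interpret sparse_random_graph "L n" n "p n" by (rule sparse)
      define m :: "nat graph \<Rightarrow> nat" where "m K = (if K = H then Suc j else 0)" for K
      have cv: "count_vector {H} g = m' \<longleftrightarrow> component_count g H = m' H" if "\<And>K. K \<noteq> H \<Longrightarrow> m' K = 0" for m' and g :: "nat graph"
        using that by (auto simp: count_vector_def fun_eq_iff)
      have "\<bar>real (m H) * prob {g. count_vector {H} g = m}
          - real (n choose s) * \<pi> n * prob {g. count_vector {H} g = m(H := m H - 1)}\<bar>
        \<le> real (n choose s) * \<pi> n * (2 * real s * real n * p n)"
        by (rule count_recursion) (use H elim(1) in \<open>auto simp: m_def\<close>)
      then have "\<bar>real (Suc j) * prob {g. component_count g H = Suc j} - \<mu> n * prob {g. component_count g H = j}\<bar>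
        \<le> \<mu> n * (2 * real s * real n * p n)"
        by (subst (asm) (1 2) cv) (auto simp: m_def \<mu>_def)
      then have "\<mu> n * prob {g. component_count g H = j} \<le>
          real (Suc j) * prob {g. component_count g H = Suc j} + \<mu> n * (2 * real s * real n * p n)" by linarith
      also have "\<dots> \<le> real (Suc j) * 1 + \<mu> n * (2 * real s * real n * p n)"
        by (intro add_right_mono mult_left_mono) auto
      finally show ?case using elim(2) by (simp add: field_simps)
    qed
    have "((\<lambda>n. inverse (\<mu> n)) \<longlongrightarrow> 0) sequentially"
      using filterlim_compose[OF tendsto_inverse_0_at_top \<mu>] tendsto_inverse_0_at_top[OF \<mu>] by blast
    then have "(\<lambda>n. real (Suc j) * inverse (\<mu> n) + 2 * real s * (real n * p n)) \<longlonglongrightarrow> real (Suc j) * 0 + 2 * real s * 0"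
      by (intro tendsto_add tendsto_mult tendsto_const sparse_degree)
    then show "(\<lambda>n. real (Suc j) * inverse (\<mu> n) + 2 * real s * (real n * p n)) \<longlonglongrightarrow> 0" by simp
  qed
  then have "(\<lambda>n. 1 - (\<Sum>j<b. measure (L n) {g. component_count g H = j})) \<longlonglongrightarrow> 1 - (\<Sum>j<b. 0)"
    by (intro tendsto_diff tendsto_sum tendsto_const)
  moreover have "1 - (\<Sum>j<b. measure (L n) {g. component_count g H = j}) = measure (L n) {g. b \<le> component_count g H}" for n
  proof -
    interpret sparse_random_graph "L n" n "p n" by (rule sparse)
    have "(\<Sum>j<b. prob {g. component_count g H = j}) = prob (\<Union>j<b. {g. component_count g H = j})"
      by (rule finite_measure_finite_Union[symmetric]) (auto simp: disjoint_family_on_def sets_L)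
    also have "(\<Union>j<b. {g. component_count g H = j}) = UNIV - {g. b \<le> component_count g H}" by auto
    finally show ?thesis using prob_compl[of "{g. b \<le> component_count g H}"] by simp
  qed
  ultimately show ?thesis by simp
qed

text \<open>The recursion needs two vertices, but here the first \<open>b\<close> vertices are all
  isolated except with probability at most \<open>b * n * p\<close>, and each of them is then a
  component.\<close>

lemma isolated_vertices_diverge:
  assumes H: "finite_simple_graph H" "card (verts H) = 1"
  shows "(\<lambda>n. measure (L n) {g. b \<le> component_count g H}) \<longlonglongrightarrow> 1"
proof (rule tendsto_sandwich)
  show "\<forall>\<^sub>F n in sequentially. 1 - real b * (real n * p n) \<le> measure (L n) {g. b \<le> component_count g H}"
    using eventually_ge_at_top[of b]
  proof eventually_elim
    case (elim n)
    interpret sparse_random_graph "L n" n "p n" by (rule sparse)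
    have sub: "{1..b} \<subseteq> {1..n}" using elim by auto
    obtain v where v: "verts H = {v}" using H(2) by (auto simp: card_1_singleton_iff)
    have adjH: "adj H = {}" using H(1) v unfolding finite_simple_graph_def irrefl_def by auto
    have key: "b \<le> component_count g H"
      if g: "finite_simple_graph g" "verts g = {1..n}" and iso: "\<And>u. u \<in> {1..b} \<Longrightarrow> isolated_set g {u}" for g
    proof -
      have g': "adj g \<subseteq> verts g \<times> verts g" "sym (adj g)" "irrefl (adj g)" using g(1) unfolding finite_simple_graph_def by auto
      have mem: "{u} \<in> component_sets g \<and> induced_subgraph g {u} \<simeq> H" if "u \<in> {1..b}" for u
      proof
        show "{u} \<in> component_sets g" unfolding component_sets_iff[OF g'(1,2)] connected_graph_def using iso[OF that] by simp
        show "induced_subgraph g {u} \<simeq> H" unfolding graph_iso_def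
          by (rule exI[of _ "\<lambda>_. v"]) (use v adjH g'(3) in \<open>auto simp: bij_betw_def irrefl_def\<close>)
      qed
      have "(\<lambda>u. {u}) ` {1..b} \<subseteq> {C \<in> component_sets g. induced_subgraph g C \<simeq> H}" using mem by blast
      moreover have "finite {C \<in> component_sets g. induced_subgraph g C \<simeq> H}"
        by (rule finite_subset[of _ "Pow (verts g)"]) (use g component_sets_subset in \<open>auto simp: finite_simple_graph_def\<close>)
      ultimately have "card ((\<lambda>u. {u}) ` {1..b}) \<le> component_count g H"
        unfolding component_count_def by (rule card_mono[rotated])
      then show ?thesis by (simp add: card_image)
    qed
    have "1 - prob {g. b \<le> component_count g H} = prob {g. \<not> b \<le> component_count g H}"
      using prob_compl[of "{g. b \<le> component_count g H}"] by (simp add: Collect_neg_eq Compl_eq_Diff_UNIV)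
    also have "\<dots> \<le> prob {g. \<exists>u\<in>{1..b}. \<not> isolated_set g {u}}"
      by (rule prob_le) (use key in blast)
    also have "\<dots> \<le> real b * real n * p n" using prob_ex_not_isolated[OF sub] by simp
    finally show ?case by (simp add: mult.assoc)
  qed
  show "\<forall>\<^sub>F n in sequentially. measure (L n) {g. b \<le> component_count g H} \<le> 1"
    using prob_space.prob_le_1[OF prob_L] by simp
  have "(\<lambda>n. 1 - real b * (real n * p n)) \<longlonglongrightarrow> 1 - real b * 0"
    by (intro tendsto_diff tendsto_mult tendsto_const sparse_degree)
  then show "(\<lambda>n. 1 - real b * (real n * p n)) \<longlonglongrightarrow> 1" by simp
qed simp

end


section \<open>The critical regime\<close>


lemma iso_representatives_unique:
  assumes "iso_representatives \<G> R" "H \<in> R" "H' \<in> R" "H \<simeq> H'"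
  shows "H = H'"
  using assms graph_iso_refl[of H] unfolding iso_representatives_def by blast

text \<open>Each representative has a copy on \<open>{1..s}\<close>, where there are finitely many
  graphs, and distinct representatives have distinct copies.\<close>

lemma finite_representatives:
  fixes R :: "nat graph set"
  assumes "iso_representatives (strictly_geometric_graphs TYPE('d::finite) s) R"
  shows "finite R"
proof -
  let ?B = "Graph {1..s} ` Pow ({1..s} \<times> {1..s})"
  have "\<exists>K\<in>?B. H \<simeq> K" if "H \<in> R" for H
  proof -
    have "finite_simple_graph H" "card (verts H) = s"
      using that assms unfolding iso_representatives_def strictly_geometric_graphs_def strictly_geometric_def by auto
    then obtain K where K: "finite_simple_graph K" "verts K = {1..s}" "H \<simeq> K" using ex_nat_graph[of H] by metis
    then have "K \<in> ?B" unfolding finite_simple_graph_def by (cases K) auto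
    with K show ?thesis by blast
  qed
  then obtain f where f: "\<And>H. H \<in> R \<Longrightarrow> f H \<in> ?B \<and> H \<simeq> f H" by metis
  have "inj_on f R"
  proof (rule inj_onI)
    fix H H' assume H: "H \<in> R" "H' \<in> R" "f H = f H'"
    have "H \<simeq> f H'" "f H' \<simeq> H'" using f[OF H(1)] f[OF H(2)] H(3) graph_iso_sym by auto
    then have "H \<simeq> H'" by (rule graph_iso_trans)
    then show "H = H'" using iso_representatives_unique[OF assms] H by blast
  qed
  moreover have "f ` R \<subseteq> ?B" using f by blast
  moreover have "finite ?B" by simp
  ultimately show ?thesis by (meson finite_imageD finite_subset)
qed

text \<open>The set grows by one vertex at a time along an edge that leaves it. This turns a
  component with more than \<open>k\<close> vertices into a connected set of exactly
  \<open>k + 1\<close>, whose expected number is small.\<close>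

lemma connected_subset:
  assumes G: "connected_graph G" "finite_simple_graph G" and j: "1 \<le> j" "j \<le> card (verts G)"
  shows "\<exists>S\<subseteq>verts G. card S = j \<and> connected_graph (induced_subgraph G S)"
  using j
proof (induction j rule: dec_induct)
  case base
  obtain v where "v \<in> verts G" using G(1) unfolding connected_graph_def by blast
  then show ?case by (intro exI[of _ "{v}"]) (auto simp: connected_graph_def)
next
  case (step j)
  have G': "finite (verts G)" "adj G \<subseteq> verts G \<times> verts G" "sym (adj G)"
    using G(2) unfolding finite_simple_graph_def by auto
  obtain S where S: "S \<subseteq> verts G" "card S = j" "connected_graph (induced_subgraph G S)"
    using step.IH step.prems by auto
  have finS: "finite S" using S(1) G'(1) finite_subset by blast
  have "\<not> isolated_set G S"
  proof
    assume iso: "isolated_set G S"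
    obtain u where u: "u \<in> S" using S(3) unfolding connected_graph_def by auto
    have "verts G \<subseteq> S"
    proof
      fix v assume "v \<in> verts G"
      then have "(u, v) \<in> (adj G)\<^sup>*" using G(1) u S(1) unfolding connected_graph_def by blast
      then show "v \<in> S" using isolated_set_closed[OF iso G'(2)] u by blast
    qed
    then have "card (verts G) \<le> j" using card_mono[OF finS] S(2) by simp
    then show False using step.prems by simp
  qed
  then obtain u v where uv: "u \<in> S" "v \<in> verts G" "v \<notin> S" "(u, v) \<in> adj G"
    using S(1) unfolding isolated_set_def by blast
  let ?T = "insert v S"
  let ?R = "adj G \<inter> ?T \<times> ?T"
  have symR: "sym ?R" using G'(3) unfolding sym_def by blast
  have from_u: "(u, x) \<in> ?R\<^sup>*" if "x \<in> ?T" for x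
  proof (cases "x = v")
    case True
    then show ?thesis using uv by auto
  next
    case False
    then have "(u, x) \<in> (adj G \<inter> S \<times> S)\<^sup>*" using S(3) that uv(1) unfolding connected_graph_def by simp
    moreover have "adj G \<inter> S \<times> S \<subseteq> ?R" by blast
    ultimately show ?thesis using rtrancl_mono by blast
  qed
  have "(x, y) \<in> ?R\<^sup>*" if "x \<in> ?T" "y \<in> ?T" for x y
    using from_u[OF that(1)] from_u[OF that(2)] sym_rtrancl[OF symR] by (meson rtrancl_trans symD)
  then have "connected_graph (induced_subgraph G ?T)" unfolding connected_graph_def by simp
  moreover have "card ?T = Suc j" using finS uv S(2) by simp
  ultimately show ?case using S(1) uv(2) by (intro exI[of _ ?T]) simp
qed

context torus_points
begin

text \<open>First moment bound over \<open>s\<close>-sets and over the connected graphs on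
  \<open>{1..s}\<close>. The sum in \<open>c\<close> runs over labelled graphs and so repeats
  isomorphism types; only its independence of \<open>n\<close> and \<open>r\<close> matters.\<close>

lemma prob_large_component_le:
  fixes s :: nat
  defines "c \<equiv> \<Sum>K | finite_simple_graph K \<and> verts K = {1..s} \<and> connected_graph K. geometric_constant TYPE('d) K"
  assumes s: "1 \<le> s" and r: "0 < r" "real (s\<^sup>2) * r \<le> 1/4"
  shows "L.prob {g. \<exists>C\<in>component_sets g. s \<le> card C} \<le> real (n choose s) * (r ^ (CARD('d) * (s - 1)) * c)"
proof -
  let ?K = "{K :: nat graph. finite_simple_graph K \<and> verts K = {1..s} \<and> connected_graph K}"
  let ?S = "{S. S \<subseteq> {1..n} \<and> card S = s}"
  have "?K \<subseteq> Graph {1..s} ` Pow ({1..s} \<times> {1..s})"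
  proof
    fix K assume "K \<in> ?K"
    then show "K \<in> Graph {1..s} ` Pow ({1..s} \<times> {1..s})" unfolding finite_simple_graph_def by (cases K) auto
  qed
  then have finK: "finite ?K" by (rule finite_subset) simp
  have finS: "finite ?S" by (rule finite_subset[of _ "Pow {1..n}"]) auto
  have cardS: "card ?S = n choose s" using n_subsets[of "{1..n}" s] by simp
  have "L.prob {g. \<exists>C\<in>component_sets g. s \<le> card C} \<le> L.prob {g. \<exists>S\<in>?S. \<exists>K\<in>?K. induced_subgraph g S \<simeq> K}"
  proof (rule L.prob_le)
    fix g assume g: "finite_simple_graph g" "verts g = {1..n}" "\<exists>C\<in>component_sets g. s \<le> card C"
    then obtain C where C: "C \<in> component_sets g" "s \<le> card C" by blast
    have g': "adj g \<subseteq> verts g \<times> verts g" "sym (adj g)" using g(1) unfolding finite_simple_graph_def by auto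
    have con: "connected_graph (induced_subgraph g C)" using C(1) component_sets_iff[OF g'] by blast
    have sub: "C \<subseteq> verts g" using C(1) component_sets_subset by blast
    obtain S where S: "S \<subseteq> C" "card S = s" "connected_graph (induced_subgraph (induced_subgraph g C) S)"
      using connected_subset[OF con finite_simple_induced[OF g(1) sub] s] C(2) by auto
    then have conS: "connected_graph (induced_subgraph g S)" by (simp only: induced_subgraph_nested)
    have Sg: "S \<subseteq> verts g" using S(1) sub by blast
    have fs: "finite_simple_graph (induced_subgraph g S)" by (rule finite_simple_induced[OF g(1) Sg])
    obtain K :: "nat graph" where K: "finite_simple_graph K" "verts K = {1..s}" "induced_subgraph g S \<simeq> K"
      using ex_nat_graph[OF fs] S(2) by auto
    have "connected_graph K" by (rule graph_iso_connected[OF K(3) conS]) auto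
    with K S(2) Sg g(2) show "\<exists>S\<in>?S. \<exists>K\<in>?K. induced_subgraph g S \<simeq> K" by blast
  qed
  also have "\<dots> \<le> (\<Sum>S\<in>?S. L.prob {g. \<exists>K\<in>?K. induced_subgraph g S \<simeq> K})" by (rule L.prob_Ex_le[OF finS])
  also have "\<dots> \<le> (\<Sum>S\<in>?S. \<Sum>K\<in>?K. L.prob {g. induced_subgraph g S \<simeq> K})"
    by (rule sum_mono) (rule L.prob_Ex_le[OF finK])
  also have "\<dots> = (\<Sum>S\<in>?S. \<Sum>K\<in>?K. r ^ (CARD('d) * (s - 1)) * geometric_constant TYPE('d) K)"
    by (intro sum.cong refl prob_induced_iso) (use r in auto)
  also have "\<dots> = real (n choose s) * (r ^ (CARD('d) * (s - 1)) * c)"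
    unfolding c_def cardS[symmetric] by (simp add: sum_distrib_left)
  finally show ?thesis .
qed

lemma component_strictly_geometric:
  assumes C: "C \<in> component_sets (graph_on {1..n} \<omega>)" "card C \<le> k"
    and r: "0 < r" "real (k\<^sup>2) * r \<le> 1/4"
    and ne: "\<not> (\<exists>i\<in>{1..n}. \<exists>j\<in>{1..n} - {i}. torus_dist (X i \<omega>) (X j \<omega>) = r)"
  shows "strictly_geometric TYPE('d) (induced_subgraph (graph_on {1..n} \<omega>) C)"
proof -
  let ?G = "graph_on {1..n} \<omega>"
  have G: "finite_simple_graph ?G" "verts ?G = {1..n}"
    unfolding graph_on_def by (auto intro: finite_simple_point_graph)
  then have G': "adj ?G \<subseteq> verts ?G \<times> verts ?G" "sym (adj ?G)" unfolding finite_simple_graph_def by auto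
  have sub: "C \<subseteq> {1..n}" using C(1) component_sets_subset[of ?G] G(2) by auto
  have con: "connected_graph (induced_subgraph ?G C)" using C(1) component_sets_iff[OF G'] by blast
  have ind: "induced_subgraph ?G C = point_graph C r (\<lambda>i. X i \<omega>)"
    using induced_graph_on[OF sub] unfolding graph_on_def by simp
  have "real ((card C)\<^sup>2) * r \<le> real (k\<^sup>2) * r"
    using C(2) r(1) by (intro mult_right_mono) (auto intro: power_mono)
  then have rC: "real ((card C)\<^sup>2) * r \<le> 1/4" using r(2) by linarith
  show ?thesis unfolding ind
    by (rule strictly_geometric_point_graph[OF _ _ r(1) rC])
      (use sub con ind ne finite_subset[OF sub] in auto)
qed

end

text \<open>Passing from \<open>s\<close> to \<open>Suc s\<close> multiplies the quotient by
  \<open>(1 - s / n) / (s + 1)\<close>.\<close>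

lemma binomial_asymp: "(\<lambda>n. real (n choose s) / real n ^ s) \<longlonglongrightarrow> 1 / fact s"
proof (induction s)
  case (Suc s)
  have l: "(\<lambda>n. (1 - real s * (1 / real n)) / real (Suc s)) \<longlonglongrightarrow> (1 - real s * 0) / real (Suc s)"
    by (intro tendsto_divide tendsto_diff tendsto_mult tendsto_const lim_1_over_n) auto
  have "(\<lambda>n. real (n choose s) / real n ^ s * ((1 - real s * (1 / real n)) / real (Suc s))) \<longlonglongrightarrow>
      1 / fact s * ((1 - real s * 0) / real (Suc s))"
    by (rule tendsto_mult[OF Suc l])
  then have "(\<lambda>n. real (n choose s) / real n ^ s * ((1 - real s * (1 / real n)) / real (Suc s))) \<longlonglongrightarrow> 1 / fact (Suc s)"
    by (simp add: field_simps)
  moreover have "\<forall>\<^sub>F n in sequentially. real (n choose s) / real n ^ s * ((1 - real s * (1 / real n)) / real (Suc s)) =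
      real (n choose Suc s) / real n ^ Suc s"
    using eventually_ge_at_top[of "Suc s"]
  proof eventually_elim
    case (elim n)
    have "Suc s * (n choose Suc s) = (n - s) * (n choose s)" by (simp only: binomial_absorption binomial_absorb_comp)
    then have "real (Suc s) * real (n choose Suc s) = (real n - real s) * real (n choose s)"
      using elim by (metis Suc_leD of_nat_diff of_nat_mult)
    then have "real (n choose Suc s) = (real n - real s) * real (n choose s) / real (Suc s)"
      by (simp add: field_simps del: of_nat_Suc)
    moreover have "1 - real s * (1 / real n) = (real n - real s) / real n" using elim by (simp add: field_simps)
    ultimately show ?case by (simp add: mult_ac del: of_nat_Suc)
  qed
  ultimately show ?case by (rule Lim_transform_eventually)
qed simp

definition poisson_vector :: "'d::finite itself \<Rightarrow> real \<Rightarrow> 'a graph set \<Rightarrow> ('a graph \<Rightarrow> nat) pmf" where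
  "poisson_vector D a R = Pi_pmf R 0 (\<lambda>H. poisson_pmf (poisson_rate D a H))"

locale critical_torus =
  fixes k :: nat and r :: "nat \<Rightarrow> real" and a :: real
    and M :: "nat \<Rightarrow> 'w measure"
    and X :: "nat \<Rightarrow> nat \<Rightarrow> 'w \<Rightarrow> real ^ 'd"
    and \<H> :: "nat \<Rightarrow> nat graph set"
  assumes k2: "k \<ge> 2"
    and r_range: "\<And>n. r n \<in> {0..1/2}"
    and a_pos: "a > 0"
    and scaling: "(\<lambda>n. real n ^ k * r n ^ (CARD('d) * (k - 1))) \<longlonglongrightarrow> a"
    and prob_M: "\<And>n. prob_space (M n)"
    and indep_X: "\<And>n. prob_space.indep_vars (M n) (\<lambda>_. borel) (X n) {1..n}"
    and uniform_X: "\<And>n i. i \<in> {1..n} \<Longrightarrow> distr (M n) borel (X n i) = uniform_torus"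
    and reps: "\<And>s. s \<ge> 1 \<Longrightarrow> iso_representatives (strictly_geometric_graphs TYPE('d) s) (\<H> s)"
begin

text \<open>The number of points per cell of side \<open>r n\<close>: the mean degree up to a constant.\<close>

definition intensity :: "nat \<Rightarrow> real" where
  "intensity n = real n * r n ^ CARD('d)"

lemma r_nonneg: "0 \<le> r n"
  using r_range[of n] by auto

lemma intensity_nonneg: "0 \<le> intensity n"
  unfolding intensity_def using r_nonneg by simp

lemma intensity_power: "1 \<le> s \<Longrightarrow> real n ^ s * r n ^ (CARD('d) * (s - 1)) = real n * intensity n ^ (s - 1)"
  unfolding intensity_def by (cases s) (auto simp: power_mult_distrib power_mult)

lemma scaling': "(\<lambda>n. real n * intensity n ^ (k - 1)) \<longlonglongrightarrow> a"
proof -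
  have "real n ^ k * r n ^ (CARD('d) * (k - 1)) = real n * intensity n ^ (k - 1)" for n
    by (rule intensity_power) (use k2 in simp)
  then show ?thesis using scaling by (simp only:)
qed

text \<open>The power \<open>k - 1\<close> of the intensity is a convergent sequence divided by
  \<open>n\<close>, and \<open>k \<ge> 2\<close> makes the root meaningful.\<close>

lemma intensity_tendsto_0: "intensity \<longlonglongrightarrow> 0"
proof -
  have "(\<lambda>n. (1 / real n) * (real n * intensity n ^ (k - 1))) \<longlonglongrightarrow> 0 * a"
    by (intro tendsto_mult lim_1_over_n scaling')
  moreover have "\<forall>\<^sub>F n in sequentially. (1 / real n) * (real n * intensity n ^ (k - 1)) = intensity n ^ (k - 1)"
    using eventually_gt_at_top[of 0] by eventually_elim simp
  ultimately have "(\<lambda>n. intensity n ^ (k - 1)) \<longlonglongrightarrow> 0" using Lim_transform_eventually by force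
  then have "(\<lambda>n. root (k - 1) (intensity n ^ (k - 1))) \<longlonglongrightarrow> root (k - 1) 0" by (rule tendsto_real_root)
  then show ?thesis using k2 intensity_nonneg by (simp add: real_root_power_cancel)
qed

lemma r_tendsto_0: "r \<longlonglongrightarrow> 0"
proof -
  have "(\<lambda>n. r n ^ CARD('d)) \<longlonglongrightarrow> 0"
  proof (rule Lim_null_comparison[OF _ intensity_tendsto_0])
    show "\<forall>\<^sub>F n in sequentially. norm (r n ^ CARD('d)) \<le> intensity n"
      using eventually_ge_at_top[of 1]
    proof eventually_elim
      case (elim n)
      have "1 * r n ^ CARD('d) \<le> real n * r n ^ CARD('d)" using elim r_nonneg by (intro mult_right_mono) auto
      then show ?case unfolding intensity_def using r_nonneg by simp
    qed
  qed
  then have "(\<lambda>n. root CARD('d) (r n ^ CARD('d))) \<longlonglongrightarrow> root CARD('d) 0" by (rule tendsto_real_root)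
  then show ?thesis using r_nonneg by (simp add: real_root_power_cancel)
qed

text \<open>A zero radius makes the scaled quantity 0, the exponent being positive, and this can
  happen only finitely often as the limit is positive.\<close>

lemma r_eventually_pos: "\<forall>\<^sub>F n in sequentially. 0 < r n"
proof -
  have "\<forall>\<^sub>F n in sequentially. 0 < real n ^ k * r n ^ (CARD('d) * (k - 1))"
    using order_tendstoD(1)[OF scaling a_pos] .
  then show ?thesis
  proof eventually_elim
    case (elim n)
    then have "r n \<noteq> 0" using k2 by (cases "r n = 0") (auto simp: power_0_left)
    then show ?case using r_nonneg[of n] by simp
  qed
qed

lemma r_eventually_small: "\<forall>\<^sub>F n in sequentially. real (s\<^sup>2) * r n \<le> 1/4"
proof -
  have "(\<lambda>n. real (s\<^sup>2) * r n) \<longlonglongrightarrow> real (s\<^sup>2) * 0" by (intro tendsto_mult tendsto_const r_tendsto_0)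
  then have "\<forall>\<^sub>F n in sequentially. real (s\<^sup>2) * r n < 1/4" by (intro order_tendstoD(2)) auto
  then show ?thesis by (rule eventually_mono) simp
qed

lemma mean_factor: "1 \<le> s \<Longrightarrow> 0 < n \<Longrightarrow> real (n choose s) * r n ^ (CARD('d) * (s - 1)) =
    (real (n choose s) / real n ^ s) * (real n * intensity n ^ (s - 1))"
  unfolding intensity_power[symmetric] by simp

lemma mean_critical: "(\<lambda>n. real (n choose k) * r n ^ (CARD('d) * (k - 1))) \<longlonglongrightarrow> a / fact k"
proof -
  have "(\<lambda>n. (real (n choose k) / real n ^ k) * (real n * intensity n ^ (k - 1))) \<longlonglongrightarrow> 1 / fact k * a"
    by (intro tendsto_mult binomial_asymp scaling')
  moreover have "\<forall>\<^sub>F n in sequentially. (real (n choose k) / real n ^ k) * (real n * intensity n ^ (k - 1)) =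
      real (n choose k) * r n ^ (CARD('d) * (k - 1))"
    using eventually_gt_at_top[of 0]
  proof eventually_elim
    case (elim n)
    show ?case by (rule mean_factor[symmetric]) (use elim k2 in auto)
  qed
  ultimately show ?thesis using Lim_transform_eventually by force
qed

text \<open>With \<open>x\<close> for the intensity, the mean is of order
  \<open>n * x^(s-1) = n * x^(k-1) / x^(k-s)\<close>, where the numerator converges to
  \<open>a\<close> and the denominator to 0.\<close>

lemma mean_subcritical:
  assumes "1 \<le> s" "s < k"
  shows "filterlim (\<lambda>n. real (n choose s) * r n ^ (CARD('d) * (s - 1))) at_top sequentially"
proof -
  have pos: "\<forall>\<^sub>F n in sequentially. 0 < intensity n"
    using r_eventually_pos eventually_gt_at_top[of 0] by eventually_elim (simp add: intensity_def)
  have lim: "(\<lambda>n. real (n choose s) / real n ^ s * (real n * intensity n ^ (k - 1))) \<longlonglongrightarrow> 1 / fact s * a"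
    by (intro tendsto_mult binomial_asymp scaling')
  have inv: "filterlim (\<lambda>n. inverse (intensity n ^ (k - s))) at_top sequentially"
  proof (rule filterlim_inverse_at_top)
    have "(\<lambda>n. intensity n ^ (k - s)) \<longlonglongrightarrow> 0 ^ (k - s)" by (intro tendsto_power intensity_tendsto_0)
    then show "(\<lambda>n. intensity n ^ (k - s)) \<longlonglongrightarrow> 0" using assms by (simp add: power_0_left)
    show "\<forall>\<^sub>F n in sequentially. 0 < intensity n ^ (k - s)" using pos by eventually_elim simp
  qed
  have "filterlim (\<lambda>n. (real (n choose s) / real n ^ s * (real n * intensity n ^ (k - 1))) *
      inverse (intensity n ^ (k - s))) at_top sequentially"
    by (rule filterlim_tendsto_pos_mult_at_top[OF lim _ inv]) (use a_pos in auto)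
  moreover have e: "\<forall>\<^sub>F n in sequentially. (real (n choose s) / real n ^ s * (real n * intensity n ^ (k - 1))) *
      inverse (intensity n ^ (k - s)) = real (n choose s) * r n ^ (CARD('d) * (s - 1))"
    using pos eventually_gt_at_top[of 0]
  proof eventually_elim
    case (elim n)
    have "k - 1 = (s - 1) + (k - s)" using assms by simp
    then have "intensity n ^ (k - 1) * inverse (intensity n ^ (k - s)) = intensity n ^ (s - 1)"
      using elim by (simp add: power_add)
    then show ?case unfolding mean_factor[OF assms(1) elim(2)] by (simp add: mult.assoc)
  qed
  ultimately show ?thesis by (simp only: filterlim_cong[OF refl refl e])
qed

text \<open>One more vertex costs one more factor of the intensity, which tends to 0.\<close>

lemma mean_supercritical: "(\<lambda>n. real (n choose Suc k) * r n ^ (CARD('d) * k)) \<longlonglongrightarrow> 0"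
proof -
  have "(\<lambda>n. (real (n choose Suc k) / real n ^ Suc k) * ((real n * intensity n ^ (k - 1)) * intensity n)) \<longlonglongrightarrow> 1 / fact (Suc k) * (a * 0)"
    by (intro tendsto_mult binomial_asymp scaling' intensity_tendsto_0)
  moreover have "\<forall>\<^sub>F n in sequentially. (real (n choose Suc k) / real n ^ Suc k) * ((real n * intensity n ^ (k - 1)) * intensity n) =
      real (n choose Suc k) * r n ^ (CARD('d) * k)"
    using eventually_gt_at_top[of 0]
  proof eventually_elim
    case (elim n)
    have "intensity n ^ (k - 1) * intensity n = intensity n ^ (Suc k - 1)" using k2 by (cases k) auto
    then show ?case using mean_factor[of "Suc k" n] elim by (simp add: mult.assoc)
  qed
  ultimately show ?thesis using Lim_transform_eventually by force
qed

section \<open>The law of the random torus graph along the sequence\<close>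

definition graph_law :: "nat \<Rightarrow> nat graph measure" where
  "graph_law n = distr (M n) (count_space UNIV) (random_torus_graph r X n)"

lemma torus_points: "torus_points (M n) (X n) n (r n)"
  unfolding torus_points_def torus_points_axioms_def using prob_M indep_X uniform_X r_nonneg by blast

lemma random_torus_graph_eq: "random_torus_graph r X n = torus_points.graph_on (X n) (r n) {1..n}"
  unfolding torus_points.graph_on_def[OF torus_points] random_torus_graph_def torus_graph_point_graph ..

lemma graph_law_eq: "graph_law n = torus_points.law (M n) (X n) n (r n)"
  unfolding torus_points.law_def[OF torus_points] graph_law_def random_torus_graph_eq ..

lemma measure_graph_law:
  "measure (M n) {\<omega> \<in> space (M n). Q (random_torus_graph r X n \<omega>)} = measure (graph_law n) {g. Q g}"
  unfolding graph_law_eq torus_points.measure_law[OF torus_points] random_torus_graph_eq ..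

lemma random_torus_graph_measurable: "random_torus_graph r X n \<in> measurable (M n) (count_space UNIV)"
  unfolding random_torus_graph_eq by (rule torus_points.graph_on_measurable[OF torus_points]) simp

sublocale sparse_sequence graph_law "\<lambda>n. (2 * r n) ^ CARD('d)"
proof (rule sparse_sequence.intro)
  show "sparse_random_graph (graph_law n) n ((2 * r n) ^ CARD('d))" for n
    unfolding graph_law_eq by (rule torus_points.sparse_law[OF torus_points])
  have "(\<lambda>n. 2 ^ CARD('d) * intensity n) \<longlonglongrightarrow> 2 ^ CARD('d) * 0"
    by (intro tendsto_mult tendsto_const intensity_tendsto_0)
  then show "(\<lambda>n. real n * (2 * r n) ^ CARD('d)) \<longlonglongrightarrow> 0"
    by (simp add: intensity_def power_mult_distrib mult_ac)
qed

lemma prob_iso: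
  assumes "connected_graph H" "finite_simple_graph H" "card (verts H) = s"
  shows "\<forall>\<^sub>F n in sequentially. \<forall>S. S \<subseteq> {1..n} \<longrightarrow> card S = s \<longrightarrow>
    measure (graph_law n) {g. induced_subgraph g S \<simeq> H} = r n ^ (CARD('d) * (s - 1)) * geometric_constant TYPE('d) H"
  using r_eventually_pos r_eventually_small[of s]
proof eventually_elim
  case (elim n)
  then show ?case
    unfolding graph_law_eq using torus_points.prob_induced_iso[OF torus_points _ _ assms] by blast
qed

lemma reps_graph:
  assumes "1 \<le> s" "H \<in> \<H> s"
  shows "strictly_geometric TYPE('d) H" "finite_simple_graph H" "connected_graph H" "card (verts H) = s"
  using reps[OF assms(1)] assms(2)
  unfolding iso_representatives_def strictly_geometric_graphs_def strictly_geometric_def by auto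

lemma reps_unique:
  assumes "1 \<le> s" "1 \<le> s'" "H \<in> \<H> s" "H' \<in> \<H> s'" "H \<simeq> H'"
  shows "H = H'"
proof -
  have "s = s'" using graph_iso_card[OF assms(5)] reps_graph(4)[OF assms(1,3)] reps_graph(4)[OF assms(2,4)] by simp
  then show ?thesis using iso_representatives_unique[OF reps[OF assms(1)]] assms by blast
qed

lemma finite_reps: "1 \<le> s \<Longrightarrow> finite (\<H> s)"
  using finite_representatives[OF reps] .

lemma poisson_rate_pos: "H \<in> \<H> k \<Longrightarrow> 0 < poisson_rate TYPE('d) a H"
  unfolding poisson_rate_def
  using a_pos k2 geometric_constant_pos[OF reps_graph(1)[of k H]] reps_graph(4)[of k H] by simp

lemma count_vector_limit:
  "(\<lambda>n. measure (graph_law n) {g. count_vector (\<H> k) g = m}) \<longlonglongrightarrow> pmf (poisson_vector TYPE('d) a (\<H> k)) m"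
  unfolding poisson_vector_def
proof (rule poisson_limit[where s = k])
  have k1: "1 \<le> k" using k2 by simp
  show "finite (\<H> k)" by (rule finite_reps[OF k1])
  show "\<forall>\<^sub>F n in sequentially. \<forall>H\<in>\<H> k. \<forall>S. S \<subseteq> {1..n} \<longrightarrow> card S = k \<longrightarrow>
      measure (graph_law n) {g. induced_subgraph g S \<simeq> H} = r n ^ (CARD('d) * (k - 1)) * geometric_constant TYPE('d) H"
    by (rule eventually_ball_finite[OF finite_reps[OF k1]]) (use prob_iso reps_graph[OF k1] in blast)
  show "(\<lambda>n. real (n choose k) * (r n ^ (CARD('d) * (k - 1)) * geometric_constant TYPE('d) H)) \<longlonglongrightarrow> poisson_rate TYPE('d) a H"
    if "H \<in> \<H> k" for H
  proof -
    have "(\<lambda>n. real (n choose k) * r n ^ (CARD('d) * (k - 1)) * geometric_constant TYPE('d) H) \<longlonglongrightarrow>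
        a / fact k * geometric_constant TYPE('d) H"
      by (intro tendsto_mult mean_critical tendsto_const)
    then show ?thesis using reps_graph(4)[OF k1 that] by (simp add: poisson_rate_def mult.assoc)
  qed
qed (use k2 reps_graph[of k] reps_unique[of k k] poisson_rate_pos in auto)

lemma expectation_limit:
  fixes f :: "(nat graph \<Rightarrow> nat) \<Rightarrow> real"
  assumes "\<And>m. \<bar>f m\<bar> \<le> B"
  shows "(\<lambda>n. \<integral>g. f (count_vector (\<H> k) g) \<partial>graph_law n) \<longlonglongrightarrow> measure_pmf.expectation (poisson_vector TYPE('d) a (\<H> k)) f"
proof (rule pointwise_pmf_limit_expectation)
  show "(\<lambda>n. measure (graph_law n) {g. count_vector (\<H> k) g = m}) \<longlonglongrightarrow> pmf (poisson_vector TYPE('d) a (\<H> k)) m" for m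
    by (rule count_vector_limit)
qed (use prob_L sets_L assms in auto)

lemma lower_counts_limit:
  assumes "H \<in> up_to \<H> (k - 1)"
  shows "(\<lambda>n. measure (graph_law n) {g. b \<le> component_count g H}) \<longlonglongrightarrow> 1"
proof -
  obtain s where s: "1 \<le> s" "s < k" "H \<in> \<H> s" using assms k2 unfolding up_to_def by auto
  note H = reps_graph[OF s(1,3)]
  show ?thesis
  proof (cases "s = 1")
    case True
    then show ?thesis using isolated_vertices_diverge H by simp
  next
    case False
    then have s2: "2 \<le> s" using s by simp
    show ?thesis
    proof (rule counts_diverge[OF H(3,2,4) s2 prob_iso[OF H(3,2,4)]])
      have "filterlim (\<lambda>n. geometric_constant TYPE('d) H * (real (n choose s) * r n ^ (CARD('d) * (s - 1)))) at_top sequentially"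
        by (rule filterlim_tendsto_pos_mult_at_top[OF tendsto_const _ mean_subcritical[OF s(1,2)]])
          (use geometric_constant_pos[OF H(1)] H(4) s2 in auto)
      then show "filterlim (\<lambda>n. real (n choose s) * (r n ^ (CARD('d) * (s - 1)) * geometric_constant TYPE('d) H)) at_top sequentially"
        by (simp add: mult_ac)
    qed
  qed
qed

definition typical :: "nat graph \<Rightarrow> bool" where
  "typical g \<longleftrightarrow> (\<forall>C\<in>component_sets g. card C \<le> k \<and> (\<exists>H\<in>up_to \<H> k. induced_subgraph g C \<simeq> H))"

text \<open>Only two things can go wrong: a component with more than \<open>k\<close> vertices,
  excluded by the supercritical mean, or a pair at distance exactly \<open>r n\<close>, which has
  probability 0. Otherwise every component is strictly geometric and has a representative.\<close>

lemma typical_limit: "(\<lambda>n. measure (graph_law n) {g. typical g}) \<longlonglongrightarrow> 1"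
proof -
  define c where "c = (\<Sum>K | finite_simple_graph K \<and> verts K = {1..Suc k} \<and> connected_graph K. geometric_constant TYPE('d) K)"
  have lower: "\<forall>\<^sub>F n in sequentially. 1 - real (n choose Suc k) * r n ^ (CARD('d) * k) * c \<le> measure (graph_law n) {g. typical g}"
    using r_eventually_pos r_eventually_small[of "Suc k"] r_eventually_small[of k]
  proof eventually_elim
    case (elim n)
    interpret T: torus_points "M n" "X n" n "r n" by (rule torus_points)
    let ?G = "random_torus_graph r X n"
    let ?bad = "{\<omega> \<in> space (M n). \<exists>i\<in>{1..n}. \<exists>j\<in>{1..n} - {i}. torus_dist (X n i \<omega>) (X n j \<omega>) = r n}"
    let ?large = "{\<omega> \<in> space (M n). \<exists>C\<in>component_sets (?G \<omega>). Suc k \<le> card C}"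
    let ?typical = "{\<omega> \<in> space (M n). typical (?G \<omega>)}"
    have ev: "{\<omega> \<in> space (M n). Q (?G \<omega>)} \<in> sets (M n)" for Q
      unfolding random_torus_graph_eq by (rule T.graph_on_event) simp
    have bad: "?bad \<in> sets (M n)"
    proof -
      have [measurable]: "X n i \<in> borel_measurable (M n)" if "i \<in> {1..n}" for i by (rule T.X_measurable[OF that])
      show ?thesis by measurable
    qed
    have sub: "space (M n) - ?typical \<subseteq> ?large \<union> ?bad"
    proof
      fix \<omega> assume w: "\<omega> \<in> space (M n) - ?typical"
      show "\<omega> \<in> ?large \<union> ?bad"
      proof (rule ccontr)
        assume not: "\<omega> \<notin> ?large \<union> ?bad"
        have "typical (?G \<omega>)" unfolding typical_def
        proof
          fix C assume C: "C \<in> component_sets (?G \<omega>)"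
          then have Ck: "card C \<le> k" using not w by auto
          have sg: "strictly_geometric TYPE('d) (induced_subgraph (?G \<omega>) C)"
            unfolding random_torus_graph_eq
            by (rule T.component_strictly_geometric[OF _ Ck elim(1) elim(3)])
              (use C not w in \<open>auto simp: random_torus_graph_eq\<close>)
          have "finite C" "C \<noteq> {}" using sg component_sets_nonempty[OF C]
            unfolding strictly_geometric_def finite_simple_graph_def by auto
          then have C1: "1 \<le> card C" by (simp add: Suc_le_eq card_gt_0_iff)
          have "induced_subgraph (?G \<omega>) C \<in> strictly_geometric_graphs TYPE('d) (card C)"
            using sg unfolding strictly_geometric_graphs_def by simp
          then obtain H where "H \<in> \<H> (card C)" "induced_subgraph (?G \<omega>) C \<simeq> H"
            using reps[OF C1] unfolding iso_representatives_def by blast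
          then show "card C \<le> k \<and> (\<exists>H\<in>up_to \<H> k. induced_subgraph (?G \<omega>) C \<simeq> H)"
            using Ck C1 unfolding up_to_def by auto
        qed
        then show False using w by simp
      qed
    qed
    have large: "?large \<in> sets (M n)" by (rule ev)
    have "T.prob (space (M n) - ?typical) \<le> T.prob (?large \<union> ?bad)"
      by (rule T.finite_measure_mono[OF sub sets.Un[OF large bad]])
    also have "\<dots> \<le> T.prob ?large + T.prob ?bad" by (rule measure_Un_le[OF large bad])
    finally have "T.prob (space (M n) - ?typical) \<le> T.prob ?large + T.prob ?bad" .
    then have "1 - T.prob ?typical \<le> T.prob ?large"
      using T.prob_compl[OF ev[of typical]] T.prob_touching by simp
    also have "T.prob ?large = measure (graph_law n) {g. \<exists>C\<in>component_sets g. Suc k \<le> card C}"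
      by (rule measure_graph_law)
    also have "\<dots> \<le> real (n choose Suc k) * (r n ^ (CARD('d) * (Suc k - 1)) * c)"
      unfolding graph_law_eq c_def by (rule T.prob_large_component_le) (use elim in auto)
    finally show ?case unfolding measure_graph_law by (simp add: mult.assoc)
  qed
  have "(\<lambda>n. 1 - real (n choose Suc k) * r n ^ (CARD('d) * k) * c) \<longlonglongrightarrow> 1 - 0 * c"
    by (intro tendsto_diff tendsto_mult tendsto_const mean_supercritical)
  then have lim: "(\<lambda>n. 1 - real (n choose Suc k) * r n ^ (CARD('d) * k) * c) \<longlonglongrightarrow> 1" by simp
  have upper: "\<forall>\<^sub>F n in sequentially. measure (graph_law n) {g. typical g} \<le> 1"
    by (simp add: prob_space.prob_le_1[OF prob_L])
  show ?thesis by (rule tendsto_sandwich[OF lower upper lim tendsto_const])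
qed

end


section \<open>Limiting probabilities of sentences\<close>


lemma complete_graph_simple: "finite_simple_graph (complete_graph s)"
  unfolding finite_simple_graph_def complete_graph_def by (auto simp: sym_def irrefl_def)

lemma complete_graph_connected: "1 \<le> s \<Longrightarrow> connected_graph (complete_graph s)"
  unfolding connected_graph_def
proof (intro conjI ballI)
  fix u v assume "u \<in> verts (complete_graph s)" "v \<in> verts (complete_graph s)"
  then show "(u, v) \<in> (adj (complete_graph s))\<^sup>*"
    unfolding complete_graph_def by (cases "u = v") (auto intro: r_into_rtrancl)
qed (simp add: complete_graph_def)

text \<open>All vertices are placed at the same point, so every distance is 0.\<close>

lemma complete_graph_strictly_geometric:
  assumes "2 \<le> s"
  shows "strictly_geometric TYPE('d::finite) (complete_graph s)"
  unfolding strictly_geometric_def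
proof (intro conjI disjI2 exI[of _ "\<lambda>_. 0"])
  show "connected_graph (complete_graph s)" using assms by (intro complete_graph_connected) simp
qed (auto simp: complete_graph_simple, auto simp: complete_graph_def infnorm_0)

lemma iso_complete_graph_iff:
  assumes G: "finite_simple_graph G" and s: "card (verts G) = s"
  shows "G \<simeq> complete_graph s \<longleftrightarrow> (\<forall>u\<in>verts G. \<forall>v\<in>verts G. u \<noteq> v \<longrightarrow> (u, v) \<in> adj G)"
proof
  assume "G \<simeq> complete_graph s"
  then obtain f where f: "bij_betw f (verts G) {1..s}"
    "\<forall>u\<in>verts G. \<forall>v\<in>verts G. (u, v) \<in> adj G \<longleftrightarrow> (f u, f v) \<in> adj (complete_graph s)"
    unfolding graph_iso_def complete_graph_def by auto
  have "f u \<in> {1..s}" "f u \<noteq> f v" if "u \<in> verts G" "v \<in> verts G" "u \<noteq> v" for u v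
    using bij_betwE[OF f(1)] inj_on_eq_iff[OF bij_betw_imp_inj_on[OF f(1)]] that by auto
  then show "\<forall>u\<in>verts G. \<forall>v\<in>verts G. u \<noteq> v \<longrightarrow> (u, v) \<in> adj G"
    using f(2) bij_betwE[OF f(1)] unfolding complete_graph_def by auto
next
  assume *: "\<forall>u\<in>verts G. \<forall>v\<in>verts G. u \<noteq> v \<longrightarrow> (u, v) \<in> adj G"
  have "finite (verts G)" using G unfolding finite_simple_graph_def by blast
  then obtain f where f: "bij_betw f (verts G) {1..s}"
    using finite_same_card_bij[of "verts G" "{1..s}"] s by auto
  have "(u, v) \<in> adj G \<longleftrightarrow> (f u, f v) \<in> adj (complete_graph s)" if uv: "u \<in> verts G" "v \<in> verts G" for u v
  proof -
    have "(u, v) \<in> adj G \<longleftrightarrow> u \<noteq> v" using * uv G unfolding finite_simple_graph_def irrefl_def by auto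
    also have "\<dots> \<longleftrightarrow> f u \<noteq> f v" using inj_on_eq_iff[OF bij_betw_imp_inj_on[OF f]] uv by blast
    also have "\<dots> \<longleftrightarrow> (f u, f v) \<in> adj (complete_graph s)"
      using bij_betwE[OF f] uv unfolding complete_graph_def by simp
    finally show ?thesis .
  qed
  then show "G \<simeq> complete_graph s" unfolding graph_iso_def
    by (intro exI[of _ f]) (use f in \<open>auto simp: complete_graph_def\<close>)
qed

section \<open>Transfer of sentences to the limit graphs, and the clique as a test\<close>

context critical_torus
begin

lemma k1: "1 \<le> k"
  using k2 by simp

lemma up_to_split: "up_to \<H> k = up_to \<H> (k - 1) \<union> \<H> k"
proof -
  have "{1..k} = insert k {1..k - 1}" using k2 by auto
  then show ?thesis unfolding up_to_def by auto
qed

lemma finite_up_to: "finite (up_to \<H> j)"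
  unfolding up_to_def using finite_reps by auto

lemma up_to_graph:
  assumes "H \<in> up_to \<H> j"
  shows "finite_simple_graph H" "connected_graph H"
  using assms reps_graph unfolding up_to_def by auto

lemma up_to_unique: "H \<in> up_to \<H> j \<Longrightarrow> H' \<in> up_to \<H> j \<Longrightarrow> H \<simeq> H' \<Longrightarrow> H = H'"
  unfolding up_to_def using reps_unique by fastforce

lemma limit_graph_eq:
  "limit_graph \<H> k m N = disjoint_copies (up_to \<H> k) (\<lambda>H. if H \<in> \<H> k then m H else N)"
  unfolding limit_graph_def up_to_split ..

text \<open>The counts on \<open>k\<close> vertices agree exactly by the choice of the vector; for
  smaller types both multiplicities reach the quantifier depth.\<close>

lemma typical_models_iff:
  assumes "finite_simple_graph g" "typical g" "sentence \<phi>"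
    and lower: "\<And>H. H \<in> up_to \<H> (k - 1) \<Longrightarrow> quantifier_depth \<phi> \<le> component_count g H"
    and N: "quantifier_depth \<phi> \<le> N"
  shows "g \<Turnstile> \<phi> \<longleftrightarrow> limit_graph \<H> k (count_vector (\<H> k) g) N \<Turnstile> \<phi>"
  unfolding limit_graph_eq
proof (rule models_disjoint_copies[OF finite_up_to up_to_graph up_to_unique assms(1)])
  show "\<exists>H\<in>up_to \<H> k. induced_subgraph g C \<simeq> H" if "C \<in> component_sets g" for C
    using assms(2) that unfolding typical_def by blast
  show "component_count g H = (if H \<in> \<H> k then count_vector (\<H> k) g H else N) \<or>
      quantifier_depth \<phi> \<le> component_count g H \<and>
      quantifier_depth \<phi> \<le> (if H \<in> \<H> k then count_vector (\<H> k) g H else N)" if "H \<in> up_to \<H> k" for H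
    using that lower[of H] N unfolding up_to_split count_vector_def by auto
qed (use assms(3) in auto)

text \<open>The same comparison between two limit graphs: \<open>N\<close> and \<open>N'\<close>
  both lie beyond what \<open>\<phi>\<close> can resolve.\<close>

lemma limit_graph_models_iff:
  assumes "sentence \<phi>" "quantifier_depth \<phi> \<le> N" "quantifier_depth \<phi> \<le> N'"
  shows "limit_graph \<H> k m N \<Turnstile> \<phi> \<longleftrightarrow> limit_graph \<H> k m N' \<Turnstile> \<phi>"
proof -
  let ?c = "\<lambda>N H. if H \<in> \<H> k then m H else N"
  let ?G = "disjoint_copies (up_to \<H> k) (?c N)"
  have simple: "finite_simple_graph ?G"
    by (rule disjoint_copies_simple[OF finite_up_to up_to_graph(1)])
  have comp: "\<exists>H\<in>up_to \<H> k. induced_subgraph ?G C \<simeq> H" if C: "C \<in> component_sets ?G" for C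
  proof -
    have "component_sets ?G = {(\<lambda>v. (H, i, v)) ` verts H | H i. H \<in> up_to \<H> k \<and> i < ?c N H}"
      by (rule component_sets_disjoint_copies(1)[OF finite_up_to up_to_graph])
    with C obtain H i where H: "H \<in> up_to \<H> k" "i < ?c N H" "C = (\<lambda>v. (H, i, v)) ` verts H" by blast
    have "induced_subgraph ?G ((\<lambda>v. (H, i, v)) ` verts H) \<simeq> H"
      by (rule component_sets_disjoint_copies(2)) (use finite_up_to up_to_graph H(1,2) in auto)
    with H show ?thesis by blast
  qed
  have count: "component_count ?G H = ?c N H" if "H \<in> up_to \<H> k" for H
    by (rule component_count_disjoint_copies(1)[OF finite_up_to up_to_graph up_to_unique that graph_iso_refl])
  have "?G \<Turnstile> \<phi> \<longleftrightarrow> disjoint_copies (up_to \<H> k) (?c N') \<Turnstile> \<phi>"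
    by (rule models_disjoint_copies[OF finite_up_to up_to_graph up_to_unique simple comp _ assms(1)])
      (use count assms in auto)
  then show ?thesis unfolding limit_graph_eq .
qed

lemma limit_graph_eventually_constant:
  assumes "sentence \<phi>"
  shows "\<forall>\<^sub>F N in sequentially. (limit_graph \<H> k m N \<Turnstile> \<phi>) = (limit_graph \<H> k m (quantifier_depth \<phi>) \<Turnstile> \<phi>)"
  using eventually_ge_at_top[of "quantifier_depth \<phi>"]
  by eventually_elim (rule limit_graph_models_iff[OF assms], auto)

lemma eventual_truth_eq:
  assumes "sentence \<phi>"
  shows "eventual_truth \<H> k \<phi> m = of_bool (limit_graph \<H> k m (quantifier_depth \<phi>) \<Turnstile> \<phi>)"
proof -
  note const = limit_graph_eventually_constant[OF assms, of m]
  have "(\<forall>\<^sub>F N in sequentially. limit_graph \<H> k m N \<Turnstile> \<phi>) \<longleftrightarrow> limit_graph \<H> k m (quantifier_depth \<phi>) \<Turnstile> \<phi>"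
  proof
    assume "\<forall>\<^sub>F N in sequentially. limit_graph \<H> k m N \<Turnstile> \<phi>"
    with const have "\<forall>\<^sub>F N :: nat in sequentially. limit_graph \<H> k m (quantifier_depth \<phi>) \<Turnstile> \<phi>"
      by eventually_elim simp
    then show "limit_graph \<H> k m (quantifier_depth \<phi>) \<Turnstile> \<phi>" by simp
  next
    assume "limit_graph \<H> k m (quantifier_depth \<phi>) \<Turnstile> \<phi>"
    then show "\<forall>\<^sub>F N in sequentially. limit_graph \<H> k m N \<Turnstile> \<phi>"
      using const by (auto elim: eventually_mono)
  qed
  then show ?thesis unfolding eventual_truth_def by simp
qed

lemma sentence_prob_eq: "sentence_prob (M n) (random_torus_graph r X n) \<phi> = measure (graph_law n) {g. g \<Turnstile> \<phi>}"
  unfolding sentence_prob_def by (rule measure_graph_law)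

text \<open>The two events can differ only where one of finitely many events of asymptotic
  probability 1 fails, so the difference is at most the sum of the failure probabilities.\<close>

lemma asymptotically_equal:
  assumes J: "finite J" "\<And>j. j \<in> J \<Longrightarrow> (\<lambda>n. measure (graph_law n) {g. R j g}) \<longlonglongrightarrow> 1"
    and eq: "\<And>g. finite_simple_graph g \<Longrightarrow> (\<And>j. j \<in> J \<Longrightarrow> R j g) \<Longrightarrow> P g \<longleftrightarrow> Q g"
    and lim: "(\<lambda>n. measure (graph_law n) {g. Q g}) \<longlonglongrightarrow> l"
  shows "(\<lambda>n. measure (graph_law n) {g. P g}) \<longlonglongrightarrow> l"
proof -
  have "(\<lambda>n. measure (graph_law n) {g. P g} - measure (graph_law n) {g. Q g}) \<longlonglongrightarrow> 0"
  proof (rule Lim_null_comparison)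
    have "norm (measure (graph_law n) {g. P g} - measure (graph_law n) {g. Q g}) \<le>
        (\<Sum>j\<in>J. 1 - measure (graph_law n) {g. R j g})" for n
    proof -
      interpret sparse_random_graph "graph_law n" n "(2 * r n) ^ CARD('d)" by (rule sparse)
      have bad: "prob {g. \<exists>j\<in>J. \<not> R j g} \<le> (\<Sum>j\<in>J. 1 - prob {g. R j g})"
      proof -
        have "prob {g. \<not> R j g} = 1 - prob {g. R j g}" for j
          using prob_compl[of "{g. R j g}"] by (simp add: Collect_neg_eq Compl_eq_Diff_UNIV)
        then show ?thesis using prob_Ex_le[OF J(1), of "\<lambda>j g. \<not> R j g"] by (simp only:)
      qed
      have "prob {g. P g} \<le> prob {g. Q g \<or> (\<exists>j\<in>J. \<not> R j g)}" by (rule prob_le) (use eq in blast)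
      moreover have "prob {g. Q g} \<le> prob {g. P g \<or> (\<exists>j\<in>J. \<not> R j g)}" by (rule prob_le) (use eq in blast)
      moreover note prob_or_le[of Q "\<lambda>g. \<exists>j\<in>J. \<not> R j g"] prob_or_le[of P "\<lambda>g. \<exists>j\<in>J. \<not> R j g"]
      ultimately show ?thesis using bad by (simp add: abs_le_iff)
    qed
    then show "\<forall>\<^sub>F n in sequentially. norm (measure (graph_law n) {g. P g} - measure (graph_law n) {g. Q g}) \<le>
        (\<Sum>j\<in>J. 1 - measure (graph_law n) {g. R j g})" by simp
    have "(\<lambda>n. \<Sum>j\<in>J. 1 - measure (graph_law n) {g. R j g}) \<longlonglongrightarrow> (\<Sum>j\<in>J. 1 - 1)"
      by (intro tendsto_sum tendsto_diff tendsto_const J(2))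
    then show "(\<lambda>n. \<Sum>j\<in>J. 1 - measure (graph_law n) {g. R j g}) \<longlonglongrightarrow> 0" by simp
  qed
  from tendsto_add[OF this lim] show ?thesis by simp
qed

lemma count_event_limit:
  "(\<lambda>n. measure (graph_law n) {g. Q (count_vector (\<H> k) g)}) \<longlonglongrightarrow>
    measure_pmf.expectation (poisson_vector TYPE('d) a (\<H> k)) (\<lambda>m. of_bool (Q m))"
proof -
  have "(\<integral>g. of_bool (Q (count_vector (\<H> k) g)) \<partial>graph_law n) = measure (graph_law n) {g. Q (count_vector (\<H> k) g)}" for n
  proof -
    interpret sparse_random_graph "graph_law n" n "(2 * r n) ^ CARD('d)" by (rule sparse)
    have "(\<integral>g. of_bool (Q (count_vector (\<H> k) g)) \<partial>graph_law n) = (\<integral>g. indicator {g. Q (count_vector (\<H> k) g)} g \<partial>graph_law n)"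
      by (rule Bochner_Integration.integral_cong) (auto simp: indicator_def)
    also have "\<dots> = measure (graph_law n) {g. Q (count_vector (\<H> k) g)}" by simp
    finally show ?thesis .
  qed
  moreover have "(\<lambda>n. \<integral>g. (of_bool (Q (count_vector (\<H> k) g)) :: real) \<partial>graph_law n) \<longlonglongrightarrow>
      measure_pmf.expectation (poisson_vector TYPE('d) a (\<H> k)) (\<lambda>m. of_bool (Q m))"
    by (rule expectation_limit[where f = "\<lambda>m. of_bool (Q m)" and B = 1]) simp
  ultimately show ?thesis by simp
qed

lemma sentence_limit:
  assumes "sentence \<phi>"
  shows "(\<lambda>n. sentence_prob (M n) (random_torus_graph r X n) \<phi>) \<longlonglongrightarrow>
    measure_pmf.expectation (poisson_vector TYPE('d) a (\<H> k)) (eventual_truth \<H> k \<phi>)"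
proof -
  let ?q = "quantifier_depth \<phi>"
  \<comment> \<open>\<open>None\<close> stands for typicality, \<open>Some H\<close> for having
    enough components isomorphic to the small graph \<open>H\<close>.\<close>
  let ?R = "\<lambda>j g. case j of None \<Rightarrow> typical g | Some H \<Rightarrow> ?q \<le> component_count g H"
  have "(\<lambda>n. measure (graph_law n) {g. g \<Turnstile> \<phi>}) \<longlonglongrightarrow>
    measure_pmf.expectation (poisson_vector TYPE('d) a (\<H> k)) (\<lambda>m. of_bool (limit_graph \<H> k m ?q \<Turnstile> \<phi>))"
  proof (rule asymptotically_equal[where J = "insert None (Some ` up_to \<H> (k - 1))" and R = ?R])
    show "finite (insert None (Some ` up_to \<H> (k - 1)))" using finite_up_to by simp
    show "(\<lambda>n. measure (graph_law n) {g. ?R j g}) \<longlonglongrightarrow> 1" if "j \<in> insert None (Some ` up_to \<H> (k - 1))" for j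
      using that typical_limit lower_counts_limit by auto
    show "(g \<Turnstile> \<phi>) = (limit_graph \<H> k (count_vector (\<H> k) g) ?q \<Turnstile> \<phi>)"
      if "finite_simple_graph g" "\<And>j. j \<in> insert None (Some ` up_to \<H> (k - 1)) \<Longrightarrow> ?R j g" for g
    proof (rule typical_models_iff[OF that(1) _ assms])
      show "typical g" using that(2)[of None] by simp
      show "?q \<le> component_count g H" if "H \<in> up_to \<H> (k - 1)" for H
        using \<open>\<And>j. j \<in> insert None (Some ` up_to \<H> (k - 1)) \<Longrightarrow> ?R j g\<close>[of "Some H"] that by simp
    qed simp
  qed (rule count_event_limit)
  moreover have "eventual_truth \<H> k \<phi> = (\<lambda>m. of_bool (limit_graph \<H> k m ?q \<Turnstile> \<phi>))"
    by (rule ext) (rule eventual_truth_eq[OF assms])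
  ultimately show ?thesis unfolding sentence_prob_eq by (simp only:)
qed

lemma poisson_vector_pmf:
  "pmf (poisson_vector TYPE('d) a (\<H> k)) m = (if m \<in> vectors (\<H> k) then
    (\<Prod>H\<in>\<H> k. exp (- poisson_rate TYPE('d) a H) * poisson_rate TYPE('d) a H ^ m H / fact (m H)) else 0)"
  unfolding poisson_vector_def pmf_Pi[OF finite_reps[OF k1]] vectors_def
  by (auto intro!: prod.cong simp: pmf_poisson[OF poisson_rate_pos])

lemma poisson_vector_zero_prob:
  assumes "H \<in> \<H> k"
  shows "measure_pmf.expectation (poisson_vector TYPE('d) a (\<H> k)) (\<lambda>m. of_bool (m H = 0)) = exp (- poisson_rate TYPE('d) a H)"
proof -
  let ?W = "poisson_vector TYPE('d) a (\<H> k)"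
  have "map_pmf (\<lambda>m. m H) ?W = poisson_pmf (poisson_rate TYPE('d) a H)"
    unfolding poisson_vector_def using Pi_pmf_component[OF finite_reps[OF k1], of H] assms by simp
  then have "pmf (map_pmf (\<lambda>m. m H) ?W) 0 = exp (- poisson_rate TYPE('d) a H)"
    by (simp add: pmf_poisson[OF poisson_rate_pos[OF assms]])
  moreover have "pmf (map_pmf (\<lambda>m. m H) ?W) 0 = measure ?W {m. m H = 0}"
    unfolding pmf_map by (simp add: vimage_def)
  moreover have "measure_pmf.expectation ?W (\<lambda>m. of_bool (m H = 0)) = measure ?W {m. m H = 0}"
  proof -
    have "measure_pmf.expectation ?W (\<lambda>m. of_bool (m H = 0)) = (\<integral>m. indicator {m. m H = 0} m \<partial>measure_pmf ?W)"
      by (rule Bochner_Integration.integral_cong) (auto simp: indicator_def)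
    also have "\<dots> = measure ?W {m. m H = 0}" by simp
    finally show ?thesis .
  qed
  ultimately show ?thesis by (simp only:)
qed

text \<open>A clique lies in a single component, and a typical component has at most
  \<open>k\<close> vertices; so a clique on \<open>k\<close> vertices is all of its
  component.\<close>

lemma typical_clique_iff:
  assumes g: "finite_simple_graph g" "typical g" and H: "H \<in> \<H> k" "complete_graph k \<simeq> H"
  shows "g \<Turnstile> clique_sentence k \<longleftrightarrow> 0 < component_count g H"
proof
  have g': "adj g \<subseteq> verts g \<times> verts g" "sym (adj g)" "finite (verts g)"
    using g(1) unfolding finite_simple_graph_def by auto
  {
    assume "g \<Turnstile> clique_sentence k"
    then obtain K where K: "K \<subseteq> verts g" "card K = k" "\<And>u v. u \<in> K \<Longrightarrow> v \<in> K \<Longrightarrow> u \<noteq> v \<Longrightarrow> (u, v) \<in> adj g"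
      unfolding models_clique_iff[OF g(1)] by blast
    obtain v where v: "v \<in> K" using K(2) k2 by (metis card.empty ex_in_conv not_numeral_le_zero)
    obtain C where C: "C \<in> component_sets g" "v \<in> C" using ex_component[OF g'(1,2)] v K(1) by blast
    have iso: "isolated_set g C" using C(1) component_sets_iff[OF g'(1,2)] by blast
    have "K \<subseteq> C"
    proof
      fix u assume "u \<in> K"
      then show "u \<in> C" using K(1,3) v C(2) iso unfolding isolated_set_def by (cases "u = v") blast+
    qed
    moreover have "card C \<le> k" using g(2) C(1) unfolding typical_def by blast
    moreover have finC: "finite C" using C(1) component_sets_subset g'(3) finite_subset by blast
    ultimately have "K = C" using K(2) by (metis card_seteq)
    have fs: "finite_simple_graph (induced_subgraph g C)"
      by (rule finite_simple_induced[OF g(1)]) (use C(1) component_sets_subset in blast)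
    have "induced_subgraph g C \<simeq> complete_graph k"
      by (subst iso_complete_graph_iff[OF fs]) (use K \<open>K = C\<close> in auto)
    then have "induced_subgraph g C \<simeq> H" using H(2) by (rule graph_iso_trans)
    then show "0 < component_count g H" by (rule component_count_pos[OF g(1) C(1)])
  }
  {
    assume "0 < component_count g H"
    then obtain C where C: "C \<in> component_sets g" "induced_subgraph g C \<simeq> H" by (rule component_count_posD)
    have sub: "C \<subseteq> verts g" using C(1) component_sets_subset by blast
    have fs: "finite_simple_graph (induced_subgraph g C)" by (rule finite_simple_induced[OF g(1) sub])
    have card: "card (verts (induced_subgraph g C)) = k" using graph_iso_card[OF C(2)] reps_graph(4)[OF k1 H(1)] by simp
    have "induced_subgraph g C \<simeq> complete_graph k" by (rule graph_iso_trans[OF C(2) graph_iso_sym[OF H(2)]])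
    then have "\<forall>u\<in>C. \<forall>v\<in>C. u \<noteq> v \<longrightarrow> (u, v) \<in> adj g" unfolding iso_complete_graph_iff[OF fs card] by simp
    then show "g \<Turnstile> clique_sentence k" unfolding models_clique_iff[OF g(1)] using sub card by auto
  }
qed

text \<open>The limit is the probability that a Poisson variable of positive rate is nonzero, the
  rate being that of the representative of the complete graph.\<close>

lemma clique_limit:
  obtains l where "0 < l" "l < 1" "(\<lambda>n. sentence_prob (M n) (random_torus_graph r X n) (clique_sentence k)) \<longlonglongrightarrow> l"
proof -
  have "complete_graph k \<in> strictly_geometric_graphs TYPE('d) k"
    unfolding strictly_geometric_graphs_def using complete_graph_strictly_geometric[OF k2]
    by (auto simp: complete_graph_def)
  then obtain H where H: "H \<in> \<H> k" "complete_graph k \<simeq> H"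
    using reps[OF k1] unfolding iso_representatives_def by blast
  have "(\<lambda>n. measure (graph_law n) {g. (count_vector (\<H> k) g) H = 0}) \<longlonglongrightarrow> exp (- poisson_rate TYPE('d) a H)"
    using count_event_limit[of "\<lambda>m. m H = 0"] unfolding poisson_vector_zero_prob[OF H(1)] .
  then have lim: "(\<lambda>n. 1 - measure (graph_law n) {g. component_count g H = 0}) \<longlonglongrightarrow> 1 - exp (- poisson_rate TYPE('d) a H)"
    using H(1) by (intro tendsto_diff tendsto_const) (simp add: count_vector_def)
  have "1 - measure (graph_law n) {g. component_count g H = 0} = measure (graph_law n) {g. 0 < component_count g H}" for n
  proof -
    interpret sparse_random_graph "graph_law n" n "(2 * r n) ^ CARD('d)" by (rule sparse)
    show ?thesis using prob_compl[of "{g. component_count g H = 0}"] by (simp add: Collect_neg_eq[symmetric] Compl_eq_Diff_UNIV[symmetric])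
  qed
  with lim have lim': "(\<lambda>n. measure (graph_law n) {g. 0 < component_count g H}) \<longlonglongrightarrow> 1 - exp (- poisson_rate TYPE('d) a H)"
    by simp
  have "(\<lambda>n. measure (graph_law n) {g. g \<Turnstile> clique_sentence k}) \<longlonglongrightarrow> 1 - exp (- poisson_rate TYPE('d) a H)"
    by (rule asymptotically_equal[where J = "{()}" and R = "\<lambda>_. typical", OF _ _ _ lim'])
      (use typical_limit typical_clique_iff[OF _ _ H] in auto)
  then show ?thesis using that[of "1 - exp (- poisson_rate TYPE('d) a H)"] poisson_rate_pos[OF H(1)]
    unfolding sentence_prob_eq by simp
qed

lemma distribution_limit:
  "converges_in_distribution M (\<lambda>n \<omega>. count_vector (\<H> k) (random_torus_graph r X n \<omega>))
    (measure_pmf (Pi_pmf (\<H> k) 0 (\<lambda>H. poisson_pmf (poisson_rate TYPE('d) a H))))"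
  unfolding converges_in_distribution_def
proof (intro allI impI)
  fix f :: "(nat graph \<Rightarrow> nat) \<Rightarrow> real"
  assume "continuous_on UNIV f \<and> bounded (range f)"
  then obtain B where B: "\<And>m. \<bar>f m\<bar> \<le> B" unfolding bounded_iff by auto
  have "(\<integral>\<omega>. f (count_vector (\<H> k) (random_torus_graph r X n \<omega>)) \<partial>M n) = (\<integral>g. f (count_vector (\<H> k) g) \<partial>graph_law n)" for n
    unfolding graph_law_def by (rule integral_distr[symmetric, OF random_torus_graph_measurable]) simp
  then show "(\<lambda>n. \<integral>\<omega>. f (count_vector (\<H> k) (random_torus_graph r X n \<omega>)) \<partial>M n) \<longlonglongrightarrow>
      (\<integral>y. f y \<partial>measure_pmf (Pi_pmf (\<H> k) 0 (\<lambda>H. poisson_pmf (poisson_rate TYPE('d) a H))))"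
    using expectation_limit[OF B] unfolding poisson_vector_def by simp
qed

lemma lower_counts_to_infinity:
  assumes "H \<in> up_to \<H> (k - 1)"
  shows "to_infinity_in_probability M (\<lambda>n \<omega>. component_count (random_torus_graph r X n \<omega>) H)"
  unfolding to_infinity_in_probability_def with_high_probability_def
proof
  fix b :: real
  have "b \<le> real (component_count g H) \<longleftrightarrow> nat \<lceil>b\<rceil> \<le> component_count g H" for g :: "nat graph"
    by linarith
  then show "(\<lambda>n. measure (M n) {\<omega> \<in> space (M n). b \<le> real (component_count (random_torus_graph r X n \<omega>) H)}) \<longlonglongrightarrow> 1"
    using lower_counts_limit[OF assms, of "nat \<lceil>b\<rceil>"] measure_graph_law[of _ "\<lambda>g. nat \<lceil>b\<rceil> \<le> component_count g H"] by simp
qed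

lemma typical_whp:
  "with_high_probability M (\<lambda>n \<omega>. \<forall>C\<in>component_sets (random_torus_graph r X n \<omega>).
    card C \<le> k \<and> (\<exists>H\<in>up_to \<H> k. induced_subgraph (random_torus_graph r X n \<omega>) C \<simeq> H))"
  using typical_limit unfolding with_high_probability_def typical_def measure_graph_law[symmetric] .

text \<open>The Poisson weights vanish off \<open>vectors (\<H> k)\<close>, so the sum over all
  functions reduces to this set.\<close>

lemma sentence_limit_series:
  assumes "sentence \<phi>"
  shows "((\<lambda>m. eventual_truth \<H> k \<phi> m *
      (\<Prod>H\<in>\<H> k. exp (- poisson_rate TYPE('d) a H) * poisson_rate TYPE('d) a H ^ m H / fact (m H)))
    has_sum measure_pmf.expectation (poisson_vector TYPE('d) a (\<H> k)) (eventual_truth \<H> k \<phi>)) (vectors (\<H> k))"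
proof -
  have "((\<lambda>m. eventual_truth \<H> k \<phi> m * pmf (poisson_vector TYPE('d) a (\<H> k)) m)
      has_sum measure_pmf.expectation (poisson_vector TYPE('d) a (\<H> k)) (eventual_truth \<H> k \<phi>)) UNIV"
    by (rule expectation_pmf_has_sum[of _ 1]) (simp add: eventual_truth_def)
  then show ?thesis
    by (rule has_sum_cong_neutral[THEN iffD1, rotated -1]) (auto simp: poisson_vector_pmf)
qed

end

theorem theorem1p4:
  fixes k :: nat and r :: "nat \<Rightarrow> real" and a :: real
    and M :: "nat \<Rightarrow> 'w measure"
    and X :: "nat \<Rightarrow> nat \<Rightarrow> 'w \<Rightarrow> real ^ 'd"
    and \<H> :: "nat \<Rightarrow> nat graph set"
  assumes "k \<ge> 2"
    and "\<And>n. r n \<in> {0..1/2}"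
    and "a > 0"
    and "(\<lambda>n. real n ^ k * r n ^ (CARD('d) * (k - 1))) \<longlonglongrightarrow> a"
    and "\<And>n. prob_space (M n)"
    and "\<And>n. prob_space.indep_vars (M n) (\<lambda>_. borel) (X n) {1..n}"
    and "\<And>n i. i \<in> {1..n} \<Longrightarrow> distr (M n) borel (X n i) = uniform_torus"
    and "\<And>s. s \<ge> 1 \<Longrightarrow> iso_representatives (strictly_geometric_graphs TYPE('d) s) (\<H> s)"
  shows
    "converges_in_distribution M
       (\<lambda>n \<omega>. count_vector (\<H> k) (random_torus_graph r X n \<omega>))
       (measure_pmf (Pi_pmf (\<H> k) 0 (\<lambda>H. poisson_pmf (poisson_rate TYPE('d) a H))))
   \<and> (\<forall>H\<in>up_to \<H> (k - 1).
        to_infinity_in_probability M (\<lambda>n \<omega>. component_count (random_torus_graph r X n \<omega>) H))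
   \<and> with_high_probability M
       (\<lambda>n \<omega>. \<forall>C\<in>component_sets (random_torus_graph r X n \<omega>).
          card C \<le> k \<and>
          (\<exists>H\<in>up_to \<H> k. induced_subgraph (random_torus_graph r X n \<omega>) C \<simeq> H))
   \<and> (\<forall>\<phi> m. sentence \<phi> \<longrightarrow> m \<in> vectors (\<H> k) \<longrightarrow>
        (\<exists>b. \<forall>\<^sub>F N in sequentially. (limit_graph \<H> k m N \<Turnstile> \<phi>) = b))
   \<and> (\<forall>\<phi>. sentence \<phi> \<longrightarrow>
        (\<exists>l. ((\<lambda>m. eventual_truth \<H> k \<phi> m *
                 (\<Prod>H\<in>\<H> k. exp (- poisson_rate TYPE('d) a H) *
                    poisson_rate TYPE('d) a H ^ m H / fact (m H)))
              has_sum l) (vectors (\<H> k))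
           \<and> (\<lambda>n. sentence_prob (M n) (random_torus_graph r X n) \<phi>) \<longlonglongrightarrow> l))
   \<and> fo_convergence_law M (random_torus_graph r X)
   \<and> \<not> fo_zero_one_law M (random_torus_graph r X)"
proof -
  interpret critical_torus k r a M X \<H>
    by (rule critical_torus.intro[OF assms])
  have "\<not> fo_zero_one_law M (random_torus_graph r X)"
  proof
    assume *: "fo_zero_one_law M (random_torus_graph r X)"
    obtain l where l: "0 < l" "l < 1" "(\<lambda>n. sentence_prob (M n) (random_torus_graph r X n) (clique_sentence k)) \<longlonglongrightarrow> l"
      by (rule clique_limit)
    have "sentence (clique_sentence k)" using k1 by (intro sentence_clique) simp
    then obtain l' where "l' \<in> {0, 1}" "(\<lambda>n. sentence_prob (M n) (random_torus_graph r X n) (clique_sentence k)) \<longlonglongrightarrow> l'"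
      using * unfolding fo_zero_one_law_def by blast
    then show False using LIMSEQ_unique[OF l(3)] l(1,2) by auto
  qed
  moreover have "fo_convergence_law M (random_torus_graph r X)"
    unfolding fo_convergence_law_def using sentence_limit convergentI by blast
  ultimately show ?thesis
    using distribution_limit lower_counts_to_infinity typical_whp limit_graph_eventually_constant
      sentence_limit sentence_limit_series by blast
qed

end
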